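(* Let $X$ be an infinite-dimensional complex Banach space and let $T\in L(X)$. Then (i) $T\in(B)$ if and only if $\sigma_{g_zw}(T)=\sigma_{g_zd}(T)$. (ii) $T\in(B_e)$ if and only if $\sigma_{g_zf}(T)=\sigma_{g_zd}(T)$. (iii) $T\in(aB)$ if and only if $\sigma_{ug_zw}(T)=\sigma_{lg_zd}(T)$.
   Context: $L(X)$ is the algebra of bounded linear operators on $X$. All operator notions apply to bounded operators on any complex Banach space. $T_M$ is the restriction of $T$ to a $T$-invariant subspace $M$. $(M,N)\in\mathrm{Red}(T)$ means that $M,N$ are closed $T$-invariant subspaces (possibly $\{0\}$) with $X=M\oplus N$. $T$ is zeroloid if $\mathrm{acc}\,\sigma(T)\subset\{0\}$, where $\mathrm{acc}$ denotes the set of accumulation points. Classical notions: $T$ is upper semi-Fredholm if its range is closed and its kernel is finite-dimensional; lower semi-Fredholm if its range has finite codimension; semi-Fredholm if upper or lower semi-Fredholm; Fredholm if both. $\mathrm{ind}(T)=\dim\ker T-\mathrm{codim}\,\mathrm{ran}\,T$. $T$ is Weyl if Fredholm of index $0$; upper semi-Weyl if upper semi-Fredholm with index $\le 0$; Browder if Fredholm with finite ascent and descent; upper semi-Browder if upper semi-Fredholm with finite ascent. $\sigma_e,\sigma_w,\sigma_{uw},\sigma_b,\sigma_{ub}$ denote respectively the Fredholm (essential), Weyl, upper semi-Weyl, Browder, upper semi-Browder spectra, i.e. the sets of $\lambda\in\mathbb{C}$ such that $T-\lambda I$ fails to be of the corresponding type. $T\in(B)$ means $\sigma_w(T)=\sigma_b(T)$;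 $T\in(B_e)$ means $\sigma_e(T)=\sigma_b(T)$; $T\in(aB)$ means $\sigma_{uw}(T)=\sigma_{ub}(T)$. New notions: $T$ is upper semi-$g_z$-Fredholm (resp. lower semi-$g_z$-Fredholm, $g_z$-Fredholm) if there is $(M,N)\in\mathrm{Red}(T)$ such that $T_M$ is upper semi-Fredholm (resp. lower semi-Fredholm, Fredholm) and $T_N$ is zeroloid; its index is $\mathrm{ind}(T):=\mathrm{ind}(T_M)$, which does not depend on the choice of $(M,N)\in\mathrm{Red}(T)$ with $T_M$ semi-Fredholm and $T_N$ zeroloid. $T$ is $g_z$-Weyl if it is $g_z$-Fredholm with $\mathrm{ind}(T)=0$, and upper semi-$g_z$-Weyl if it is upper semi-$g_z$-Fredholm with $\mathrm{ind}(T)\le0$. $T$ is left (resp. right) $g_z$-invertible if there is $(M,N)\in\mathrm{Red}(T)$ such that $T_M$ is bounded below (resp. surjective) and $T_N$ is zeroloid; $T$ is $g_z$-invertible if it is both left and right $g_z$-invertible. $\sigma_{g_zf},\sigma_{g_zw},\sigma_{ug_zw},\sigma_{g_zd},\sigma_{lg_zd}$ denote the sets of $\lambda\in\mathbb{C}$ such that $T-\lambda I$ is not, respectively, $g_z$-Fredholm, $g_z$-Weyl, upper semi-$g_z$-Weyl, $g_z$-invertible, left $g_z$-invertible. *)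

theory Defs
  imports "HOL-Analysis.Analysis"
begin

section \<open>Complex Banach spaces\<close>

(* The distribution has no class of complex normed spaces.  The underlying real structure is
   the one of class banach, and the complex scaling extends the real one. *)
class complex_banach = banach +
  fixes scaleC :: "complex \<Rightarrow> 'a \<Rightarrow> 'a" (infixr \<open>*\<^sub>C\<close> 75)
  assumes scaleC_add_right: "c *\<^sub>C (x + y) = c *\<^sub>C x + c *\<^sub>C y"
    and scaleC_add_left: "(c + d) *\<^sub>C x = c *\<^sub>C x + d *\<^sub>C x"
    and scaleC_scaleC: "c *\<^sub>C (d *\<^sub>C x) = (c * d) *\<^sub>C x"
    and scaleC_one: "1 *\<^sub>C x = x"
    and scaleR_scaleC: "scaleR r x = complex_of_real r *\<^sub>C x"
    and norm_scaleC: "norm (c *\<^sub>C x) = cmod c * norm x"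

instantiation complex :: complex_banach
begin

definition scaleC_complex :: "complex \<Rightarrow> complex \<Rightarrow> complex" where
  "scaleC_complex c x = c * x"

instance
  by standard (simp_all add: scaleC_complex_def algebra_simps norm_mult scaleR_conv_of_real)

end

interpretation complex_vector: vector_space "scaleC :: complex \<Rightarrow> 'a \<Rightarrow> 'a::complex_banach"
  by unfold_locales (simp_all add: scaleC_add_right scaleC_add_left scaleC_scaleC scaleC_one)


section \<open>Dimension and codimension\<close>

definition edim :: "'a::complex_banach set \<Rightarrow> enat" where
  "edim V = (if \<exists>B. finite B \<and> V \<subseteq> complex_vector.span B
             then enat (complex_vector.dim V) else \<infinity>)"

definition complement_in :: "'a::complex_banach set \<Rightarrow> 'a set \<Rightarrow> 'a set \<Rightarrow> bool" where
  "complement_in M R F \<longleftrightarrow> complex_vector.subspace F \<and> F \<subseteq> M \<and> R \<inter> F = {0} \<and>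
     (\<forall>x\<in>M. \<exists>r\<in>R. \<exists>f\<in>F. x = r + f)"

(* The dimension of M / R, for a subspace R of M, read off an algebraic complement of R in M:
   one exists by complement_in_exists, and the choice is irrelevant by codim_eq. *)
definition codim :: "'a::complex_banach set \<Rightarrow> 'a set \<Rightarrow> enat" where
  "codim M R = edim (SOME F. complement_in M R F)"

lemma complement_in_exists:
  fixes R :: "'a::complex_banach set"
  assumes R: "complex_vector.subspace R" and M: "complex_vector.subspace M" and "R \<subseteq> M"
  shows "\<exists>F. complement_in M R F"
proof -
  interpret pair: vector_space_pair "scaleC :: complex \<Rightarrow> 'a \<Rightarrow> 'a" "scaleC :: complex \<Rightarrow> 'a \<Rightarrow> 'a"
    by unfold_locales
  obtain p :: "'a \<Rightarrow> 'a" where p: "range p \<subseteq> R" "\<And>v. v \<in> R \<Longrightarrow> p v = v"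
      and lin: "Vector_Spaces.linear scaleC scaleC p"
    using pair.linear_exists_left_inverse_on[OF complex_vector.linear_ident R] by auto
  interpret p: Vector_Spaces.linear scaleC scaleC p
    by (fact lin)
  let ?F = "{x \<in> M. p x = 0}"
  have "complex_vector.subspace ?F"
    using M by (auto simp: complex_vector.subspace_def p.add p.scale p.zero)
  moreover have "R \<inter> ?F = {0}"
    using p(2) complex_vector.subspace_0[OF R] complex_vector.subspace_0[OF M]
    by (auto simp: p.zero)
  moreover have "\<exists>r\<in>R. \<exists>f\<in>?F. x = r + f" if "x \<in> M" for x
  proof (intro bexI)
    show "p x \<in> R"
      using p(1) by blast
    then have "p (p x) = p x" and "p x \<in> M"
      using p(2) assms(3) by auto
    then show "x - p x \<in> ?F"
      using that complex_vector.subspace_diff[OF M] by (auto simp: p.diff)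
  qed simp
  ultimately show ?thesis
    unfolding complement_in_def by (intro exI[of _ ?F]) auto
qed

lemma edim_complement_le:
  fixes R :: "'a::complex_banach set"
  assumes R: "complex_vector.subspace R" and "R \<subseteq> M"
    and F: "complement_in M R F" and G: "complement_in M R G"
  shows "edim G \<le> edim F"
proof (cases "\<exists>B. finite B \<and> F \<subseteq> complex_vector.span B")
  case False
  then have "edim F = \<infinity>"
    unfolding edim_def by (simp only: if_False)
  then show ?thesis
    by simp
next
  case True
  then obtain C where C: "finite C" "F \<subseteq> complex_vector.span C"
    by blast
  obtain B where B: "B \<subseteq> F" "complex_vector.independent B" "F \<subseteq> complex_vector.span B"
      "card B = complex_vector.dim F"
    using complex_vector.basis_exists by blast
  have finB: "finite B"
    using complex_vector.independent_span_bound[OF C(1) B(2)] B(1) C(2) by blast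
  have subG: "complex_vector.subspace G"
    using G by (simp add: complement_in_def)
  have "\<exists>g\<in>G. b - g \<in> R" if "b \<in> B" for b
  proof -
    from that B(1) F have "b \<in> M"
      by (auto simp: complement_in_def)
    then obtain r g where "r \<in> R" "g \<in> G" "b = r + g"
      using G unfolding complement_in_def by blast
    then show ?thesis
      by (intro bexI[of _ g]) auto
  qed
  then obtain p where p: "\<And>b. b \<in> B \<Longrightarrow> p b \<in> G \<and> b - p b \<in> R"
    by metis
  have spanG: "complex_vector.span (p ` B) \<subseteq> G"
    using p subG by (intro complex_vector.span_minimal) auto
  have approx: "\<exists>g\<in>complex_vector.span (p ` B). f - g \<in> R"
    if "f \<in> complex_vector.span B" for f
    using that
  proof (induction rule: complex_vector.span_induct_alt)
    case base
    show ?case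
      using complex_vector.subspace_0[OF R]
      by (intro bexI[of _ 0]) (auto simp: complex_vector.span_zero)
  next
    case (step c x y)
    then obtain g where g: "g \<in> complex_vector.span (p ` B)" "y - g \<in> R"
      by blast
    have "c *\<^sub>C x + y - (c *\<^sub>C p x + g) = c *\<^sub>C (x - p x) + (y - g)"
      by (simp add: complex_vector.scale_right_diff_distrib)
    moreover have "\<dots> \<in> R"
      using p[OF \<open>x \<in> B\<close>] g R
      by (intro complex_vector.subspace_add complex_vector.subspace_scale) auto
    moreover have "c *\<^sub>C p x + g \<in> complex_vector.span (p ` B)"
      using complex_vector.span_add[OF complex_vector.span_scale
          [OF complex_vector.span_base[OF imageI[OF \<open>x \<in> B\<close>]]] g(1)] .
    ultimately show ?case
      by metis
  qed
  have spans: "G \<subseteq> complex_vector.span (p ` B)"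
  proof
    fix x assume x: "x \<in> G"
    then have "x \<in> M"
      using G by (auto simp: complement_in_def)
    then obtain r f where rf: "r \<in> R" "f \<in> F" "x = r + f"
      using F unfolding complement_in_def by blast
    obtain g where g: "g \<in> complex_vector.span (p ` B)" "f - g \<in> R"
      using approx B(3) rf(2) by blast
    have "x - g \<in> R"
      using complex_vector.subspace_add[OF R rf(1) g(2)] rf(3) by (simp add: algebra_simps)
    moreover have "x - g \<in> G"
      using complex_vector.subspace_diff[OF subG x] g(1) spanG by blast
    moreover have "R \<inter> G = {0}"
      using G by (simp add: complement_in_def)
    ultimately have "x - g = 0"
      by blast
    with g(1) show "x \<in> complex_vector.span (p ` B)"
      by simp
  qed
  have "complex_vector.dim G \<le> card (p ` B)"
    using spans finB by (intro complex_vector.dim_le_card) auto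
  also have "\<dots> \<le> complex_vector.dim F"
    using card_image_le[OF finB, of p] B(4) by simp
  finally have dim_le: "complex_vector.dim G \<le> complex_vector.dim F" .
  have "\<exists>B. finite B \<and> G \<subseteq> complex_vector.span B"
    using spans finB by blast
  with True dim_le show ?thesis
    unfolding edim_def by (simp only: if_True enat_ord_simps)
qed

lemma codim_eq:
  fixes R :: "'a::complex_banach set"
  assumes "complex_vector.subspace R" and "R \<subseteq> M" and "complement_in M R F"
  shows "codim M R = edim F"
proof -
  have "complement_in M R (SOME F. complement_in M R F)"
    using assms(3) by (rule someI)
  then show ?thesis
    unfolding codim_def using edim_complement_le assms by (intro antisym) blast+
qed


section \<open>Classical notions for the restriction of an operator to a closed invariant subspace\<close>

(* An operator on a closed subspace M is represented by a function on the whole type, of which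
   only the values on M matter; hence T also represents its restriction to an invariant M.
   The space X itself is UNIV. *)

definition bounded_op :: "'a::complex_banach set \<Rightarrow> ('a \<Rightarrow> 'a) \<Rightarrow> bool" where
  "bounded_op M T \<longleftrightarrow> (\<forall>x\<in>M. T x \<in> M) \<and>
     (\<forall>x\<in>M. \<forall>y\<in>M. T (x + y) = T x + T y) \<and>
     (\<forall>c. \<forall>x\<in>M. T (c *\<^sub>C x) = c *\<^sub>C T x) \<and>
     (\<exists>K. \<forall>x\<in>M. norm (T x) \<le> K * norm x)"

lemma bounded_op_UNIV:
  "bounded_op UNIV T \<longleftrightarrow> bounded_linear T \<and> (\<forall>c x. T (c *\<^sub>C x) = c *\<^sub>C T x)"
  unfolding bounded_op_def bounded_linear_def bounded_linear_axioms_def linear_iff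
  by (auto simp: scaleR_scaleC mult.commute)

definition shift :: "('a::complex_banach \<Rightarrow> 'a) \<Rightarrow> complex \<Rightarrow> 'a \<Rightarrow> 'a" where
  "shift T \<mu> = (\<lambda>x. T x - \<mu> *\<^sub>C x)"

definition invertible_op :: "'a::complex_banach set \<Rightarrow> ('a \<Rightarrow> 'a) \<Rightarrow> bool" where
  "invertible_op M T \<longleftrightarrow> (\<exists>S. bounded_op M S \<and> (\<forall>x\<in>M. S (T x) = x \<and> T (S x) = x))"

definition spectrum_op :: "'a::complex_banach set \<Rightarrow> ('a \<Rightarrow> 'a) \<Rightarrow> complex set" where
  "spectrum_op M T = {\<mu>. \<not> invertible_op M (shift T \<mu>)}"

definition zeroloid :: "'a::complex_banach set \<Rightarrow> ('a \<Rightarrow> 'a) \<Rightarrow> bool" where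
  "zeroloid M T \<longleftrightarrow> {\<mu>. \<mu> islimpt spectrum_op M T} \<subseteq> {0}"

definition kernel_op :: "'a::complex_banach set \<Rightarrow> ('a \<Rightarrow> 'a) \<Rightarrow> 'a set" where
  "kernel_op M T = {x \<in> M. T x = 0}"

definition bounded_below :: "'a::complex_banach set \<Rightarrow> ('a \<Rightarrow> 'a) \<Rightarrow> bool" where
  "bounded_below M T \<longleftrightarrow> (\<exists>c>0. \<forall>x\<in>M. c * norm x \<le> norm (T x))"

definition surjective_op :: "'a::complex_banach set \<Rightarrow> ('a \<Rightarrow> 'a) \<Rightarrow> bool" where
  "surjective_op M T \<longleftrightarrow> T ` M = M"

definition upper_semi_fredholm :: "'a::complex_banach set \<Rightarrow> ('a \<Rightarrow> 'a) \<Rightarrow> bool" where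
  "upper_semi_fredholm M T \<longleftrightarrow> closed (T ` M) \<and> edim (kernel_op M T) < \<infinity>"

definition lower_semi_fredholm :: "'a::complex_banach set \<Rightarrow> ('a \<Rightarrow> 'a) \<Rightarrow> bool" where
  "lower_semi_fredholm M T \<longleftrightarrow> codim M (T ` M) < \<infinity>"

definition semi_fredholm :: "'a::complex_banach set \<Rightarrow> ('a \<Rightarrow> 'a) \<Rightarrow> bool" where
  "semi_fredholm M T \<longleftrightarrow> upper_semi_fredholm M T \<or> lower_semi_fredholm M T"

definition fredholm :: "'a::complex_banach set \<Rightarrow> ('a \<Rightarrow> 'a) \<Rightarrow> bool" where
  "fredholm M T \<longleftrightarrow> upper_semi_fredholm M T \<and> lower_semi_fredholm M T"

(* Meaningful for semi-Fredholm operators only, where at most one of the terms is infinite. *)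
definition index_op :: "'a::complex_banach set \<Rightarrow> ('a \<Rightarrow> 'a) \<Rightarrow> ereal" where
  "index_op M T = ereal_of_enat (edim (kernel_op M T)) - ereal_of_enat (codim M (T ` M))"

definition weyl :: "'a::complex_banach set \<Rightarrow> ('a \<Rightarrow> 'a) \<Rightarrow> bool" where
  "weyl M T \<longleftrightarrow> fredholm M T \<and> index_op M T = 0"

definition upper_semi_weyl :: "'a::complex_banach set \<Rightarrow> ('a \<Rightarrow> 'a) \<Rightarrow> bool" where
  "upper_semi_weyl M T \<longleftrightarrow> upper_semi_fredholm M T \<and> index_op M T \<le> 0"

definition finite_ascent :: "'a::complex_banach set \<Rightarrow> ('a \<Rightarrow> 'a) \<Rightarrow> bool" where
  "finite_ascent M T \<longleftrightarrow> (\<exists>n. kernel_op M (T ^^ n) = kernel_op M (T ^^ Suc n))"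

definition finite_descent :: "'a::complex_banach set \<Rightarrow> ('a \<Rightarrow> 'a) \<Rightarrow> bool" where
  "finite_descent M T \<longleftrightarrow> (\<exists>n. (T ^^ n) ` M = (T ^^ Suc n) ` M)"

definition browder :: "'a::complex_banach set \<Rightarrow> ('a \<Rightarrow> 'a) \<Rightarrow> bool" where
  "browder M T \<longleftrightarrow> fredholm M T \<and> finite_ascent M T \<and> finite_descent M T"

definition upper_semi_browder :: "'a::complex_banach set \<Rightarrow> ('a \<Rightarrow> 'a) \<Rightarrow> bool" where
  "upper_semi_browder M T \<longleftrightarrow> upper_semi_fredholm M T \<and> finite_ascent M T"


section \<open>The classical spectra of an operator on the whole space\<close>

definition fredholm_spectrum :: "('a::complex_banach \<Rightarrow> 'a) \<Rightarrow> complex set" where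
  "fredholm_spectrum T = {\<mu>. \<not> fredholm UNIV (shift T \<mu>)}"

definition weyl_spectrum :: "('a::complex_banach \<Rightarrow> 'a) \<Rightarrow> complex set" where
  "weyl_spectrum T = {\<mu>. \<not> weyl UNIV (shift T \<mu>)}"

definition upper_semi_weyl_spectrum :: "('a::complex_banach \<Rightarrow> 'a) \<Rightarrow> complex set" where
  "upper_semi_weyl_spectrum T = {\<mu>. \<not> upper_semi_weyl UNIV (shift T \<mu>)}"

definition browder_spectrum :: "('a::complex_banach \<Rightarrow> 'a) \<Rightarrow> complex set" where
  "browder_spectrum T = {\<mu>. \<not> browder UNIV (shift T \<mu>)}"

definition upper_semi_browder_spectrum :: "('a::complex_banach \<Rightarrow> 'a) \<Rightarrow> complex set" where
  "upper_semi_browder_spectrum T = {\<mu>. \<not> upper_semi_browder UNIV (shift T \<mu>)}"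

definition class_B :: "('a::complex_banach \<Rightarrow> 'a) \<Rightarrow> bool" where
  "class_B T \<longleftrightarrow> weyl_spectrum T = browder_spectrum T"

definition class_Be :: "('a::complex_banach \<Rightarrow> 'a) \<Rightarrow> bool" where
  "class_Be T \<longleftrightarrow> fredholm_spectrum T = browder_spectrum T"

definition class_aB :: "('a::complex_banach \<Rightarrow> 'a) \<Rightarrow> bool" where
  "class_aB T \<longleftrightarrow> upper_semi_weyl_spectrum T = upper_semi_browder_spectrum T"


section \<open>The notions relative to zeroloid summands\<close>

definition Red :: "('a::complex_banach \<Rightarrow> 'a) \<Rightarrow> ('a set \<times> 'a set) set" where
  "Red T = {(M, N).
     complex_vector.subspace M \<and> closed M \<and> (\<forall>x\<in>M. T x \<in> M) \<and>
     complex_vector.subspace N \<and> closed N \<and> (\<forall>x\<in>N. T x \<in> N) \<and>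
     M \<inter> N = {0} \<and> (\<forall>x. \<exists>m\<in>M. \<exists>n\<in>N. x = m + n)}"

definition upper_semi_gz_fredholm :: "('a::complex_banach \<Rightarrow> 'a) \<Rightarrow> bool" where
  "upper_semi_gz_fredholm T \<longleftrightarrow>
     (\<exists>(M, N) \<in> Red T. upper_semi_fredholm M T \<and> zeroloid N T)"

definition gz_fredholm :: "('a::complex_banach \<Rightarrow> 'a) \<Rightarrow> bool" where
  "gz_fredholm T \<longleftrightarrow> (\<exists>(M, N) \<in> Red T. fredholm M T \<and> zeroloid N T)"

(* The common value of the index over all admissible decompositions. *)
definition gz_index :: "('a::complex_banach \<Rightarrow> 'a) \<Rightarrow> ereal" where
  "gz_index T =
     (THE k. \<exists>(M, N) \<in> Red T. semi_fredholm M T \<and> zeroloid N T \<and> k = index_op M T)"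

definition gz_weyl :: "('a::complex_banach \<Rightarrow> 'a) \<Rightarrow> bool" where
  "gz_weyl T \<longleftrightarrow> gz_fredholm T \<and> gz_index T = 0"

definition upper_semi_gz_weyl :: "('a::complex_banach \<Rightarrow> 'a) \<Rightarrow> bool" where
  "upper_semi_gz_weyl T \<longleftrightarrow> upper_semi_gz_fredholm T \<and> gz_index T \<le> 0"

definition left_gz_invertible :: "('a::complex_banach \<Rightarrow> 'a) \<Rightarrow> bool" where
  "left_gz_invertible T \<longleftrightarrow> (\<exists>(M, N) \<in> Red T. bounded_below M T \<and> zeroloid N T)"

definition right_gz_invertible :: "('a::complex_banach \<Rightarrow> 'a) \<Rightarrow> bool" where
  "right_gz_invertible T \<longleftrightarrow> (\<exists>(M, N) \<in> Red T. surjective_op M T \<and> zeroloid N T)"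

definition gz_invertible :: "('a::complex_banach \<Rightarrow> 'a) \<Rightarrow> bool" where
  "gz_invertible T \<longleftrightarrow> left_gz_invertible T \<and> right_gz_invertible T"

definition gz_fredholm_spectrum :: "('a::complex_banach \<Rightarrow> 'a) \<Rightarrow> complex set" where
  "gz_fredholm_spectrum T = {\<mu>. \<not> gz_fredholm (shift T \<mu>)}"

definition gz_weyl_spectrum :: "('a::complex_banach \<Rightarrow> 'a) \<Rightarrow> complex set" where
  "gz_weyl_spectrum T = {\<mu>. \<not> gz_weyl (shift T \<mu>)}"

definition upper_semi_gz_weyl_spectrum :: "('a::complex_banach \<Rightarrow> 'a) \<Rightarrow> complex set" where
  "upper_semi_gz_weyl_spectrum T = {\<mu>. \<not> upper_semi_gz_weyl (shift T \<mu>)}"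

definition gz_invertible_spectrum :: "('a::complex_banach \<Rightarrow> 'a) \<Rightarrow> complex set" where
  "gz_invertible_spectrum T = {\<mu>. \<not> gz_invertible (shift T \<mu>)}"

definition left_gz_invertible_spectrum :: "('a::complex_banach \<Rightarrow> 'a) \<Rightarrow> complex set" where
  "left_gz_invertible_spectrum T = {\<mu>. \<not> left_gz_invertible (shift T \<mu>)}"

end

theory Submission
  imports Defs
begin

text \<open>Write \<open>S = T - \<lambda>I\<close>. In each of the three cases one inclusion of the two generalized spectra always holds,
so the equality of spectra says that every \<open>S\<close> of generalized Weyl (Fredholm, upper semi-Weyl) type
is already generalized invertible (left invertible), just as the class condition says that every
\<open>S\<close> of Weyl (Fredholm, upper semi-Weyl) type is already Browder (upper semi-Browder). The two
implications are transferred into each other by moving to operators \<open>S - \<mu>I\<close> with \<open>\<mu>\<close> small.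

Let \<open>X = M \<oplus> N\<close> with \<open>S\<close> semi-Fredholm on \<open>M\<close> and zeroloid on \<open>N\<close>. Nonzero points are not
accumulation points of the spectrum of the zeroloid part, so there are arbitrarily small \<open>\<mu>\<close> for which
\<open>S - \<mu>I\<close> is invertible on \<open>N\<close> (\<open>zeroloid_gap\<close>); for these, \<open>S - \<mu>I\<close> on \<open>X\<close> has the same kernel,
codimension and index as on \<open>M\<close> (\<open>splits_invertible_part\<close>), and by stability of the index
(\<open>upper_semi_fredholm_shift_near\<close>, \<open>lower_semi_fredholm_shift_near\<close>) this is the index of \<open>S\<close> on \<open>M\<close>.
This makes the generalized index independent of the splitting (\<open>gz_index_eq\<close>), and it lets the class
condition act on \<open>S - \<mu>I\<close>, which is therefore Browder. A Browder operator is invertible after every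
small nonzero shift (\<open>browder_bij_nearby\<close>), so \<open>S\<close> on \<open>M\<close> becomes invertible after arbitrarily small shifts; in the upper semi-Browder case,
injective (\<open>upper_semi_browder_injective_nearby\<close>).

The heart of the matter is then a converse (\<open>splitting_if_injective_nearby\<close>, \<open>splitting_if_bij_nearby\<close>): an upper
semi-Fredholm operator that becomes injective (invertible) after arbitrarily small shifts is the direct
sum of a bounded below (invertible) operator and a nilpotent one. It rests on the Kato decomposition
(\<open>kato_decomposition\<close>): up to a nilpotent summand, the kernel lies in the range of every power, and a
nonzero kernel of this kind survives every small shift, because a kernel vector is the constant term
of a power series in \<open>\<mu>\<close> of eigenvectors (\<open>kernel_persists_in_hyperrange\<close>). Moving the nilpotent summand
of \<open>M\<close> over to the zeroloid part \<open>N\<close> yields the generalized inverse. In the other direction, a Fredholm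
operator that is generalized invertible also becomes invertible after arbitrarily small shifts, and
the same splitting shows that its ascent and descent are finite; likewise for upper semi-Fredholm,
left invertibility, injectivity and ascent.

The functional analysis underneath is the Hahn-Banach theorem, used to complement finite-dimensional
subspaces and to find the commuting projections of the Kato decomposition, and the open mapping theorem.\<close>


section \<open>The Hahn-Banach theorem\<close>

definition sublinear :: "('b::real_vector \<Rightarrow> real) \<Rightarrow> bool" where
  "sublinear q \<longleftrightarrow> (\<forall>x y. q (x + y) \<le> q x + q y) \<and> (\<forall>t\<ge>0. \<forall>x. q (t *\<^sub>R x) = t * q x)"

lemma sublinearI:
  assumes add: "\<And>x y. q (x + y) \<le> q x + q y" and zero: "q 0 = 0"
    and scale: "\<And>t x. t > 0 \<Longrightarrow> q (t *\<^sub>R x) \<le> t * q x"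
  shows "sublinear q"
proof -
  have "q (t *\<^sub>R x) = t * q x" if "t \<ge> 0" for t x
  proof (cases "t = 0")
    case False
    then have t: "t > 0" using that by simp
    have "q x = q ((1 / t) *\<^sub>R (t *\<^sub>R x))" using t by simp
    also have "\<dots> \<le> (1 / t) * q (t *\<^sub>R x)" using t by (intro scale) simp
    finally have "t * q x \<le> q (t *\<^sub>R x)" using t by (simp add: field_simps)
    with scale[OF t, of x] show ?thesis by simp
  qed (simp add: zero)
  with add show ?thesis by (simp add: sublinear_def)
qed

lemma sublinear_zero: "sublinear q \<Longrightarrow> q 0 = 0"
  unfolding sublinear_def by (metis mult_zero_left order_refl scaleR_zero_left)

lemma sublinear_minus: "sublinear q \<Longrightarrow> - q (- x) \<le> q x"
  using sublinear_zero[of q] unfolding sublinear_def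
  by (metis add.right_inverse diff_ge_0_iff_ge diff_minus_eq_add add.commute)

text \<open>Subtracting the rate \<open>p y\<close> along the ray through \<open>y\<close> and taking the infimum gives the sublinear function
below \<open>p\<close> that is as small as possible in the direction \<open>- y\<close>. A minimal sublinear function cannot decrease
under this operation, which is what makes it additive.\<close>

lemma sublinear_decrease:
  fixes p :: "'b::real_vector \<Rightarrow> real"
  assumes p: "sublinear p"
  shows "\<exists>q. sublinear q \<and> q \<le> p \<and> (\<forall>x. q x \<le> p (x + y) - p y)"
proof -
  have sub: "p (x + z) \<le> p x + p z" and hom: "t \<ge> 0 \<Longrightarrow> p (t *\<^sub>R x) = t * p x" for x z t
    using p by (auto simp: sublinear_def)
  define q where "q x = (INF t\<in>{0..}. p (x + t *\<^sub>R y) - t * p y)" for x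
  have bdd: "bdd_below ((\<lambda>t. p (x + t *\<^sub>R y) - t * p y) ` {0..})" for x
  proof (rule bdd_belowI2)
    fix t :: real assume "t \<in> {0..}"
    then show "- p (- x) \<le> p (x + t *\<^sub>R y) - t * p y"
      using sub[of "x + t *\<^sub>R y" "- x"] hom[of t y] by simp
  qed
  have qle: "q x \<le> p (x + t *\<^sub>R y) - t * p y" if "t \<ge> 0" for x t
    unfolding q_def using that bdd by (intro cINF_lower) auto
  have qge: "c \<le> q x" if "\<And>t. t \<ge> 0 \<Longrightarrow> c \<le> p (x + t *\<^sub>R y) - t * p y" for c x
    unfolding q_def using that by (intro cINF_greatest) auto
  have "sublinear q"
  proof (rule sublinearI)
    fix x z
    have "q (x + z) - (p (z + s *\<^sub>R y) - s * p y) \<le> q x" if s: "s \<ge> 0" for s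
    proof (rule qge)
      fix t :: real assume t: "t \<ge> 0"
      have "q (x + z) \<le> p ((x + t *\<^sub>R y) + (z + s *\<^sub>R y)) - (t + s) * p y"
        using qle[of "t + s" "x + z"] s t by (simp add: algebra_simps)
      also have "\<dots> \<le> p (x + t *\<^sub>R y) + p (z + s *\<^sub>R y) - (t + s) * p y"
        using sub by simp
      finally show "q (x + z) - (p (z + s *\<^sub>R y) - s * p y) \<le> p (x + t *\<^sub>R y) - t * p y"
        by (simp add: algebra_simps)
    qed
    then have "q (x + z) - q x \<le> q z" by (intro qge) (simp add: algebra_simps)
    then show "q (x + z) \<le> q x + q z" by simp
  next
    show "q 0 = 0"
    proof (rule antisym)
      show "q 0 \<le> 0" using qle[of 0 0] sublinear_zero[OF p] by simp
      show "0 \<le> q 0" using hom by (intro qge) simp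
    qed
  next
    fix t :: real and x assume t: "t > 0"
    have "q (t *\<^sub>R x) / t \<le> q x"
    proof (rule qge)
      fix s :: real assume s: "s \<ge> 0"
      have "q (t *\<^sub>R x) \<le> p (t *\<^sub>R (x + s *\<^sub>R y)) - (t * s) * p y"
        using qle[of "t * s" "t *\<^sub>R x"] s t by (simp add: algebra_simps)
      also have "\<dots> = t * (p (x + s *\<^sub>R y) - s * p y)" using t by (simp add: hom right_diff_distrib)
      finally show "q (t *\<^sub>R x) / t \<le> p (x + s *\<^sub>R y) - s * p y" using t by (simp add: field_simps)
    qed
    then show "q (t *\<^sub>R x) \<le> t * q x" using t by (simp add: field_simps)
  qed
  moreover have "q \<le> p" using qle[of 0] by (auto simp: le_fun_def)
  moreover have "q x \<le> p (x + y) - p y" for x using qle[of 1 x] by simp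
  ultimately show ?thesis by blast
qed

text \<open>Zorn's lemma: the pointwise infimum of a chain is again sublinear, and it is finite because every
member \<open>q\<close> of the chain satisfies \<open>- p (- x) \<le> - q (- x) \<le> q x\<close>.\<close>

lemma minimal_sublinear_exists:
  fixes p :: "'b::real_vector \<Rightarrow> real"
  assumes p: "sublinear p"
  shows "\<exists>m. sublinear m \<and> m \<le> p \<and> (\<forall>q. sublinear q \<and> q \<le> m \<longrightarrow> q = m)"
proof -
  let ?A = "{q. sublinear q \<and> q \<le> p}"
  have "\<exists>m\<in>?A. \<forall>q\<in>?A. m \<ge> q \<longrightarrow> q = m"
  proof (rule predicate_Zorn)
    show "partial_order_on ?A (relation_of (\<ge>) ?A)"
      by (auto simp: partial_order_on_def preorder_on_def refl_on_def trans_def antisym_def relation_of_def)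
  next
    fix C assume "C \<in> Chains (relation_of (\<ge>) ?A)"
    then have chain: "q \<in> ?A" "r \<in> ?A" "q \<le> r \<or> r \<le> q" if "q \<in> C" "r \<in> C" for q r
      using that by (auto simp: Chains_def relation_of_def)
    show "\<exists>u\<in>?A. \<forall>q\<in>C. q \<ge> u"
    proof (cases "C = {}")
      case True
      then show ?thesis using p by auto
    next
      case False
      then obtain q0 where q0: "q0 \<in> C" by blast
      define u where "u x = (INF q\<in>C. q x)" for x
      have bdd: "bdd_below ((\<lambda>q. q x) ` C)" for x
      proof (rule bdd_belowI2)
        fix q assume "q \<in> C"
        then have "sublinear q" "q (- x) \<le> p (- x)" using chain by (auto simp: le_fun_def)
        then show "- p (- x) \<le> q x" using sublinear_minus[of q x] by simp
      qed
      have ule: "u x \<le> q x" if "q \<in> C" for x q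
        unfolding u_def using bdd that by (rule cINF_lower)
      have uge: "c \<le> u x" if "\<And>q. q \<in> C \<Longrightarrow> c \<le> q x" for c x
        unfolding u_def using that False by (intro cINF_greatest) auto
      have "sublinear u"
      proof (rule sublinearI)
        fix x y
        have "u (x + y) - r y \<le> u x" if r: "r \<in> C" for r
        proof (rule uge)
          fix q assume q: "q \<in> C"
          obtain s where s: "s \<in> C" "s \<le> q" "s \<le> r" using chain[OF q r] q r by auto
          then have "u (x + y) \<le> s x + s y" using ule[OF s(1), of "x + y"] chain(1)[OF s(1) s(1)]
            by (auto simp: sublinear_def intro: order_trans)
          also have "\<dots> \<le> q x + r y" using s by (intro add_mono) (auto simp: le_fun_def)
          finally show "u (x + y) - r y \<le> q x" by simp
        qed
        then have "u (x + y) - u x \<le> u y" by (intro uge) (simp add: algebra_simps)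
        then show "u (x + y) \<le> u x + u y" by simp
      next
        have "q 0 = 0" if "q \<in> C" for q using chain[of q q] that sublinear_zero by auto
        then show "u 0 = 0" using ule[OF q0, of 0] uge[of 0 0] q0 by fastforce
      next
        fix t :: real and x assume t: "t > 0"
        have "u (t *\<^sub>R x) / t \<le> u x"
        proof (rule uge)
          fix q assume q: "q \<in> C"
          then have "u (t *\<^sub>R x) \<le> t * q x" using ule[OF q, of "t *\<^sub>R x"] chain[of q q] t
            by (auto simp: sublinear_def)
          then show "u (t *\<^sub>R x) / t \<le> q x" using t by (simp add: field_simps)
        qed
        then show "u (t *\<^sub>R x) \<le> t * u x" using t by (simp add: field_simps)
      qed
      moreover have "u \<le> p"
        using ule[OF q0] chain[OF q0 q0] by (auto simp: le_fun_def intro: order_trans)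
      ultimately show ?thesis using ule by (auto simp: le_fun_def)
    qed
  qed
  then show ?thesis by (metis (mono_tags, lifting) mem_Collect_eq order_trans)
qed

text \<open>Minimal sublinear functions are linear. Starting the descent from a function that takes the value
\<open>- p x0\<close> at \<open>- x0\<close> forces equality at \<open>x0\<close>.\<close>

lemma real_hahn_banach:
  fixes p :: "'b::real_vector \<Rightarrow> real"
  assumes p: "sublinear p"
  shows "\<exists>g. linear g \<and> g \<le> p \<and> g x0 = p x0"
proof -
  obtain p0 where p0: "sublinear p0" "p0 \<le> p" "\<And>x. p0 x \<le> p (x + x0) - p x0"
    using sublinear_decrease[OF p] by blast
  obtain m where m: "sublinear m" "m \<le> p0" "\<And>q. sublinear q \<Longrightarrow> q \<le> m \<Longrightarrow> q = m"
    using minimal_sublinear_exists[OF p0(1)] by blast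
  have sub: "m (x + z) \<le> m x + m z" and hom: "t \<ge> 0 \<Longrightarrow> m (t *\<^sub>R x) = t * m x" for x z t
    using m(1) by (auto simp: sublinear_def)
  have add: "m (x + y) = m x + m y" for x y
  proof -
    obtain q where "sublinear q" "q \<le> m" "\<And>x. q x \<le> m (x + y) - m y"
      using sublinear_decrease[OF m(1), of y] by blast
    then have "m x \<le> m (x + y) - m y" using m(3) by metis
    with sub[of x y] show ?thesis by simp
  qed
  have neg: "m (- x) = - m x" for x
    using add[of x "- x"] sublinear_zero[OF m(1)] by simp
  have "m (t *\<^sub>R x) = t * m x" for t x
    using hom[of t x] hom[of "- t" x] neg[of "t *\<^sub>R x"] by (cases "t \<ge> 0") auto
  then have "linear m" using add by (intro linearI) auto
  moreover have "m \<le> p" using m(2) p0(2) by simp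
  moreover have "m (- x0) \<le> - p x0"
    using m(2) p0(3)[of "- x0"] sublinear_zero[OF p] by (auto simp: le_fun_def intro: order_trans)
  then have "p x0 \<le> m x0" using neg by simp
  then have "m x0 = p x0" using \<open>m \<le> p\<close> by (auto simp: le_fun_def intro: antisym)
  ultimately show ?thesis by blast
qed

text \<open>The complex functional is recovered from its real part \<open>g\<close> as \<open>g x - \<i> g (\<i> x)\<close>; rotating \<open>x\<close> so that the
value becomes a nonnegative real turns the bound for \<open>g\<close> into one for the modulus.\<close>

lemma complex_hahn_banach:
  fixes p :: "'a::complex_banach \<Rightarrow> real"
  assumes add: "\<And>x y. p (x + y) \<le> p x + p y" and scale: "\<And>c x. p (c *\<^sub>C x) = cmod c * p x"
  shows "\<exists>f :: 'a \<Rightarrow> complex. (\<forall>x y. f (x + y) = f x + f y) \<and> (\<forall>c x. f (c *\<^sub>C x) = c * f x) \<and>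
           (\<forall>x. cmod (f x) \<le> p x) \<and> f x0 = of_real (p x0)"
proof -
  have "sublinear p" using add scale by (simp add: sublinear_def scaleR_scaleC)
  then obtain g where g: "linear g" "g \<le> p" "g x0 = p x0" using real_hahn_banach by blast
  interpret g: linear g by (fact g(1))
  define f where "f x = Complex (g x) (- g (\<i> *\<^sub>C x))" for x
  have gr: "g (complex_of_real r *\<^sub>C x) = r * g x" for r x
    using g.scaleR[of r x] by (simp add: scaleR_scaleC)
  have fadd: "f (x + y) = f x + f y" for x y
    by (simp add: f_def g.add scaleC_add_right complex_eq_iff)
  have fscale: "f (c *\<^sub>C x) = c * f x" for c x
  proof -
    have c: "c = complex_of_real (Re c) + complex_of_real (Im c) * \<i>"
      by (simp add: complex_eq_iff)
    have 1: "g (c *\<^sub>C x) = Re c * g x + Im c * g (\<i> *\<^sub>C x)"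
      by (subst c) (simp only: scaleC_add_left g.add scaleC_scaleC[symmetric] gr)
    have ic: "\<i> * c = complex_of_real (- Im c) + complex_of_real (Re c) * \<i>"
      by (simp add: complex_eq_iff)
    have 2: "g ((\<i> * c) *\<^sub>C x) = - Im c * g x + Re c * g (\<i> *\<^sub>C x)"
      by (subst ic) (simp only: scaleC_add_left g.add scaleC_scaleC[symmetric] gr)
    show ?thesis unfolding f_def by (simp add: 1 2 complex_eq_iff algebra_simps)
  qed
  have fle: "cmod (f x) \<le> p x" for x
  proof (cases "f x = 0")
    case True
    have "0 \<le> p x" using add[of x "- x"] scale[of "-1" x] scale[of 0 x]
      by (simp add: complex_vector.scale_minus_left scaleC_one)
    then show ?thesis using True by simp
  next
    case False
    define c where "c = cnj (f x) / cmod (f x)"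
    have "f (c *\<^sub>C x) = complex_of_real (cmod (f x))"
      using False by (simp add: fscale c_def complex_norm_square[symmetric] power2_eq_square mult.commute)
    then have "cmod (f x) = g (c *\<^sub>C x)" by (simp add: f_def complex_eq_iff)
    also have "\<dots> \<le> p (c *\<^sub>C x)" using g(2) by (simp add: le_fun_def)
    also have "\<dots> = p x" using False by (simp add: scale c_def norm_divide)
    finally show ?thesis .
  qed
  have "Re (f x0) = p x0" by (simp add: f_def g)
  moreover have "(cmod (f x0))\<^sup>2 \<le> (p x0)\<^sup>2" using fle by (intro power_mono) auto
  ultimately have "f x0 = of_real (p x0)" by (simp add: complex_eq_iff cmod_power2)
  with fadd fscale fle show ?thesis by blast
qed


section \<open>The open mapping theorem\<close>

text \<open>Successive approximation: the error is reduced by the factor \<open>q\<close> at each step, and the corrections sum to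
a geometric series. Both the open mapping theorem and the stability of surjectivity under perturbation
come from this one iteration.\<close>

lemma surjective_if_approximately_surjective:
  fixes A :: "'b::banach \<Rightarrow> 'c::real_normed_vector"
  assumes A: "bounded_linear A" and M: "subspace M" "closed M"
    and R: "subspace R" and AM: "A ` M \<subseteq> R" and q: "0 \<le> q" "q < 1" and "0 \<le> C"
    and approx: "\<And>y. y \<in> R \<Longrightarrow> \<exists>x\<in>M. norm x \<le> C * norm y \<and> norm (y - A x) \<le> q * norm y"
    and y: "y \<in> R"
  shows "\<exists>x\<in>M. A x = y \<and> norm x \<le> C / (1 - q) * norm y"
proof -
  interpret A: bounded_linear A by (fact A)
  obtain g where g: "\<And>y. y \<in> R \<Longrightarrow> g y \<in> M \<and> norm (g y) \<le> C * norm y \<and> norm (y - A (g y)) \<le> q * norm y"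
    using approx by metis
  define r where "r = rec_nat y (\<lambda>_ z. z - A (g z))"
  have r0: "r 0 = y" and rSuc: "r (Suc n) = r n - A (g (r n))" for n
    by (simp_all add: r_def)
  have rR: "r n \<in> R" for n
  proof (induction n)
    case (Suc n)
    have "A (g (r n)) \<in> R" using g[OF Suc] AM by blast
    with Suc show ?case using R by (simp add: rSuc subspace_diff)
  qed (simp add: r0 y)
  have rn: "norm (r n) \<le> q ^ n * norm y" for n
  proof (induction n)
    case (Suc n)
    have "norm (r (Suc n)) \<le> q * norm (r n)" using g[OF rR] by (simp add: rSuc)
    also have "\<dots> \<le> q * (q ^ n * norm y)" using Suc q by (intro mult_left_mono) auto
    finally show ?case by simp
  qed (simp add: r0)
  have gn: "norm (g (r n)) \<le> (C * norm y) * q ^ n" for n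
  proof -
    have "norm (g (r n)) \<le> C * norm (r n)" using g[OF rR] by blast
    also have "\<dots> \<le> C * (q ^ n * norm y)" using rn \<open>0 \<le> C\<close> by (intro mult_left_mono) auto
    finally show ?thesis by (simp add: algebra_simps)
  qed
  have geo: "(\<lambda>n. (C * norm y) * q ^ n) sums ((C * norm y) * (1 / (1 - q)))"
    using q by (intro sums_mult geometric_sums) auto
  have sumn: "summable (\<lambda>n. norm (g (r n)))"
    using geo gn by (intro summable_comparison_test[OF _ sums_summable[OF geo]]) auto
  then have sm: "summable (\<lambda>n. g (r n))" by (rule summable_norm_cancel)
  define x where "x = (\<Sum>n. g (r n))"
  have part: "y - A (\<Sum>i<n. g (r i)) = r n" for n
    by (induction n) (auto simp: r0 rSuc A.add A.zero algebra_simps)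
  have lim: "(\<lambda>n. \<Sum>i<n. g (r i)) \<longlonglongrightarrow> x"
    using sm unfolding x_def by (rule summable_LIMSEQ)
  have "(\<lambda>n. y - A (\<Sum>i<n. g (r i))) \<longlonglongrightarrow> y - A x"
    by (intro tendsto_intros A.tendsto lim)
  moreover have "r \<longlonglongrightarrow> 0"
  proof (rule tendsto_norm_zero_cancel, rule tendsto_sandwich[where f = "\<lambda>_. 0" and h = "\<lambda>n. q ^ n * norm y"])
    have "(\<lambda>n. q ^ n * norm y) \<longlonglongrightarrow> 0 * norm y"
      using q by (intro tendsto_intros LIMSEQ_power_zero) auto
    then show "(\<lambda>n. q ^ n * norm y) \<longlonglongrightarrow> 0" by simp
  qed (use rn in auto)
  ultimately have "y - A x = 0" unfolding part by (rule LIMSEQ_unique)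
  then have "A x = y" by simp
  moreover have "x \<in> M"
    using lim by (rule closed_sequentially[OF M(2), rotated])
      (intro subspace_sum[OF M(1)] ballI, use g rR in auto)
  moreover have "norm x \<le> (\<Sum>n. norm (g (r n)))" unfolding x_def by (rule summable_norm[OF sumn])
  moreover have "\<dots> \<le> (\<Sum>n. (C * norm y) * q ^ n)"
    by (rule suminf_le[OF gn sumn sums_summable[OF geo]])
  moreover have "\<dots> = C / (1 - q) * norm y" using sums_unique[OF geo] by simp
  ultimately show ?thesis by (intro bexI[of _ x]) auto
qed

lemma surjective_perturbation:
  fixes A B :: "'b::banach \<Rightarrow> 'c::real_normed_vector"
  assumes B: "bounded_linear B" and M: "subspace M" "closed M"
    and R: "subspace R" and BM: "B ` M \<subseteq> R" and C: "0 \<le> C" and d: "0 \<le> d" "C * d < 1"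
    and surj: "\<And>y. y \<in> R \<Longrightarrow> \<exists>x\<in>M. A x = y \<and> norm x \<le> C * norm y"
    and close: "\<And>x. x \<in> M \<Longrightarrow> norm (A x - B x) \<le> d * norm x"
    and y: "y \<in> R"
  shows "\<exists>x\<in>M. B x = y \<and> norm x \<le> C / (1 - C * d) * norm y"
proof (rule surjective_if_approximately_surjective[OF B M R BM _ d(2) C _ y])
  fix y assume "y \<in> R"
  then obtain x where x: "x \<in> M" "A x = y" "norm x \<le> C * norm y" using surj by blast
  have "norm (y - B x) \<le> d * norm x" using close[OF x(1)] x(2) by simp
  also have "\<dots> \<le> d * (C * norm y)" using x(3) d(1) by (rule mult_left_mono)
  finally show "\<exists>x\<in>M. norm x \<le> C * norm y \<and> norm (y - B x) \<le> C * d * norm y"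
    using x by (intro bexI[of _ x]) (auto simp: mult_ac)
qed (use C d in auto)

text \<open>By the Baire category theorem in the range, the closure of the image of some ball contains a relative ball;
centring it at the origin and scaling gives approximate solutions with error factor \<open>1 / 2\<close>.\<close>

lemma open_mapping:
  fixes A :: "'b::banach \<Rightarrow> 'c::banach"
  assumes A: "bounded_linear A" and M: "subspace M" "closed M" and R: "closed (A ` M)"
  shows "\<exists>C>0. \<forall>y\<in>A ` M. \<exists>x\<in>M. A x = y \<and> norm x \<le> C * norm y"
proof -
  interpret A: bounded_linear A by (fact A)
  let ?R = "A ` M"
  let ?X = "top_of_set ?R"
  have subR: "subspace ?R" by (rule linear_subspace_image[OF A.linear M(1)])
  define K where "K n = closure (A ` (M \<inter> cball 0 (real n)))" for n :: nat
  have KR: "K n \<subseteq> ?R" for n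
    unfolding K_def using R by (intro closure_minimal) auto
  have closedK: "closedin ?X (K n)" for n
    using KR by (rule closed_subset) (simp add: K_def)
  have cover: "?R \<subseteq> \<Union> (range K)"
  proof
    fix y assume "y \<in> ?R"
    then obtain x where x: "x \<in> M" "y = A x" by blast
    obtain n where "norm x \<le> real n" using real_arch_simple by blast
    then have "y \<in> K n" unfolding K_def using x closure_subset by fastforce
    then show "y \<in> \<Union> (range K)" by blast
  qed
  \<comment> \<open>Otherwise the range, a complete space, would be a countable union of nowhere dense sets.\<close>
  have "\<exists>n. ?X interior_of (K n) \<noteq> {}"
  proof (rule ccontr)
    assume "\<not> ?thesis"
    then have "?X interior_of \<Union> (range K) = {}"
      using closedK completely_metrizable_space_closedin[OF completely_metrizable_space_euclidean] R
      by (intro Baire_category_alt) auto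
    moreover have "?X interior_of ?R = ?R" using interior_of_topspace[of ?X] by simp
    moreover have "?X interior_of ?R \<subseteq> ?X interior_of \<Union> (range K)"
      using cover by (rule interior_of_mono)
    moreover have "0 \<in> ?R" using subR by (rule subspace_0)
    ultimately show False by blast
  qed
  then obtain n y0 where "y0 \<in> ?X interior_of (K n)" by blast
  then obtain V where V: "openin ?X V" "y0 \<in> V" "V \<subseteq> K n" by (auto simp: interior_of_def)
  then obtain r where r: "r > 0" "ball y0 r \<inter> ?R \<subseteq> V" and y0: "y0 \<in> ?R"
    unfolding openin_contains_ball by blast
  have appr: "\<exists>x\<in>M. norm x \<le> 4 * real n / r * norm y \<and> norm (y - A x) \<le> 1/2 * norm y" if y: "y \<in> ?R" for y
  proof (cases "y = 0")
    case True
    then show ?thesis using subspace_0[OF M(1)] by (intro bexI[of _ 0]) (auto simp: A.zero)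
  next
    case False
    let ?s = "r / (2 * norm y)"
    have s: "?s > 0" using False r by simp
    let ?z = "?s *\<^sub>R y"
    have nz: "norm ?z = r / 2" using False r by simp
    have "y0 + ?z \<in> ?R" using subR y0 y by (intro subspace_add subspace_scale)
    moreover have "dist y0 (y0 + ?z) < r" using nz r by (simp add: dist_norm)
    ultimately have "y0 + ?z \<in> ball y0 r \<inter> ?R" by (simp only: mem_ball Int_iff)
    then have "y0 + ?z \<in> K n" and "y0 \<in> K n" using r(2) V by blast+
    then have "\<exists>w\<in>A ` (M \<inter> cball 0 (real n)). dist w (y0 + ?z) < r / 8"
      and "\<exists>w\<in>A ` (M \<inter> cball 0 (real n)). dist w y0 < r / 8"
      using r(1) unfolding K_def closure_approachable by (meson divide_pos_pos zero_less_numeral)+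
    then obtain u v where u: "u \<in> M" "norm u \<le> n" "dist (A u) (y0 + ?z) < r/8"
      and v: "v \<in> M" "norm v \<le> n" "dist (A v) y0 < r / 8"
      by auto
    define x where "x = (1 / ?s) *\<^sub>R (u - v)"
    have xM: "x \<in> M" unfolding x_def using M u v by (intro subspace_scale subspace_diff)
    have "norm (u - v) \<le> 2 * n" using norm_triangle_ineq4[of u v] u v by simp
    then have "(2 * norm y / r) * norm (u - v) \<le> (2 * norm y / r) * (2 * real n)"
      using r by (intro mult_left_mono) auto
    moreover have "norm x = (2 * norm y / r) * norm (u - v)"
      using r by (simp only: x_def norm_scaleR) simp
    ultimately have nx: "norm x \<le> 4 * real n / r * norm y" by (simp add: field_simps)
    have "norm (?z - A (u - v)) = norm ((y0 + ?z - A u) - (y0 - A v))" by (simp add: A.diff algebra_simps)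
    also have "\<dots> \<le> norm (y0 + ?z - A u) + norm (y0 - A v)" by (rule norm_triangle_ineq4)
    also have "\<dots> \<le> r / 4" using u v by (simp add: dist_norm norm_minus_commute)
    finally have 1: "norm (?z - A (u - v)) \<le> r / 4" .
    have "y - A x = (1 / ?s) *\<^sub>R (?z - A (u - v))"
    proof -
      have "A x = (1 / ?s) *\<^sub>R A (u - v)" by (simp only: x_def A.scaleR)
      moreover have "y = (1 / ?s) *\<^sub>R ?z" using False r by simp
      ultimately show ?thesis by (simp only: scaleR_right_diff_distrib)
    qed
    then have "norm (y - A x) = \<bar>1 / ?s\<bar> * norm (?z - A (u - v))" by (simp only: norm_scaleR)
    also have "\<dots> = (1 / ?s) * norm (?z - A (u - v))" using s by (simp only: abs_of_pos zero_less_divide_1_iff)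
    also have "\<dots> \<le> (1 / ?s) * (r / 4)" 
      by (rule mult_left_mono[OF 1]) (use s r in simp)
    also have "\<dots> = 1/2 * norm y" using r by (simp add: field_simps)
    finally show ?thesis using xM nx by blast
  qed
  define C where "C = 4 * real n / r / (1 - 1/2) + 1"
  have "\<exists>x\<in>M. A x = y \<and> norm x \<le> C * norm y" if "y \<in> ?R" for y
  proof -
    have "\<exists>x\<in>M. A x = y \<and> norm x \<le> 4 * real n / r / (1 - 1/2) * norm y"
      by (rule surjective_if_approximately_surjective[OF A M subR subset_refl _ _ _ appr that]) (use r in auto)
    then obtain x where "x \<in> M" "A x = y" "norm x \<le> 4 * real n / r / (1 - 1/2) * norm y" by blast
    then show ?thesis by (intro bexI[of _ x]) (auto simp: C_def distrib_right intro: add_increasing2)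
  qed
  moreover have "C > 0" unfolding C_def using r by (simp add: add_nonneg_pos)
  ultimately show ?thesis by blast
qed


section \<open>Closed subspaces and functionals\<close>

definition cfunctional :: "('a::complex_banach \<Rightarrow> complex) \<Rightarrow> bool" where
  "cfunctional f \<longleftrightarrow> bounded_linear f \<and> (\<forall>c x. f (c *\<^sub>C x) = c * f x)"

lemma cfunctionalD:
  assumes "cfunctional f"
  shows "bounded_linear f" "f (x + y) = f x + f y" "f (x - y) = f x - f y" "f (c *\<^sub>C x) = c * f x" "f 0 = 0"
    "f (\<Sum>i\<in>I. h i) = (\<Sum>i\<in>I. f (h i))"
proof -
  interpret f: bounded_linear f using assms by (simp add: cfunctional_def)
  show "bounded_linear f" "f (x + y) = f x + f y" "f (x - y) = f x - f y" "f 0 = 0"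
    "f (\<Sum>i\<in>I. h i) = (\<Sum>i\<in>I. f (h i))"
    by (fact f.bounded_linear_axioms f.add f.diff f.zero f.sum)+
  show "f (c *\<^sub>C x) = c * f x" using assms by (simp add: cfunctional_def)
qed

lemma subspace_kernel_functional: "cfunctional f \<Longrightarrow> complex_vector.subspace {x. f x = 0}"
  by (auto simp: complex_vector.subspace_def cfunctionalD)

lemma closed_kernel_functional: "cfunctional f \<Longrightarrow> closed {x. f x = 0}"
  by (intro closed_Collect_eq continuous_on_const linear_continuous_on cfunctionalD(1))

definition sum_space :: "'a::complex_banach set \<Rightarrow> 'a set \<Rightarrow> 'a set" where
  "sum_space U V = {u + v |u v. u \<in> U \<and> v \<in> V}"

lemma sum_spaceI: "u \<in> U \<Longrightarrow> v \<in> V \<Longrightarrow> u + v \<in> sum_space U V"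
  by (auto simp: sum_space_def)

lemma sum_spaceE:
  assumes "x \<in> sum_space U V" obtains u v where "u \<in> U" "v \<in> V" "x = u + v"
  using assms by (auto simp: sum_space_def)

lemma mem_sum_space: "x \<in> sum_space U V \<longleftrightarrow> (\<exists>u\<in>U. \<exists>v\<in>V. x = u + v)"
  by (auto simp: sum_space_def)

lemma sum_space_as_image: "(\<lambda>x. fst x + snd x) ` (A \<times> B) = sum_space A B"
  unfolding set_eq_iff image_iff mem_sum_space by (simp add: split_paired_all)

lemma subspace_sum_space:
  "complex_vector.subspace U \<Longrightarrow> complex_vector.subspace V \<Longrightarrow> complex_vector.subspace (sum_space U V)"
  unfolding sum_space_def by (rule complex_vector.subspace_sums)

lemma sum_space_superset:
  assumes "complex_vector.subspace U" "complex_vector.subspace V"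
  shows "U \<subseteq> sum_space U V" "V \<subseteq> sum_space U V"
  using sum_spaceI[of _ U 0 V] sum_spaceI[of 0 U _ V] assms[THEN complex_vector.subspace_0] by auto

lemma sum_space_subset:
  "complex_vector.subspace M \<Longrightarrow> U \<subseteq> M \<Longrightarrow> V \<subseteq> M \<Longrightarrow> sum_space U V \<subseteq> M"
  by (auto simp: sum_space_def intro!: complex_vector.subspace_add)

lemma sum_space_commute: "sum_space U V = sum_space V U"
proof -
  have "sum_space U V \<subseteq> sum_space V U" for U V :: "'a set"
  proof
    fix x assume "x \<in> sum_space U V"
    then obtain u v where "u \<in> U" "v \<in> V" "x = u + v" by (rule sum_spaceE)
    then show "x \<in> sum_space V U" using sum_spaceI[of v V u U] by (simp add: add.commute)
  qed
  then show ?thesis by blast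
qed

lemma subspace_if_csubspace: "complex_vector.subspace M \<Longrightarrow> subspace M"
  by (simp add: subspace_def complex_vector.subspace_def scaleR_scaleC)

lemma bounded_linear_scaleC_right: "bounded_linear (\<lambda>x :: 'a::complex_banach. c *\<^sub>C x)"
  by (rule bounded_linear_intro[of _ "cmod c"])
    (simp_all add: scaleC_add_right scaleR_scaleC scaleC_scaleC mult.commute norm_scaleC)

lemma bounded_linear_scaleC_left: "bounded_linear (\<lambda>c. c *\<^sub>C (x :: 'a::complex_banach))"
  by (rule bounded_linear_intro[of _ "norm x"])
    (simp_all add: scaleC_add_left scaleR_scaleC scaleC_complex_def scaleC_scaleC norm_scaleC)

lemma le_infdistI:
  assumes "W \<noteq> {}" "\<And>w. w \<in> W \<Longrightarrow> d \<le> dist x w" shows "d \<le> infdist x W"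
  using assms by (auto simp: infdist_notempty intro!: cINF_greatest)

text \<open>Together with the homogeneity below, this makes the distance to a subspace a seminorm, the one to which
Hahn-Banach is applied.\<close>

lemma infdist_add_le:
  fixes W :: "'a::complex_banach set"
  assumes W: "complex_vector.subspace W"
  shows "infdist (x + y) W \<le> infdist x W + infdist y W"
proof -
  have ne: "W \<noteq> {}" using complex_vector.subspace_0[OF W] by auto
  have "infdist (x + y) W - dist y v \<le> infdist x W" if v: "v \<in> W" for v
  proof (rule le_infdistI[OF ne])
    fix w assume "w \<in> W"
    then have "infdist (x + y) W \<le> dist (x + y) (w + v)"
      using complex_vector.subspace_add[OF W] v by (intro infdist_le) auto
    also have "\<dots> \<le> dist x w + dist y v" by (rule dist_triangle_add)
    finally show "infdist (x + y) W - dist y v \<le> dist x w" by simp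
  qed
  then have "infdist (x + y) W - infdist x W \<le> infdist y W"
    by (intro le_infdistI[OF ne]) (simp add: algebra_simps)
  then show ?thesis by simp
qed

lemma infdist_scaleC:
  fixes W :: "'a::complex_banach set"
  assumes W: "complex_vector.subspace W"
  shows "infdist (c *\<^sub>C x) W = cmod c * infdist x W"
proof (cases "c = 0")
  case True
  then show ?thesis using complex_vector.subspace_0[OF W] by simp
next
  case False
  have ne: "W \<noteq> {}" using complex_vector.subspace_0[OF W] by auto
  have le: "infdist (d *\<^sub>C z) W \<le> cmod d * infdist z W" if d: "d \<noteq> 0" for d z
  proof -
    have "infdist (d *\<^sub>C z) W / cmod d \<le> infdist z W"
    proof (rule le_infdistI[OF ne])
      fix w assume "w \<in> W"
      then have "infdist (d *\<^sub>C z) W \<le> dist (d *\<^sub>C z) (d *\<^sub>C w)"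
        using complex_vector.subspace_scale[OF W] by (intro infdist_le) auto
      also have "\<dots> = cmod d * dist z w"
        by (simp add: dist_norm norm_scaleC complex_vector.scale_right_diff_distrib[symmetric])
      finally show "infdist (d *\<^sub>C z) W / cmod d \<le> dist z w" using d by (simp add: field_simps)
    qed
    then show ?thesis using d by (simp add: field_simps)
  qed
  have "infdist x W = infdist ((1 / c) *\<^sub>C c *\<^sub>C x) W" using False by (simp add: scaleC_one)
  also have "\<dots> \<le> cmod (1 / c) * infdist (c *\<^sub>C x) W" using False by (intro le) simp
  finally have "cmod c * infdist x W \<le> infdist (c *\<^sub>C x) W"
    using False by (simp add: norm_divide field_simps)
  with le[OF False, of x] show ?thesis by simp
qed

lemma functional_dominated_by_distance:
  fixes W :: "'a::complex_banach set"
  assumes W: "complex_vector.subspace W"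
  shows "\<exists>f. cfunctional f \<and> (\<forall>y. cmod (f y) \<le> infdist y W) \<and> f x = of_real (infdist x W)"
proof -
  obtain f :: "'a \<Rightarrow> complex" where f: "\<And>x y. f (x + y) = f x + f y" "\<And>c x. f (c *\<^sub>C x) = c * f x"
    "\<And>x. cmod (f x) \<le> infdist x W" "f x = of_real (infdist x W)"
    using complex_hahn_banach[of "\<lambda>x. infdist x W" x] infdist_add_le[OF W] infdist_scaleC[OF W] by blast
  have "infdist y W \<le> norm y" for y
    using infdist_le[OF complex_vector.subspace_0[OF W], of y] by simp
  then have "cmod (f y) \<le> norm y" for y
    using f(3)[of y] by (rule order_trans[rotated])
  then have "bounded_linear f"
    using f by (intro bounded_linear_intro[of f 1]) (auto simp: scaleR_scaleC scaleC_complex_def)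
  then show ?thesis using f unfolding cfunctional_def by blast
qed

lemma separating_functional:
  fixes W :: "'a::complex_banach set"
  assumes W: "complex_vector.subspace W" "closed W" and x: "x \<notin> W"
  shows "\<exists>f. cfunctional f \<and> (\<forall>w\<in>W. f w = 0) \<and> f x = 1"
proof -
  obtain f where f: "cfunctional f" "\<And>y. cmod (f y) \<le> infdist y W" "f x = of_real (infdist x W)"
    using functional_dominated_by_distance[OF W(1)] by blast
  let ?d = "infdist x W"
  have "?d \<noteq> 0" using in_closed_iff_infdist_zero[OF W(2)] complex_vector.subspace_0[OF W(1)] x by auto
  moreover have "f w = 0" if "w \<in> W" for w using f(2)[of w] that by simp
  moreover have "cfunctional (\<lambda>y. f y / of_real ?d)"
    using f(1) unfolding cfunctional_def by (auto intro: bounded_linear_divide[THEN bounded_linear_compose])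
  ultimately show ?thesis using f(3) by (intro exI[of _ "\<lambda>y. f y / of_real ?d"]) auto
qed

lemma norming_functional:
  fixes x :: "'a::complex_banach"
  shows "\<exists>f. cfunctional f \<and> (\<forall>y. cmod (f y) \<le> norm y) \<and> f x = of_real (norm x)"
  using functional_dominated_by_distance[OF complex_vector.subspace_single_0, of x]
  by (simp add: infdist_def)

text \<open>If \<open>f\<close> vanishes on \<open>W\<close> and \<open>f x = 1\<close>, the sum consists of the \<open>z\<close> with \<open>z - f z x \<in> W\<close>, a closed condition.\<close>

lemma closed_sum_line:
  fixes W :: "'a::complex_banach set"
  assumes W: "complex_vector.subspace W" "closed W"
  shows "closed (sum_space W (range (\<lambda>c. c *\<^sub>C x)))"
proof (cases "x \<in> W")
  case True
  have "u + c *\<^sub>C x \<in> W" if "u \<in> W" for u c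
    using W(1) True that by (intro complex_vector.subspace_add complex_vector.subspace_scale)
  moreover have "u \<in> sum_space W (range (\<lambda>c. c *\<^sub>C x))" if "u \<in> W" for u
    using sum_spaceI[OF that, of 0 "range (\<lambda>c. c *\<^sub>C x)"] by (metis add_0_right complex_vector.scale_zero_left rangeI)
  ultimately have "sum_space W (range (\<lambda>c. c *\<^sub>C x)) = W" by (auto simp: sum_space_def)
  then show ?thesis using W(2) by simp
next
  case False
  then obtain f where f: "cfunctional f" "\<And>w. w \<in> W \<Longrightarrow> f w = 0" "f x = 1"
    using separating_functional[OF W] by blast
  interpret f: bounded_linear f using f(1) by (simp add: cfunctional_def)
  have fs: "f (c *\<^sub>C x) = c" for c using f by (simp add: cfunctional_def)
  have "sum_space W (range (\<lambda>c. c *\<^sub>C x)) = (\<lambda>z. z - f z *\<^sub>C x) -` W"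
  proof (intro equalityI subsetI)
    fix z assume "z \<in> (\<lambda>z. z - f z *\<^sub>C x) -` W"
    then have "(z - f z *\<^sub>C x) + f z *\<^sub>C x \<in> sum_space W (range (\<lambda>c. c *\<^sub>C x))"
      by (intro sum_spaceI) auto
    then show "z \<in> sum_space W (range (\<lambda>c. c *\<^sub>C x))" by simp
  qed (auto simp: f.add f(2) fs elim!: sum_spaceE)
  moreover have "bounded_linear (\<lambda>z. z - f z *\<^sub>C x)"
    by (intro bounded_linear_sub bounded_linear_ident
        bounded_linear_compose[OF bounded_linear_scaleC_left] f.bounded_linear_axioms)
  ultimately show ?thesis
    using W(2) by (simp add: closed_vimage bounded_linear.continuous_on[OF _ continuous_on_id]
        linear_continuous_on)
qed

lemma closed_sum_finite_dim:
  fixes W :: "'a::complex_banach set"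
  assumes W: "complex_vector.subspace W" "closed W" and "finite B"
  shows "closed (sum_space W (complex_vector.span B))"
  using \<open>finite B\<close>
proof (induction B)
  case empty
  have "sum_space W {0} = W" by (auto simp: sum_space_def)
  then show ?case using W by simp
next
  case (insert b B)
  let ?S = "complex_vector.span B"
  have "sum_space W (complex_vector.span (insert b B))
        = sum_space (sum_space W ?S) (range (\<lambda>c. c *\<^sub>C b))" (is "?L = ?R")
  proof (intro equalityI subsetI)
    fix z assume "z \<in> ?L"
    then obtain w v where wv: "w \<in> W" "v \<in> complex_vector.span (insert b B)" "z = w + v"
      by (rule sum_spaceE)
    obtain k where "v - k *\<^sub>C b \<in> ?S" using wv(2) complex_vector.span_insert[of b B] by blast
    then have "(w + (v - k *\<^sub>C b)) + k *\<^sub>C b \<in> ?R" using wv(1) by (intro sum_spaceI) auto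
    then show "z \<in> ?R" using wv(3) by simp
  next
    fix z assume "z \<in> ?R"
    then obtain w v k where wv: "w \<in> W" "v \<in> ?S" "z = (w + v) + k *\<^sub>C b"
      by (auto elim!: sum_spaceE)
    have "v + k *\<^sub>C b \<in> complex_vector.span (insert b B)"
      by (rule complex_vector.span_add[OF subsetD[OF complex_vector.span_mono[OF subset_insertI] wv(2)]
            complex_vector.span_scale[OF complex_vector.span_base[OF insertI1]]])
    from sum_spaceI[OF wv(1) this] show "z \<in> ?L" using wv(3) by (simp add: add.assoc)
  qed
  then show ?case
    using insert closed_sum_line[of "sum_space W ?S" b] W subspace_sum_space[of W ?S] by simp
qed

lemma closed_span_finite:
  fixes B :: "'a::complex_banach set"
  assumes "finite B" shows "closed (complex_vector.span B)"
proof -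
  have "sum_space {0} (complex_vector.span B) = complex_vector.span B" by (auto simp: sum_space_def)
  then show ?thesis using closed_sum_finite_dim[of "{0}" B] assms by simp
qed

text \<open>Coordinate functionals of \<open>B\<close>, extended to the whole space so as to vanish on \<open>W\<close>: the functional belonging
to \<open>b\<close> separates \<open>b\<close> from the closed subspace spanned by \<open>W\<close> and the other elements of \<open>B\<close>.\<close>

lemma dual_basis:
  fixes W :: "'a::complex_banach set"
  assumes W: "complex_vector.subspace W" "closed W" and B: "finite B" "complex_vector.independent B"
    and WB: "W \<inter> complex_vector.span B = {0}"
  obtains \<phi> where "\<And>b. b \<in> B \<Longrightarrow> cfunctional (\<phi> b)" "\<And>b w. b \<in> B \<Longrightarrow> w \<in> W \<Longrightarrow> \<phi> b w = 0"
    "\<And>b b'. b \<in> B \<Longrightarrow> b' \<in> B \<Longrightarrow> \<phi> b b' = (if b' = b then 1 else 0)"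
    "\<And>v. v \<in> complex_vector.span B \<Longrightarrow> v = (\<Sum>b\<in>B. \<phi> b v *\<^sub>C b)"
proof -
  have "\<exists>f. cfunctional f \<and> (\<forall>w\<in>sum_space W (complex_vector.span (B - {b})). f w = 0) \<and> f b = 1"
    if b: "b \<in> B" for b
  proof (rule separating_functional)
    let ?S = "complex_vector.span (B - {b})"
    show "complex_vector.subspace (sum_space W ?S)" using W by (simp add: subspace_sum_space)
    show "closed (sum_space W ?S)" using W B by (intro closed_sum_finite_dim) auto
    show "b \<notin> sum_space W ?S"
    proof
      assume "b \<in> sum_space W ?S"
      then obtain w v where wv: "w \<in> W" "v \<in> ?S" "b = w + v" by (rule sum_spaceE)
      have "v \<in> complex_vector.span B" using wv(2) complex_vector.span_mono[of "B - {b}" B] by blast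
      then have "b - v \<in> complex_vector.span B"
        using complex_vector.span_diff[OF complex_vector.span_base[OF b]] by blast
      moreover have "b - v = w" using wv(3) by simp
      ultimately have "w = 0" using wv(1) WB by auto
      then have "b \<in> ?S" using wv by simp
      then show False using B(2) b unfolding complex_vector.dependent_def by blast
    qed
  qed
  then obtain \<phi> where \<phi>: "\<And>b. b \<in> B \<Longrightarrow> cfunctional (\<phi> b)" "\<And>b. b \<in> B \<Longrightarrow> \<phi> b b = 1"
    "\<And>b w. b \<in> B \<Longrightarrow> w \<in> sum_space W (complex_vector.span (B - {b})) \<Longrightarrow> \<phi> b w = 0"
    by metis
  have \<phi>W: "\<phi> b w = 0" if "b \<in> B" "w \<in> W" for b w
    using \<phi>(3)[OF that(1)] sum_space_superset(1)[OF W(1) complex_vector.subspace_span] that by blast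
  have \<phi>B: "\<phi> b b' = 0" if "b \<in> B" "b' \<in> B" "b' \<noteq> b" for b b'
    using \<phi>(3)[OF that(1)] sum_space_superset(2)[OF W(1) complex_vector.subspace_span]
      complex_vector.span_base[of b' "B - {b}"] that by blast
  have "v = (\<Sum>b\<in>B. \<phi> b v *\<^sub>C b)" if v: "v \<in> complex_vector.span B" for v
  proof -
    obtain u where u: "v = (\<Sum>b\<in>B. u b *\<^sub>C b)" using v complex_vector.span_finite[OF B(1)] by auto
    have "\<phi> b v = u b" if b: "b \<in> B" for b
    proof -
      interpret f: bounded_linear "\<phi> b" using \<phi>(1)[OF b] by (simp add: cfunctional_def)
      have "\<phi> b v = (\<Sum>b'\<in>B. u b' * \<phi> b b')"
        unfolding u using \<phi>(1)[OF b] by (simp add: f.sum cfunctional_def)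
      also have "\<dots> = (\<Sum>b'\<in>B. if b' = b then u b else 0)"
        using \<phi>(2)[OF b] \<phi>B[OF b] by (intro sum.cong) auto
      finally show ?thesis using B(1) b by simp
    qed
    then show ?thesis by (subst u) simp
  qed
  moreover have "\<phi> b b' = (if b' = b then 1 else 0)" if "b \<in> B" "b' \<in> B" for b b'
    using \<phi>(2) \<phi>B that by simp
  ultimately show thesis using \<phi>(1) \<phi>W by (intro that[of \<phi>])
qed


section \<open>Dimension and codimension\<close>

lemma enat_le_if_all_nat_le:
  fixes a b :: enat
  assumes "\<And>m. enat m \<le> a \<Longrightarrow> enat m \<le> b" shows "a \<le> b"
proof (cases b)
  case (enat n)
  then have "\<not> enat (Suc n) \<le> a" using assms[of "Suc n"] by auto
  then show ?thesis using enat by (cases a) auto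
qed simp

text \<open>Testing dimensions against natural numbers treats finite and infinite dimensions alike.\<close>

lemma nat_le_edim_iff:
  "enat m \<le> edim V \<longleftrightarrow> (\<exists>B\<subseteq>V. finite B \<and> card B = m \<and> complex_vector.independent B)"
proof (cases "\<exists>C. finite C \<and> V \<subseteq> complex_vector.span C")
  case True
  then obtain C where C: "finite C" "V \<subseteq> complex_vector.span C" by blast
  obtain B0 where B0: "B0 \<subseteq> V" "complex_vector.independent B0" "V \<subseteq> complex_vector.span B0"
      "card B0 = complex_vector.dim V"
    using complex_vector.basis_exists by blast
  have fin: "finite B0"
    using complex_vector.independent_span_bound[OF C(1) B0(2)] B0(1) C(2) by blast
  have ed: "edim V = enat (card B0)" using True B0(4) unfolding edim_def by (simp only: if_True)
  show ?thesis
  proof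
    assume "enat m \<le> edim V"
    then obtain B where "B \<subseteq> B0" "card B = m" "finite B"
      using ed obtain_subset_with_card_n[of m B0] by auto
    then show "\<exists>B\<subseteq>V. finite B \<and> card B = m \<and> complex_vector.independent B"
      using B0 complex_vector.independent_mono[OF B0(2)] by (intro exI[of _ B]) auto
  next
    assume "\<exists>B\<subseteq>V. finite B \<and> card B = m \<and> complex_vector.independent B"
    then obtain B where B: "B \<subseteq> V" "card B = m" "complex_vector.independent B" by blast
    then have "card B \<le> card B0"
      using complex_vector.independent_span_bound[OF fin, of B] B0(3) by blast
    then show "enat m \<le> edim V" using ed B(2) by simp
  qed
next
  case False
  have "\<exists>B\<subseteq>V. finite B \<and> card B = m \<and> complex_vector.independent B" for m
  proof (induction m)
    case 0
    show ?case by (intro exI[of _ "{}"]) (auto simp: complex_vector.independent_empty)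
  next
    case (Suc m)
    then obtain B where B: "B \<subseteq> V" "finite B" "card B = m" "complex_vector.independent B" by blast
    then obtain v where v: "v \<in> V" "v \<notin> complex_vector.span B" using False by blast
    then have "v \<notin> B" using complex_vector.span_base by blast
    then show ?case using B v
      by (intro exI[of _ "insert v B"]) (simp add: complex_vector.independent_insertI)
  qed
  moreover have "edim V = \<infinity>" using False unfolding edim_def by (simp only: if_False)
  ultimately show ?thesis by simp
qed

lemma nat_le_edimI:
  "B \<subseteq> V \<Longrightarrow> finite B \<Longrightarrow> complex_vector.independent B \<Longrightarrow> enat (card B) \<le> edim V"
  unfolding nat_le_edim_iff by (intro exI[of _ B] conjI refl)

lemma nat_le_edimE:
  assumes "enat m \<le> edim V"
  obtains B where "B \<subseteq> V" "finite B" "card B = m" "complex_vector.independent B"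
  using assms unfolding nat_le_edim_iff by (elim exE conjE)

lemma edim_mono: "U \<subseteq> V \<Longrightarrow> edim U \<le> edim V"
  by (rule enat_le_if_all_nat_le, erule nat_le_edimE) (metis nat_le_edimI order_trans)

lemma edim_finite_basis:
  assumes "edim V < \<infinity>" "complex_vector.subspace V"
  obtains B where "finite B" "complex_vector.independent B" "complex_vector.span B = V" "edim V = enat (card B)"
proof -
  have ex: "\<exists>C. finite C \<and> V \<subseteq> complex_vector.span C"
  proof (rule ccontr)
    assume "\<not> ?thesis"
    then have "edim V = \<infinity>" unfolding edim_def by (simp only: if_False)
    then show False using assms(1) by simp
  qed
  obtain C where C: "finite C" "V \<subseteq> complex_vector.span C" using ex by blast
  obtain B where B: "B \<subseteq> V" "complex_vector.independent B" "V \<subseteq> complex_vector.span B"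
      "card B = complex_vector.dim V"
    using complex_vector.basis_exists by blast
  have "finite B"
    using complex_vector.independent_span_bound[OF C(1) B(2)] B(1) C(2) by blast
  moreover have "complex_vector.span B = V"
    using B(1,3) complex_vector.span_minimal[OF B(1) assms(2)] by blast
  moreover have "edim V = enat (card B)" using ex B(4) unfolding edim_def by (simp only: if_True)
  ultimately show thesis using that B(2) by blast
qed

text \<open>The complement is the common kernel of coordinate functionals of the finite-dimensional subspace.\<close>

lemma closed_complement_of_finite_dim:
  assumes M: "complex_vector.subspace M" "closed M" and K: "complex_vector.subspace K" "K \<subseteq> M" "edim K < \<infinity>"
  shows "\<exists>M0. complex_vector.subspace M0 \<and> closed M0 \<and> M0 \<subseteq> M \<and> K \<inter> M0 = {0} \<and> M \<subseteq> sum_space K M0"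
proof -
  obtain B where B: "finite B" "complex_vector.independent B" "complex_vector.span B = K" "edim K = enat (card B)"
    using edim_finite_basis[OF K(3,1)] .
  obtain \<phi> where \<phi>: "\<And>b. b \<in> B \<Longrightarrow> cfunctional (\<phi> b)"
    "\<And>b w. b \<in> B \<Longrightarrow> w \<in> {0} \<Longrightarrow> \<phi> b w = 0"
    "\<And>b b'. b \<in> B \<Longrightarrow> b' \<in> B \<Longrightarrow> \<phi> b b' = (if b' = b then 1 else 0)"
    "\<And>v. v \<in> K \<Longrightarrow> v = (\<Sum>b\<in>B. \<phi> b v *\<^sub>C b)"
    using dual_basis[of "{0}" B, unfolded B(3)] B(1,2) complex_vector.subspace_0[OF K(1)] by auto
  define M0 where "M0 = M \<inter> (\<Inter>b\<in>B. {x. \<phi> b x = 0})"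
  have "complex_vector.subspace M0"
    unfolding M0_def using M(1) \<phi>(1)
    by (intro complex_vector.subspace_inter complex_vector.subspace_Inter) (auto intro: subspace_kernel_functional)
  moreover have "closed M0"
    unfolding M0_def using M(2) \<phi>(1) by (intro closed_Int closed_INT) (auto intro: closed_kernel_functional)
  moreover have "v = 0" if "v \<in> K" "v \<in> M0" for v
  proof -
    have "(\<Sum>b\<in>B. \<phi> b v *\<^sub>C b) = 0" using that(2) by (intro sum.neutral) (auto simp: M0_def)
    then show ?thesis using \<phi>(4)[OF that(1)] by simp
  qed
  then have "K \<inter> M0 = {0}"
    using complex_vector.subspace_0[OF K(1)] complex_vector.subspace_0[OF \<open>complex_vector.subspace M0\<close>] by blast
  moreover have "x \<in> sum_space K M0" if x: "x \<in> M" for x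
  proof -
    define p where "p = (\<Sum>b\<in>B. \<phi> b x *\<^sub>C b)"
    have pK: "p \<in> K" unfolding p_def B(3)[symmetric]
      by (intro complex_vector.span_sum complex_vector.span_scale complex_vector.span_base)
    have "\<phi> b (x - p) = 0" if b: "b \<in> B" for b
    proof -
      have "\<phi> b p = (\<Sum>b'\<in>B. if b' = b then \<phi> b x else 0)"
        unfolding p_def cfunctionalD(4,6)[OF \<phi>(1)[OF b]] using \<phi>(3)[OF b] by (intro sum.cong) auto
      then show ?thesis using B(1) b by (simp add: cfunctionalD(3)[OF \<phi>(1)[OF b]])
    qed
    moreover have "x - p \<in> M" using x pK K(2) complex_vector.subspace_diff[OF M(1)] by blast
    ultimately have "x - p \<in> M0" by (simp add: M0_def)
    then have "p + (x - p) \<in> sum_space K M0" using pK by (intro sum_spaceI)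
    then show ?thesis by simp
  qed
  ultimately show ?thesis by (intro exI[of _ M0]) (auto simp: M0_def)
qed

lemma finite_dim_closed: "complex_vector.subspace F \<Longrightarrow> edim F < \<infinity> \<Longrightarrow> closed F"
  by (metis edim_finite_basis closed_span_finite)

lemma edim_span_le:
  assumes "finite B" shows "edim (complex_vector.span B) \<le> enat (card B)"
proof -
  have "\<exists>C. finite C \<and> complex_vector.span B \<subseteq> complex_vector.span C" using assms by blast
  then have "edim (complex_vector.span B) = enat (complex_vector.dim (complex_vector.span B))"
    unfolding edim_def by (simp only: if_True)
  also have "\<dots> \<le> enat (card B)"
    unfolding enat_ord_simps by (rule complex_vector.dim_le_card[OF subset_refl assms])
  finally show ?thesis .
qed

lemma edim_span: 
  assumes "finite B" "complex_vector.independent B"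
  shows "edim (complex_vector.span B) = enat (card B)"
proof (rule antisym[OF edim_span_le[OF assms(1)]])
  show "enat (card B) \<le> edim (complex_vector.span B)"
    using complex_vector.span_superset assms by (rule nat_le_edimI)
qed

lemma edim_zero: "edim {0} = 0"
  using edim_span[of "{}"] by (simp add: zero_enat_def complex_vector.independent_empty)

lemma edim_eq_0_iff: 
  assumes "complex_vector.subspace V" shows "edim V = 0 \<longleftrightarrow> V = {0}"
proof
  assume "edim V = 0"
  then obtain B where "finite B" "complex_vector.span B = V" "edim V = enat (card B)"
    using edim_finite_basis[OF _ assms] by auto
  with \<open>edim V = 0\<close> show "V = {0}" by (auto simp: zero_enat_def)
qed (simp add: edim_zero)

definition clinear :: "('a::complex_banach \<Rightarrow> 'a) \<Rightarrow> bool" where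
  "clinear A \<longleftrightarrow> (\<forall>x y. A (x + y) = A x + A y) \<and> (\<forall>c x. A (c *\<^sub>C x) = c *\<^sub>C A x)"

lemma clinear_iff_linear: "clinear A \<longleftrightarrow> Vector_Spaces.linear scaleC scaleC A"
  unfolding clinear_def Vector_Spaces.linear_iff
  by (auto intro: complex_vector.vector_space_axioms)

lemma edim_image_inj:
  fixes A :: "'a::complex_banach \<Rightarrow> 'a"
  assumes A: "clinear A" and L: "complex_vector.subspace L" and inj: "inj_on A L"
  shows "edim (A ` L) = edim L"
proof -
  interpret A: Vector_Spaces.linear scaleC scaleC A using A by (simp add: clinear_iff_linear)
  show ?thesis
  proof (rule antisym; rule enat_le_if_all_nat_le)
    fix m assume "enat m \<le> edim (A ` L)"
    then obtain C where C: "C \<subseteq> A ` L" "finite C" "card C = m" "complex_vector.independent C"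
      by (rule nat_le_edimE)
    then obtain B where B: "B \<subseteq> L" "C = A ` B" "inj_on A B"
      using subset_image_inj[of C A L] by auto
    have "finite B" "card B = m" using C B by (auto simp: finite_image_iff card_image)
    moreover have "complex_vector.independent B"
    proof
      assume "complex_vector.dependent B"
      then obtain b where b: "b \<in> B" "b \<in> complex_vector.span (B - {b})"
        by (auto simp: complex_vector.dependent_def)
      then have "A b \<in> A ` complex_vector.span (B - {b})" by blast
      also have "\<dots> = complex_vector.span (A ` (B - {b}))" by (simp add: A.span_image)
      also have "A ` (B - {b}) = C - {A b}" using B b(1) by (auto simp: inj_on_def)
      finally show False using C(4) b(1) B(2) unfolding complex_vector.dependent_def by blast
    qed
    ultimately show "enat m \<le> edim L" using nat_le_edimI[OF B(1)] by blast
  next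
    fix m assume "enat m \<le> edim L"
    then obtain B where B: "B \<subseteq> L" "finite B" "card B = m" "complex_vector.independent B"
      by (rule nat_le_edimE)
    have "complex_vector.span B \<subseteq> L" using B(1) L by (rule complex_vector.span_minimal)
    then have "complex_vector.independent (A ` B)"
      using A.independent_injective_image[OF B(4)] inj_on_subset[OF inj] by blast
    then have "enat (card (A ` B)) \<le> edim (A ` L)" using B by (intro nat_le_edimI) auto
    then show "enat m \<le> edim (A ` L)" using card_image[OF inj_on_subset[OF inj B(1)]] B(3) by simp
  qed
qed


lemma independent_union:
  assumes C: "finite C" "complex_vector.independent C" and B: "complex_vector.independent B"
    and BC: "complex_vector.span B \<inter> complex_vector.span C = {0}"
  shows "complex_vector.independent (B \<union> C)"
  using C BC
proof (induction C)
  case (insert c C)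
  have indC: "complex_vector.independent C"
    using insert.prems(1) subset_insertI by (rule complex_vector.independent_mono)
  have spC: "complex_vector.span C \<subseteq> complex_vector.span (insert c C)"
    using subset_insertI by (rule complex_vector.span_mono)
  have "complex_vector.independent (B \<union> C)"
    using insert.IH[OF indC] insert.prems(2) spC complex_vector.span_zero[of B] complex_vector.span_zero[of C]
    by blast
  moreover have "c \<notin> complex_vector.span (B \<union> C)"
  proof
    assume "c \<in> complex_vector.span (B \<union> C)"
    then obtain u v where uv: "u \<in> complex_vector.span B" "v \<in> complex_vector.span C" "c = u + v"
      unfolding complex_vector.span_Un by blast
    have "c - v \<in> complex_vector.span (insert c C)"
      by (rule complex_vector.span_diff[OF complex_vector.span_base[OF insertI1] subsetD[OF spC uv(2)]])
    moreover have "c - v = u" using uv(3) by simp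
    ultimately have "u = 0" using uv(1) insert.prems(2) by blast
    then have "c \<in> complex_vector.span C" using uv by simp
    moreover have "C = insert c C - {c}" using insert.hyps(2) by simp
    ultimately show False using insert.prems(1) unfolding complex_vector.dependent_def by (metis insertI1)
  qed
  ultimately show ?case using complex_vector.independent_insertI by simp
qed (use B in simp)

lemma edim_direct_sum:
  assumes U: "complex_vector.subspace U" and V: "complex_vector.subspace V" and UV: "U \<inter> V = {0}"
  shows "edim (sum_space U V) = edim U + edim V"
proof (cases "edim U = \<infinity> \<or> edim V = \<infinity>")
  case True
  then have "edim (sum_space U V) = \<infinity>"
    using edim_mono[OF sum_space_superset(1)[OF U V]] edim_mono[OF sum_space_superset(2)[OF U V]] by auto
  then show ?thesis using True by auto
next
  case False
  then have fin: "edim U < \<infinity>" "edim V < \<infinity>" by auto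
  obtain B where B: "finite B" "complex_vector.independent B" "complex_vector.span B = U" "edim U = enat (card B)"
    using edim_finite_basis[OF fin(1) U] .
  obtain C where C: "finite C" "complex_vector.independent C" "complex_vector.span C = V" "edim V = enat (card C)"
    using edim_finite_basis[OF fin(2) V] .
  have "complex_vector.independent (B \<union> C)" using C(1,2) B(2) UV B(3) C(3) by (intro independent_union) simp_all
  moreover have "complex_vector.span (B \<union> C) = sum_space U V"
    unfolding complex_vector.span_Un B(3) C(3) sum_space_def ..
  moreover have "B \<inter> C = {}"
  proof (rule ccontr)
    assume "B \<inter> C \<noteq> {}"
    then obtain b where b: "b \<in> B" "b \<in> C" by blast
    then have "b \<in> U \<inter> V" using B(3) C(3) complex_vector.span_base[of b] by blast
    then have "b = 0" using UV by blast
    then show False using b(1) B(2) complex_vector.dependent_zero by blast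
  qed
  ultimately show ?thesis
    using edim_span[of "B \<union> C"] B(1,4) C(1,4) by (simp add: card_Un_disjoint)
qed

lemma complement_in_spans: "complement_in M R F \<Longrightarrow> M \<subseteq> sum_space R F"
  unfolding complement_in_def by (intro subsetI) (simp add: mem_sum_space)

lemma complement_in_sum_space:
  assumes R: "complex_vector.subspace R" and S: "complex_vector.subspace S" and RS: "R \<inter> S = {0}" "S \<subseteq> M"
    and M: "complex_vector.subspace M" and G: "complement_in M (sum_space R S) G"
  shows "complement_in M R (sum_space S G)" and "S \<inter> G = {0}"
proof -
  have G': "complex_vector.subspace G" "G \<subseteq> M" "sum_space R S \<inter> G = {0}"
    and ex: "\<And>x. x \<in> M \<Longrightarrow> \<exists>r\<in>sum_space R S. \<exists>f\<in>G. x = r + f"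
    using G by (auto simp: complement_in_def)
  show "S \<inter> G = {0}"
    using G'(3) sum_space_superset(2)[OF R S] complex_vector.subspace_0[OF S] by blast
  have "x = 0" if x: "x \<in> R" "x \<in> sum_space S G" for x
  proof -
    obtain s g where sg: "s \<in> S" "g \<in> G" "x = s + g" using x(2) by (rule sum_spaceE)
    have "x + (- s) \<in> sum_space R S" using x(1) sg(1) S by (intro sum_spaceI complex_vector.subspace_neg)
    then have "g \<in> sum_space R S \<inter> G" using sg by simp
    then have "g = 0" using G'(3) by blast
    then show ?thesis using x(1) sg RS by auto
  qed
  then have "R \<inter> sum_space S G = {0}"
    using complex_vector.subspace_0[OF R] complex_vector.subspace_0[OF subspace_sum_space[OF S G'(1)]] by blast
  moreover have "\<exists>r\<in>R. \<exists>f\<in>sum_space S G. x = r + f" if "x \<in> M" for x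
  proof -
    obtain y g where yg: "y \<in> sum_space R S" "g \<in> G" "x = y + g" using ex[OF \<open>x \<in> M\<close>] by blast
    obtain r s where rs: "r \<in> R" "s \<in> S" "y = r + s" using yg(1) by (rule sum_spaceE)
    have "s + g \<in> sum_space S G" using rs yg by (intro sum_spaceI)
    then show ?thesis using rs yg by (intro bexI[of _ r] bexI[of _ "s + g"]) (auto simp: add.assoc)
  qed
  ultimately show "complement_in M R (sum_space S G)"
    unfolding complement_in_def
    using subspace_sum_space[OF S G'(1)] sum_space_subset[OF M RS(2) G'(2)] by (intro conjI ballI)
qed

lemma codim_sum_space:
  assumes R: "complex_vector.subspace R" "R \<subseteq> M" and S: "complex_vector.subspace S" "S \<subseteq> M"
    and RS: "R \<inter> S = {0}" and M: "complex_vector.subspace M"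
  shows "codim M R = edim S + codim M (sum_space R S)"
proof -
  have sub: "complex_vector.subspace (sum_space R S)" "sum_space R S \<subseteq> M"
    using subspace_sum_space[OF R(1) S(1)] sum_space_subset[OF M R(2) S(2)] by auto
  obtain G where G: "complement_in M (sum_space R S) G" using complement_in_exists[OF sub(1) M sub(2)] by blast
  note c = complement_in_sum_space[OF R(1) S(1) RS S(2) M G]
  have "complex_vector.subspace G" using G by (simp add: complement_in_def)
  then have "codim M R = edim S + edim G"
    using codim_eq[OF R c(1)] edim_direct_sum[OF S(1) _ c(2)] by simp
  also have "edim G = codim M (sum_space R S)" using codim_eq[OF sub G] by simp
  finally show ?thesis .
qed

lemma edim_le_codim:
  assumes R: "complex_vector.subspace R" "R \<subseteq> M" and S: "complex_vector.subspace S" "S \<subseteq> M"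
    and RS: "R \<inter> S = {0}" and M: "complex_vector.subspace M"
  shows "edim S \<le> codim M R"
  using codim_sum_space[OF assms] by simp

lemma codim_le_edim:
  assumes R: "complex_vector.subspace R" "R \<subseteq> M" and F: "complex_vector.subspace F"
    and M: "complex_vector.subspace M" "M \<subseteq> sum_space R F"
  shows "codim M R \<le> edim F"
proof -
  have RF: "complex_vector.subspace (R \<inter> F)" using R(1) F by (rule complex_vector.subspace_inter)
  obtain G where G: "complement_in F (R \<inter> F) G" using complement_in_exists[OF RF F] by blast
  obtain H where H: "complement_in M R H" using complement_in_exists[OF R(1) M(1) R(2)] by blast
  have G': "complex_vector.subspace G" "G \<subseteq> F" "(R \<inter> F) \<inter> G = {0}"
    "\<And>x. x \<in> F \<Longrightarrow> \<exists>r\<in>R \<inter> F. \<exists>f\<in>G. x = r + f" using G by (auto simp: complement_in_def)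
  let ?S = "sum_space R G"
  have S: "complex_vector.subspace ?S" using R(1) G'(1) by (rule subspace_sum_space)
  have "M \<subseteq> ?S"
  proof
    fix x assume "x \<in> M"
    then obtain r f where rf: "r \<in> R" "f \<in> F" "x = r + f" using M(2) by (blast elim: sum_spaceE)
    obtain r' g where "r' \<in> R" "g \<in> G" "f = r' + g" using G'(4)[OF rf(2)] by blast
    then show "x \<in> ?S" using rf sum_spaceI[of "r + r'" R g G] complex_vector.subspace_add[OF R(1)]
      by (simp add: add.assoc)
  qed
  have HM: "complex_vector.subspace H" "H \<subseteq> M" "R \<inter> H = {0}" using H by (auto simp: complement_in_def)
  have RG: "complement_in ?S R G"
    using G' sum_space_superset[OF R(1) G'(1)] by (auto simp: complement_in_def sum_space_def)
  have "codim M R = edim H" using R H by (rule codim_eq)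
  also have "\<dots> \<le> codim ?S R"
    using HM \<open>M \<subseteq> ?S\<close> S sum_space_superset(1)[OF R(1) G'(1)] R(1) by (intro edim_le_codim) auto
  also have "\<dots> = edim G" using R(1) sum_space_superset(1)[OF R(1) G'(1)] RG by (rule codim_eq)
  also have "\<dots> \<le> edim F" using G'(2) by (rule edim_mono)
  finally show ?thesis .
qed

lemma codim_self: "complex_vector.subspace M \<Longrightarrow> codim M M = 0"
  using codim_le_edim[of M M "{0}"] sum_space_superset(1)[of M "{0}"] by (simp add: edim_zero)

lemma codim_eq_0_iff:
  assumes R: "complex_vector.subspace R" "R \<subseteq> M" and M: "complex_vector.subspace M"
  shows "codim M R = 0 \<longleftrightarrow> R = M"
proof
  assume 0: "codim M R = 0"
  obtain H where H: "complement_in M R H" using complement_in_exists[OF R(1) M R(2)] by blast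
  then have "edim H = 0" "complex_vector.subspace H" using codim_eq[OF R H] 0 by (auto simp: complement_in_def)
  then have "H = {0}" by (simp add: edim_eq_0_iff)
  then have "\<forall>x\<in>M. \<exists>r\<in>R. x = r" using H by (simp add: complement_in_def)
  then show "R = M" using R(2) by blast
qed (use codim_self[OF M] in simp)

text \<open>The bookkeeping behind the invariance of the index: for a fixed splitting \<open>M = K \<oplus> M0\<close> on whose second summand
\<open>A\<close> is injective, the index of \<open>A\<close> on \<open>M\<close> is \<open>dim K - codim A(M0)\<close>. In this additive form it
holds for infinite dimensions too.\<close>

lemma edim_kernel_plus_codim:
  fixes A :: "'a::complex_banach \<Rightarrow> 'a"
  assumes A: "clinear A" and M: "complex_vector.subspace M" "A ` M \<subseteq> M"
    and K: "complex_vector.subspace K" "K \<subseteq> M" and M0: "complex_vector.subspace M0" "M0 \<subseteq> M"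
    and KM0: "K \<inter> M0 = {0}" "M \<subseteq> sum_space K M0"
    and inj: "kernel_op M0 A = {0}"
  shows "edim K + codim M (A ` M) = edim (kernel_op M A) + codim M (A ` M0)"
proof -
  interpret A: Vector_Spaces.linear scaleC scaleC A using A by (simp add: clinear_iff_linear)
  let ?Z = "kernel_op M A"
  have Z: "complex_vector.subspace ?Z" "?Z \<subseteq> M"
    using M(1) by (auto simp: kernel_op_def complex_vector.subspace_def A.add A.scale A.zero)
  have ZM0: "M0 \<inter> ?Z = {0}" using inj M0(2) by (auto simp: kernel_op_def)
  let ?S = "sum_space M0 ?Z"
  have S: "complex_vector.subspace ?S" "?S \<subseteq> M"
    using subspace_sum_space[OF M0(1) Z(1)] sum_space_subset[OF M(1) M0(2) Z(2)] by auto
  obtain L where L: "complement_in M ?S L" using complement_in_exists[OF S(1) M(1) S(2)] by blast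
  have L': "complex_vector.subspace L" "L \<subseteq> M" "?S \<inter> L = {0}"
    "\<And>x. x \<in> M \<Longrightarrow> \<exists>r\<in>?S. \<exists>f\<in>L. x = r + f" using L by (auto simp: complement_in_def)
  have "\<exists>r\<in>M0. \<exists>f\<in>K. x = r + f" if "x \<in> M" for x
  proof -
    obtain k m where "k \<in> K" "m \<in> M0" "x = k + m"
      using subsetD[OF KM0(2) \<open>x \<in> M\<close>] by (rule sum_spaceE)
    then show ?thesis by (intro bexI[of _ m] bexI[of _ k]) (simp_all add: add.commute)
  qed
  moreover have "M0 \<inter> K = {0}" using KM0(1) by (simp add: Int_commute)
  ultimately have "complement_in M M0 K" using K by (simp add: complement_in_def)
  then have "edim K = codim M M0" using codim_eq[OF M0] by simp
  also have "\<dots> = edim ?Z + codim M ?S" using codim_sum_space[OF M0 Z ZM0 M(1)] .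
  also have "codim M ?S = edim L" using codim_eq[OF S L] .
  finally have 1: "edim K = edim ?Z + edim L" .
  have ker: "x = 0 \<and> l = 0" if "x \<in> M0" "l \<in> L" "A x = A l" for x l
  proof -
    have "l - x \<in> ?Z" using that M(1) M0(2) L'(2) complex_vector.subspace_diff[OF M(1), of l x]
      by (auto simp: kernel_op_def A.diff)
    then have "x + (l - x) \<in> ?S" using that by (intro sum_spaceI)
    then have "l = 0" using that L'(3) by auto
    then have "x \<in> kernel_op M0 A" using that by (auto simp: kernel_op_def A.zero)
    then show ?thesis using inj \<open>l = 0\<close> by auto
  qed
  have injL: "inj_on A L"
  proof (rule inj_onI)
    fix x y assume "x \<in> L" "y \<in> L" "A x = A y"
    then have "x - y \<in> L" "A 0 = A (x - y)"
      using complex_vector.subspace_diff[OF L'(1)] by (auto simp: A.diff A.zero)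
    then show "x = y" using ker[of 0 "x - y"] complex_vector.subspace_0[OF M0(1)] by auto
  qed
  have AM0: "complex_vector.subspace (A ` M0)" "A ` M0 \<subseteq> M" and AL: "complex_vector.subspace (A ` L)" "A ` L \<subseteq> M"
    using A.subspace_image[OF M0(1)] A.subspace_image[OF L'(1)] M(2) M0(2) L'(2) by auto
  have "A ` M0 \<inter> A ` L = {0}"
  proof -
    have "y = 0" if y: "y \<in> A ` M0" "y \<in> A ` L" for y
    proof -
      obtain x l where xl: "x \<in> M0" "l \<in> L" "y = A x" "y = A l" using y by blast
      then have "l = 0" using ker[of x l] by simp
      then show ?thesis using xl(4) by (simp add: A.zero)
    qed
    then show ?thesis
      using complex_vector.subspace_0[OF AM0(1)] complex_vector.subspace_0[OF AL(1)] by blast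
  qed
  then have "codim M (A ` M0) = edim (A ` L) + codim M (sum_space (A ` M0) (A ` L))"
    using AM0 AL M(1) by (intro codim_sum_space)
  moreover have "sum_space (A ` M0) (A ` L) = A ` M"
  proof (intro equalityI subsetI)
    fix y assume "y \<in> A ` M"
    then obtain x where x: "x \<in> M" "y = A x" by blast
    obtain s l where sl: "s \<in> ?S" "l \<in> L" "x = s + l" using L'(4)[OF x(1)] by blast
    obtain u z where uz: "u \<in> M0" "z \<in> ?Z" "s = u + z" using sl(1) by (rule sum_spaceE)
    have "y = A u + A l" using x sl uz by (auto simp: A.add kernel_op_def)
    then show "y \<in> sum_space (A ` M0) (A ` L)" using uz sl by (auto intro: sum_spaceI)
  next
    fix y assume "y \<in> sum_space (A ` M0) (A ` L)"
    then obtain u l where ul: "u \<in> M0" "l \<in> L" "y = A u + A l" by (auto elim!: sum_spaceE)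
    then have "u + l \<in> M" using M0(2) L'(2) by (intro complex_vector.subspace_add[OF M(1)]) auto
    then show "y \<in> A ` M" using ul(3) by (metis A.add imageI)
  qed
  moreover have "edim (A ` L) = edim L" using A L'(1) injL by (rule edim_image_inj)
  ultimately show ?thesis using 1 by (simp add: add.assoc)
qed


section \<open>Operators and their invariant splittings\<close>

lemma bounded_op_imp_clinear: "bounded_op UNIV T \<Longrightarrow> clinear T"
  by (simp add: bounded_op_def clinear_def)

lemma bounded_op_imp_bounded_linear: "bounded_op UNIV T \<Longrightarrow> bounded_linear T"
  by (simp add: bounded_op_UNIV)

lemma bounded_op_shift:
  assumes "bounded_op UNIV T" shows "bounded_op UNIV (shift T \<mu>)"
  using assms bounded_linear_scaleC_right unfolding bounded_op_UNIV shift_def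
  by (auto intro!: bounded_linear_sub simp: complex_vector.scale_right_diff_distrib mult.commute)

lemma shift_shift: "shift (shift T a) b = shift T (a + b)"
  by (simp add: shift_def scaleC_add_left fun_eq_iff)

lemma shift_zero [simp]: "shift T 0 = T"
  by (simp add: shift_def)

definition closed_invariant :: "('a::complex_banach \<Rightarrow> 'a) \<Rightarrow> 'a set \<Rightarrow> bool" where
  "closed_invariant T M \<longleftrightarrow> complex_vector.subspace M \<and> closed M \<and> T ` M \<subseteq> M"

text \<open>\<open>splits T M A B\<close> relativizes \<open>Red\<close> to an invariant subspace \<open>M\<close>, so that a summand can be split further.\<close>

definition splits :: "('a::complex_banach \<Rightarrow> 'a) \<Rightarrow> 'a set \<Rightarrow> 'a set \<Rightarrow> 'a set \<Rightarrow> bool" where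
  "splits T M A B \<longleftrightarrow> closed_invariant T A \<and> closed_invariant T B \<and> A \<inter> B = {0} \<and> M = sum_space A B"

lemma Red_iff_splits: "(M, N) \<in> Red T \<longleftrightarrow> splits T UNIV M N"
proof -
  have "UNIV = sum_space M N \<longleftrightarrow> (\<forall>x. \<exists>m\<in>M. \<exists>n\<in>N. x = m + n)"
    unfolding set_eq_iff mem_sum_space by blast
  then show ?thesis unfolding Red_def splits_def closed_invariant_def by auto
qed

lemma closed_invariantD:
  assumes "closed_invariant T M"
  shows "complex_vector.subspace M" "closed M" "T ` M \<subseteq> M" "subspace M"
  using assms subspace_if_csubspace by (auto simp: closed_invariant_def)

lemma closed_invariant_UNIV: "closed_invariant T UNIV"
  by (simp add: closed_invariant_def)

lemma closed_invariant_shift: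
  assumes "closed_invariant T M" shows "closed_invariant (shift T \<mu>) M"
  using assms by (auto simp: closed_invariant_def shift_def
      intro!: complex_vector.subspace_diff complex_vector.subspace_scale)

lemma splits_shift: "splits T M A B \<Longrightarrow> splits (shift T \<mu>) M A B"
  by (simp add: splits_def closed_invariant_shift)

lemma splits_superset:
  assumes "splits T M A B" shows "A \<subseteq> M" "B \<subseteq> M" "complex_vector.subspace M"
  using assms sum_space_superset[of A B] subspace_sum_space[of A B]
  by (auto simp: splits_def closed_invariant_def)

lemma splits_trivial: "closed_invariant T M \<Longrightarrow> clinear T \<Longrightarrow> splits T M M {0}"
  unfolding splits_def sum_space_def closed_invariant_def clinear_def
  by (auto simp: complex_vector.subspace_0) (metis complex_vector.scale_zero_left)

lemma clinear_simps:
  assumes "clinear T"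
  shows "T (x + y) = T x + T y" "T (c *\<^sub>C x) = c *\<^sub>C T x" "T 0 = 0" "T (x - y) = T x - T y" "T (- x) = - T x"
proof -
  interpret T: Vector_Spaces.linear scaleC scaleC T using assms by (simp add: clinear_iff_linear)
  show "T (x + y) = T x + T y" "T (c *\<^sub>C x) = c *\<^sub>C T x" "T 0 = 0" "T (x - y) = T x - T y" "T (- x) = - T x"
    by (fact T.add T.scale T.zero T.diff T.neg)+
qed

lemma csubspace_image: "clinear T \<Longrightarrow> complex_vector.subspace M \<Longrightarrow> complex_vector.subspace (T ` M)"
  using module_hom.subspace_image[of scaleC scaleC T M] by (simp add: clinear_iff_linear linear_iff_module_hom)

lemma csubspace_kernel: "clinear T \<Longrightarrow> complex_vector.subspace M \<Longrightarrow> complex_vector.subspace (kernel_op M T)"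
  by (auto simp: complex_vector.subspace_def kernel_op_def clinear_simps)

lemma inj_on_iff_kernel:
  assumes "clinear T" "complex_vector.subspace M"
  shows "inj_on T M \<longleftrightarrow> kernel_op M T = {0}"
proof
  assume "inj_on T M"
  then have "x = 0" if "x \<in> kernel_op M T" for x
    using that inj_onD[of T M x 0] clinear_simps(3)[OF assms(1)] complex_vector.subspace_0[OF assms(2)]
    by (auto simp: kernel_op_def)
  then show "kernel_op M T = {0}"
    using complex_vector.subspace_0[OF csubspace_kernel[OF assms]] by blast
next
  assume ker: "kernel_op M T = {0}"
  show "inj_on T M"
  proof (rule inj_onI)
    fix x y assume "x \<in> M" "y \<in> M" "T x = T y"
    then have "x - y \<in> kernel_op M T"
      using complex_vector.subspace_diff[OF assms(2)] by (simp add: kernel_op_def clinear_simps[OF assms(1)])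
    then show "x = y" using ker by simp
  qed
qed

lemma bounded_below_kernel: "bounded_below M T \<Longrightarrow> 0 \<in> M \<Longrightarrow> T 0 = 0 \<Longrightarrow> kernel_op M T = {0}"
  by (auto simp: bounded_below_def kernel_op_def mult_le_0_iff)

lemma bounded_below_closed:
  assumes T: "bounded_linear T" and M: "subspace M" "closed M" and bb: "bounded_below M T"
  shows "closed (T ` M)"
proof -
  obtain c where "c > 0" "\<forall>x\<in>M. c * norm x \<le> norm (T x)" using bb by (auto simp: bounded_below_def)
  then show ?thesis using complete_isometric_image[of c M T] T M by (simp add: complete_eq_closed)
qed

lemma bounded_below_if_kernel:
  assumes T: "bounded_op UNIV T" and M: "complex_vector.subspace M" "closed M"
    and ker: "kernel_op M T = {0}" and cl: "closed (T ` M)"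
  shows "bounded_below M T"
proof -
  obtain C where C: "C > 0" "\<And>y. y \<in> T ` M \<Longrightarrow> \<exists>x\<in>M. T x = y \<and> norm x \<le> C * norm y"
    using open_mapping[OF bounded_op_imp_bounded_linear[OF T] subspace_if_csubspace[OF M(1)] M(2) cl] by blast
  have inj: "inj_on T M" using ker inj_on_iff_kernel[OF bounded_op_imp_clinear[OF T] M(1)] by simp
  have "(1 / C) * norm x \<le> norm (T x)" if x: "x \<in> M" for x
  proof -
    obtain x' where "x' \<in> M" "T x' = T x" "norm x' \<le> C * norm (T x)" using C(2) x by blast
    then have "norm x \<le> C * norm (T x)" using inj x by (metis inj_onD)
    then show ?thesis using C(1) by (simp add: field_simps)
  qed
  then show ?thesis unfolding bounded_below_def using C(1) by (intro exI[of _ "1 / C"]) auto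
qed

lemma bounded_below_shift:
  assumes c: "\<And>x. x \<in> M \<Longrightarrow> c * norm x \<le> norm (T x)" and x: "x \<in> M"
  shows "(c - cmod \<mu>) * norm x \<le> norm (shift T \<mu> x)"
proof -
  have "norm (T x) \<le> norm (shift T \<mu> x) + norm (\<mu> *\<^sub>C x)"
    unfolding shift_def by (metis diff_add_cancel norm_triangle_ineq)
  then show ?thesis using c[OF x] by (simp add: norm_scaleC algebra_simps)
qed

lemma bounded_below_shift_near:
  assumes "bounded_below M T"
  shows "\<exists>\<epsilon>>0. \<forall>\<mu>. cmod \<mu> < \<epsilon> \<longrightarrow> bounded_below M (shift T \<mu>)"
proof -
  obtain c where c: "c > 0" "\<And>x. x \<in> M \<Longrightarrow> c * norm x \<le> norm (T x)"
    using assms by (auto simp: bounded_below_def)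
  then have "bounded_below M (shift T \<mu>)" if "cmod \<mu> < c" for \<mu>
    unfolding bounded_below_def using bounded_below_shift[of M c T _ \<mu>] that
    by (intro exI[of _ "c - cmod \<mu>"]) auto
  with c(1) show ?thesis by blast
qed

text \<open>The inverse is automatically bounded by the open mapping theorem, so spectra can be computed from bijectivity alone.\<close>

lemma invertible_iff_bij:
  assumes T: "bounded_op UNIV T" and M: "closed_invariant T M"
  shows "invertible_op M T \<longleftrightarrow> bij_betw T M M"
proof
  assume "invertible_op M T"
  then obtain S where S: "bounded_op M S" "\<forall>x\<in>M. S (T x) = x \<and> T (S x) = x"
    by (auto simp: invertible_op_def)
  then show "bij_betw T M M"
    using closed_invariantD(3)[OF M] by (intro bij_betwI[of T M M S]) (auto simp: bounded_op_def)
next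
  assume bij: "bij_betw T M M"
  note M' = closed_invariantD[OF M]
  have inj: "inj_on T M" and im: "T ` M = M" using bij by (auto simp: bij_betw_def)
  note cl = bounded_op_imp_clinear[OF T]
  obtain C where C: "C > 0" "\<And>y. y \<in> M \<Longrightarrow> \<exists>x\<in>M. T x = y \<and> norm x \<le> C * norm y"
    using open_mapping[OF bounded_op_imp_bounded_linear[OF T] M'(4,2)] im M'(2) by auto
  define S where "S = inv_into M T"
  have SM: "S x \<in> M" and TS: "T (S x) = x" if "x \<in> M" for x
    using that im by (auto simp: S_def inv_into_into f_inv_into_f)
  have ST: "S (T x) = x" if "x \<in> M" for x using that inj by (simp add: S_def)
  have S_eq: "S y = x" if "x \<in> M" "T x = y" for x y using ST that by blast
  have "bounded_op M S"
    unfolding bounded_op_def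
  proof (intro conjI ballI allI)
    fix x y assume "x \<in> M" "y \<in> M"
    then show "S (x + y) = S x + S y"
      by (intro S_eq) (auto simp: SM TS clinear_simps[OF cl] complex_vector.subspace_add[OF M'(1)])
  next
    fix c x assume "x \<in> M"
    then show "S (c *\<^sub>C x) = c *\<^sub>C S x"
      by (intro S_eq) (auto simp: SM TS clinear_simps[OF cl] complex_vector.subspace_scale[OF M'(1)])
  next
    show "\<exists>K. \<forall>x\<in>M. norm (S x) \<le> K * norm x"
    proof (intro exI ballI)
      fix y assume "y \<in> M"
      then obtain x where "x \<in> M" "T x = y" "norm x \<le> C * norm y" using C(2) by blast
      then show "norm (S y) \<le> C * norm y" using S_eq by simp
    qed
  qed (rule SM)
  then show "invertible_op M T" unfolding invertible_op_def using ST TS by (intro exI[of _ S]) auto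
qed

text \<open>The projections of a closed direct sum are bounded, by the open mapping theorem for addition.\<close>

lemma direct_sum_norm_bound:
  fixes A B :: "'a::complex_banach set"
  assumes A: "complex_vector.subspace A" "closed A" and B: "complex_vector.subspace B" "closed B"
    and AB: "A \<inter> B = {0}" and cl: "closed (sum_space A B)"
  shows "\<exists>C>0. \<forall>a\<in>A. \<forall>b\<in>B. norm (a, b) \<le> C * norm (a + b)"
proof -
  let ?p = "\<lambda>x. fst x + snd x :: 'a"
  have im: "?p ` (A \<times> B) = sum_space A B" by (rule sum_space_as_image)
  have "bounded_linear ?p" by (intro bounded_linear_add bounded_linear_fst bounded_linear_snd)
  moreover have "subspace (A \<times> B)" using A B by (intro subspace_Times subspace_if_csubspace)
  moreover have "closed (A \<times> B)" using A B by (intro closed_Times)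
  ultimately obtain C where C: "C > 0"
    "\<And>y. y \<in> ?p ` (A \<times> B) \<Longrightarrow> \<exists>x\<in>A \<times> B. ?p x = y \<and> norm x \<le> C * norm y"
    using open_mapping[of ?p "A \<times> B"] cl im by metis
  have "norm (a, b) \<le> C * norm (a + b)" if ab: "a \<in> A" "b \<in> B" for a b
  proof -
    have "a + b \<in> ?p ` (A \<times> B)" using ab by force
    then obtain a' b' where x: "a' \<in> A" "b' \<in> B" "a' + b' = a + b" "norm (a', b') \<le> C * norm (a + b)"
      using C(2) by fastforce
    have "a' - a = b - b'" using x(3) by (simp add: algebra_simps)
    then have "a' - a \<in> A \<inter> B"
      using complex_vector.subspace_diff[OF A(1) x(1) ab(1)] complex_vector.subspace_diff[OF B(1) ab(2) x(2)] by simp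
    then have "a' = a" using AB by auto
    then show ?thesis using x(3,4) by simp
  qed
  with C(1) show ?thesis by blast
qed

text \<open>Addition is bounded below on \<open>A \<times> B\<close>, hence on \<open>A0 \<times> B\<close>, so its range there is complete.\<close>

lemma closed_sum_of_summands:
  fixes A B :: "'a::complex_banach set"
  assumes A: "complex_vector.subspace A" "closed A" and B: "complex_vector.subspace B" "closed B"
    and AB: "A \<inter> B = {0}" and cl: "closed (sum_space A B)"
    and A0: "complex_vector.subspace A0" "closed A0" "A0 \<subseteq> A"
  shows "closed (sum_space A0 B)"
proof -
  obtain C where C: "C > 0" "\<And>a b. a \<in> A \<Longrightarrow> b \<in> B \<Longrightarrow> norm (a, b) \<le> C * norm (a + b)"
    using direct_sum_norm_bound[OF A B AB cl] by blast
  let ?p = "\<lambda>x. fst x + snd x :: 'a"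
  have im: "?p ` (A0 \<times> B) = sum_space A0 B" by (rule sum_space_as_image)
  have "bounded_linear ?p" by (intro bounded_linear_add bounded_linear_fst bounded_linear_snd)
  moreover have "subspace (A0 \<times> B)" using A0 B by (intro subspace_Times subspace_if_csubspace)
  moreover have "complete (A0 \<times> B)" using A0 B by (simp add: complete_eq_closed closed_Times)
  moreover have "\<forall>x\<in>A0 \<times> B. (1 / C) * norm x \<le> norm (?p x)"
    using C A0(3) by (auto simp: field_simps)
  ultimately have "complete (?p ` (A0 \<times> B))"
    using C(1) by (intro complete_isometric_image[of "1 / C"]) auto
  then show ?thesis using im by (simp add: complete_eq_closed)
qed

lemma splits_image:
  assumes "clinear T" "splits T M A B"
  shows "T ` M = sum_space (T ` A) (T ` B)"
proof (intro equalityI subsetI)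
  fix y assume "y \<in> T ` M"
  then obtain a b where ab: "a \<in> A" "b \<in> B" "y = T (a + b)"
    using assms(2) unfolding splits_def by (blast elim: sum_spaceE)
  then show "y \<in> sum_space (T ` A) (T ` B)"
    using sum_spaceI[of "T a" "T ` A" "T b" "T ` B"] by (simp add: clinear_simps[OF assms(1)])
next
  fix y assume "y \<in> sum_space (T ` A) (T ` B)"
  then obtain a b where ab: "a \<in> A" "b \<in> B" "y = T a + T b" by (auto elim!: sum_spaceE)
  then have "y = T (a + b)" by (simp add: clinear_simps[OF assms(1)])
  then show "y \<in> T ` M" using ab assms(2) by (auto simp: splits_def intro: sum_spaceI)
qed

lemma splits_eqD:
  assumes "splits T M A B" "a \<in> A" "b \<in> B" "a' \<in> A" "b' \<in> B" "a + b = a' + b'"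
  shows "a = a'" "b = b'"
proof -
  have sub: "complex_vector.subspace A" "complex_vector.subspace B" "A \<inter> B = {0}"
    using assms(1) by (simp_all add: splits_def closed_invariant_def)
  have "a - a' = b' - b" using assms(6) by (simp add: algebra_simps)
  then have "a - a' \<in> A \<inter> B"
    using complex_vector.subspace_diff[OF sub(1) assms(2,4)] complex_vector.subspace_diff[OF sub(2) assms(5,3)]
    by simp
  then show "a = a'" using sub(3) by simp
  then show "b = b'" using assms(6) by simp
qed

lemma splits_kernel:
  assumes "clinear T" "splits T M A B"
  shows "kernel_op M T = sum_space (kernel_op A T) (kernel_op B T)"
proof (intro equalityI subsetI)
  fix x assume x: "x \<in> kernel_op M T"
  then obtain a b where ab: "a \<in> A" "b \<in> B" "x = a + b"
    using assms(2) by (auto simp: splits_def kernel_op_def elim!: sum_spaceE)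
  have inv: "T a \<in> A" "T b \<in> B" "0 \<in> A" "0 \<in> B"
    using ab assms(2) by (auto simp: splits_def closed_invariant_def complex_vector.subspace_0)
  have "T a + T b = 0 + 0" using x ab(3) by (simp add: kernel_op_def clinear_simps[OF assms(1)])
  then have "T a = 0" "T b = 0"
    using splits_eqD[OF assms(2) inv(1,2) inv(3,4)] by auto
  then show "x \<in> sum_space (kernel_op A T) (kernel_op B T)"
    using ab by (auto simp: kernel_op_def intro: sum_spaceI)
next
  fix x assume "x \<in> sum_space (kernel_op A T) (kernel_op B T)"
  then obtain a b where "a \<in> A" "b \<in> B" "x = a + b" "T a = 0" "T b = 0"
    by (auto simp: kernel_op_def elim!: sum_spaceE)
  then show "x \<in> kernel_op M T"
    using assms(2) by (auto simp: kernel_op_def splits_def clinear_simps[OF assms(1)] intro: sum_spaceI)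
qed

lemma splits_image_eq_iff:
  assumes T: "clinear T" and s: "splits T M A B"
  shows "T ` M = M \<longleftrightarrow> T ` A = A \<and> T ` B = B"
proof
  assume M: "T ` M = M"
  have inv: "T ` A \<subseteq> A" "T ` B \<subseteq> B" and z: "0 \<in> A" "0 \<in> B"
    using s by (auto simp: splits_def closed_invariant_def complex_vector.subspace_0)
  have "x \<in> T ` A" if x: "x \<in> A" for x
  proof -
    have "x \<in> sum_space (T ` A) (T ` B)" using x M splits_image[OF T s] splits_superset[OF s] by auto
    then obtain a b where ab: "a \<in> A" "b \<in> B" "x = T a + T b" by (auto elim!: sum_spaceE)
    have "T a \<in> A" "T b \<in> B" using ab inv by blast+
    then have "x = T a" by (rule splits_eqD(1)[OF s x z(2)]) (simp add: ab(3))
    then show ?thesis using ab by blast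
  qed
  moreover have "x \<in> T ` B" if x: "x \<in> B" for x
  proof -
    have "x \<in> sum_space (T ` A) (T ` B)" using x M splits_image[OF T s] splits_superset[OF s] by auto
    then obtain a b where ab: "a \<in> A" "b \<in> B" "x = T a + T b" by (auto elim!: sum_spaceE)
    have "T a \<in> A" "T b \<in> B" using ab inv by blast+
    then have "x = T b" by (rule splits_eqD(2)[OF s z(1) x]) (simp add: ab(3))
    then show ?thesis using ab by blast
  qed
  ultimately show "T ` A = A \<and> T ` B = B" using inv by blast
next
  assume "T ` A = A \<and> T ` B = B"
  then show "T ` M = M" using splits_image[OF T s] s by (simp add: splits_def)
qed

lemma splits_kernel_eq_zero_iff:
  assumes T: "clinear T" and s: "splits T M A B"
  shows "kernel_op M T = {0} \<longleftrightarrow> kernel_op A T = {0} \<and> kernel_op B T = {0}"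
proof -
  have sub: "complex_vector.subspace (kernel_op A T)" "complex_vector.subspace (kernel_op B T)"
    using s csubspace_kernel[OF T] by (auto simp: splits_def closed_invariant_def)
  have "sum_space {0} {0} = {0 :: 'a}" by (auto simp: sum_space_def)
  then show ?thesis
    using splits_kernel[OF T s] sum_space_superset[OF sub] sub[THEN complex_vector.subspace_0] by auto
qed

lemma splits_bij_iff:
  assumes T: "clinear T" and s: "splits T M A B"
  shows "bij_betw T M M \<longleftrightarrow> bij_betw T A A \<and> bij_betw T B B"
proof -
  have sub: "complex_vector.subspace M" "complex_vector.subspace A" "complex_vector.subspace B"
    using s splits_superset[OF s] by (auto simp: splits_def closed_invariant_def)
  show ?thesis
    unfolding bij_betw_def using inj_on_iff_kernel[OF T] sub splits_image_eq_iff[OF T s]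
      splits_kernel_eq_zero_iff[OF T s] by auto
qed

text \<open>An invertible summand is invisible to kernel and cokernel: a complement of the range in \<open>A\<close> is one in \<open>M\<close>.\<close>

lemma splits_invertible_part:
  assumes T: "clinear T" and s: "splits T M A B" and M: "closed M" and bij: "bij_betw T B B"
  shows "kernel_op M T = kernel_op A T" "closed (T ` M) \<longleftrightarrow> closed (T ` A)"
    "codim M (T ` M) = codim A (T ` A)"
proof -
  have s': "complex_vector.subspace A" "closed A" "T ` A \<subseteq> A" "complex_vector.subspace B" "closed B"
    "A \<inter> B = {0}" "M = sum_space A B" "complex_vector.subspace M"
    using s splits_superset(3)[OF s] by (auto simp: splits_def closed_invariant_def)
  have TA: "complex_vector.subspace (T ` A)" using csubspace_image[OF T s'(1)] .
  have TM: "complex_vector.subspace (T ` M)" using csubspace_image[OF T s'(8)] .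
  have imB: "T ` B = B" and kerB: "kernel_op B T = {0}"
    using bij inj_on_iff_kernel[OF T s'(4)] by (auto simp: bij_betw_def)
  have im: "T ` M = sum_space (T ` A) B" using splits_image[OF T s] imB by simp
  show "kernel_op M T = kernel_op A T"
    using splits_kernel[OF T s] kerB by (auto simp: sum_space_def)
  show "closed (T ` M) \<longleftrightarrow> closed (T ` A)"
  proof
    assume cl: "closed (T ` A)"
    have "closed (sum_space A B)" using M s'(7) by simp
    then show "closed (T ` M)"
      unfolding im by (rule closed_sum_of_summands[OF s'(1,2,4,5,6) _ TA cl s'(3)])
  next
    assume "closed (T ` M)"
    moreover have "T ` A = T ` M \<inter> A"
    proof (intro equalityI subsetI)
      fix x assume "x \<in> T ` M \<inter> A"
      then obtain a b where ab: "a \<in> A" "b \<in> B" "x = T a + b" "x \<in> A"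
        unfolding im by (auto elim!: sum_spaceE)
      have Ta: "T a \<in> A" using ab(1) s'(3) by blast
      have "x = T a"
        by (rule splits_eqD(1)[OF s ab(4) complex_vector.subspace_0[OF s'(4)] Ta ab(2)])
          (simp add: ab(3))
      then show "x \<in> T ` A" using ab by blast
    next
      fix x assume "x \<in> T ` A"
      then show "x \<in> T ` M \<inter> A" using s'(3) splits_superset(1)[OF s] by blast
    qed
    ultimately show "closed (T ` A)" using s'(2) by (simp add: closed_Int)
  qed
  obtain G where G: "complement_in A (T ` A) G" using complement_in_exists[OF TA s'(1) s'(3)] by blast
  have G': "complex_vector.subspace G" "G \<subseteq> A" "T ` A \<inter> G = {0}"
    "\<And>x. x \<in> A \<Longrightarrow> \<exists>r\<in>T ` A. \<exists>f\<in>G. x = r + f" using G by (auto simp: complement_in_def)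
  have "x = 0" if x: "x \<in> T ` M" "x \<in> G" for x
  proof -
    obtain a b where ab: "a \<in> A" "b \<in> B" "x = T a + b" using x(1) unfolding im by (auto elim!: sum_spaceE)
    have xA: "x \<in> A" and Ta: "T a \<in> A" using ab(1) s'(3) G'(2) x(2) by blast+
    have "x = T a"
      by (rule splits_eqD(1)[OF s xA complex_vector.subspace_0[OF s'(4)] Ta ab(2)])
        (simp add: ab(3))
    then show ?thesis using x ab G'(3) by blast
  qed
  then have "T ` M \<inter> G = {0}"
    using complex_vector.subspace_0[OF G'(1)] complex_vector.subspace_0[OF TM] by blast
  moreover have "\<exists>r\<in>T ` M. \<exists>f\<in>G. x = r + f" if x: "x \<in> M" for x
  proof -
    obtain a b where ab: "a \<in> A" "b \<in> B" "x = a + b" using x unfolding s'(7) by (rule sum_spaceE)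
    obtain r f where rf: "r \<in> T ` A" "f \<in> G" "a = r + f" using G'(4)[OF ab(1)] by blast
    have "r + b \<in> T ` M" unfolding im using rf ab by (intro sum_spaceI)
    moreover have "x = (r + b) + f" using ab rf by simp
    ultimately show ?thesis using rf(2) by blast
  qed
  ultimately have "complement_in M (T ` M) G"
    using G' splits_superset(1)[OF s] by (auto simp: complement_in_def)
  moreover have "T ` M \<subseteq> M" using im s' splits_superset[OF s] sum_space_subset[of M "T ` A" B] by auto
  ultimately show "codim M (T ` M) = codim A (T ` A)"
    using codim_eq[OF TM] codim_eq[OF TA s'(3) G] by simp
qed

lemma semi_fredholm_invertible_part:
  assumes T: "clinear T" and s: "splits T M A B" and M: "closed M" and bij: "bij_betw T B B"
  shows "upper_semi_fredholm M T \<longleftrightarrow> upper_semi_fredholm A T"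
    "lower_semi_fredholm M T \<longleftrightarrow> lower_semi_fredholm A T"
    "index_op M T = index_op A T"
  using splits_invertible_part[OF assms]
  by (simp_all add: upper_semi_fredholm_def lower_semi_fredholm_def index_op_def)

text \<open>Surjectivity is the geometric series for the inverse, unrolled as an induction on the power of \<open>T\<close> that
annihilates the given vector.\<close>

lemma bij_shift_nilpotent:
  assumes T: "clinear T" and N: "complex_vector.subspace N" "T ` N \<subseteq> N"
    and nil: "\<And>x. x \<in> N \<Longrightarrow> (T ^^ n) x = 0" and \<mu>: "\<mu> \<noteq> 0"
  shows "bij_betw (shift T \<mu>) N N"
proof -
  have "inj_on (shift T \<mu>) N"
  proof (rule inj_onI)
    fix x y assume xy: "x \<in> N" "y \<in> N" "shift T \<mu> x = shift T \<mu> y"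
    let ?z = "x - y"
    have "T ?z = \<mu> *\<^sub>C ?z"
      using xy(3) by (simp add: shift_def clinear_simps[OF T] algebra_simps complex_vector.scale_right_diff_distrib)
    then have "(T ^^ k) ?z = \<mu> ^ k *\<^sub>C ?z" for k
      by (induction k) (auto simp: clinear_simps[OF T] scaleC_one mult.commute)
    then have "\<mu> ^ n *\<^sub>C ?z = 0" using nil complex_vector.subspace_diff[OF N(1) xy(1,2)] by metis
    then show "x = y" using \<mu> by simp
  qed
  moreover have "\<exists>x\<in>N. shift T \<mu> x = y" if "y \<in> N" "(T ^^ k) y = 0" for y k
    using that
  proof (induction k arbitrary: y)
    case 0
    then show ?case by (intro bexI[of _ 0]) (auto simp: shift_def clinear_simps[OF T])
  next
    case (Suc k)
    have "(T ^^ k) (T y) = 0" using Suc.prems(2) by (simp add: funpow_swap1)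
    then obtain x where x: "x \<in> N" "shift T \<mu> x = T y" using Suc.IH[of "T y"] Suc.prems(1) N(2) by blast
    have "shift T \<mu> ((1 / \<mu>) *\<^sub>C (x - y)) = (1 / \<mu>) *\<^sub>C (shift T \<mu> x - shift T \<mu> y)"
      by (simp add: shift_def clinear_simps[OF T] complex_vector.scale_right_diff_distrib mult.commute)
    also have "\<dots> = y" using \<mu> x by (simp add: shift_def)
    finally show ?case
      using complex_vector.subspace_scale[OF N(1) complex_vector.subspace_diff[OF N(1) x(1) Suc.prems(1)]] by blast
  qed
  moreover have "shift T \<mu> ` N \<subseteq> N"
    using N by (auto simp: shift_def intro!: complex_vector.subspace_diff complex_vector.subspace_scale)
  ultimately show ?thesis unfolding bij_betw_def using nil by blast
qed


section \<open>Stability of upper semi-Fredholm operators\<close>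

lemma bounded_linear_shift: "bounded_op UNIV T \<Longrightarrow> bounded_linear (shift T \<mu>)"
  by (intro bounded_op_imp_bounded_linear bounded_op_shift)

text \<open>The pairs \<open>(x, f)\<close> map onto \<open>M\<close> by \<open>T x + f\<close>, and surjectivity persists under a small perturbation of \<open>T\<close>
with a uniform bound on the solution. The auxiliary summand \<open>F\<close> lets one lemma serve both the ranges of finite
codimension and, with \<open>F = {0}\<close>, the surjective operators.\<close>

lemma surjective_shift_near:
  assumes T: "bounded_op UNIV T" and M: "complex_vector.subspace M" "closed M"
    and M0: "complex_vector.subspace M0" "closed M0" "M0 \<subseteq> M" "T ` M0 \<subseteq> M"
    and F: "complex_vector.subspace F" "closed F" "F \<subseteq> M" and surj: "M \<subseteq> sum_space (T ` M0) F"
  shows "\<exists>C>0. \<exists>\<delta>>0. \<forall>\<mu>. cmod \<mu> < \<delta> \<longrightarrow>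
           (\<forall>y\<in>M. \<exists>x\<in>M0. \<exists>f\<in>F. y = shift T \<mu> x + f \<and> norm x \<le> C * norm y \<and> norm f \<le> C * norm y)"
proof -
  define A where "A \<mu> = (\<lambda>x. shift T \<mu> (fst x) + snd x)" for \<mu>
  have blA: "bounded_linear (A \<mu>)" for \<mu>
    unfolding A_def
    by (intro bounded_linear_add bounded_linear_snd bounded_linear_compose[OF bounded_linear_shift[OF T]]
        bounded_linear_fst)
  have sub: "subspace (M0 \<times> F)" "closed (M0 \<times> F)"
    using M0 F by (auto intro!: subspace_Times closed_Times subspace_if_csubspace)
  have shiftM: "shift T \<mu> x \<in> M" if "x \<in> M0" for \<mu> x
    using that M0(3,4) complex_vector.subspace_diff[OF M(1)] complex_vector.subspace_scale[OF M(1)]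
    unfolding shift_def by blast
  have into: "A \<mu> ` (M0 \<times> F) \<subseteq> M" for \<mu>
  proof
    fix y assume "y \<in> A \<mu> ` (M0 \<times> F)"
    then obtain x f where "x \<in> M0" "f \<in> F" "y = shift T \<mu> x + f" by (auto simp: A_def)
    then show "y \<in> M" using complex_vector.subspace_add[OF M(1) shiftM, of x f \<mu>] F(3) by auto
  qed
  have im: "A 0 ` (M0 \<times> F) = M"
  proof
    show "M \<subseteq> A 0 ` (M0 \<times> F)"
    proof
      fix y assume "y \<in> M"
      then obtain z f where "z \<in> T ` M0" "f \<in> F" "y = z + f" by (rule sum_spaceE[OF subsetD[OF surj]])
      then obtain x where "x \<in> M0" "f \<in> F" "y = T x + f" by blast
      then have "y = A 0 (x, f)" "(x, f) \<in> M0 \<times> F" by (auto simp: A_def)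
      then show "y \<in> A 0 ` (M0 \<times> F)" by blast
    qed
  qed (rule into)
  have cl: "closed (A 0 ` (M0 \<times> F))" using im M(2) by simp
  obtain C where C: "C > 0" "\<And>y. y \<in> M \<Longrightarrow> \<exists>x\<in>M0 \<times> F. A 0 x = y \<and> norm x \<le> C * norm y"
    using open_mapping[OF blA[of 0] sub cl, unfolded im] by blast
  have "\<exists>x\<in>M0. \<exists>f\<in>F. y = shift T \<mu> x + f \<and> norm x \<le> (2 * C) * norm y \<and> norm f \<le> (2 * C) * norm y"
    if \<mu>: "cmod \<mu> < 1 / (2 * C)" and y: "y \<in> M" for \<mu> y
  proof -
    have d: "C * cmod \<mu> < 1 / 2" using \<mu> C(1) by (simp add: field_simps)
    have "\<exists>x\<in>M0 \<times> F. A \<mu> x = y \<and> norm x \<le> C / (1 - C * cmod \<mu>) * norm y"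
    proof (rule surjective_perturbation[OF blA sub subspace_if_csubspace[OF M(1)] into _ _ _ C(2) _ y])
      fix x :: "'a \<times> 'a"
      have "norm (A 0 x - A \<mu> x) = cmod \<mu> * norm (fst x)" by (simp add: A_def shift_def norm_scaleC)
      also have "\<dots> \<le> cmod \<mu> * norm x" using norm_fst_le[of "fst x" "snd x"] by (intro mult_left_mono) simp_all
      finally show "norm (A 0 x - A \<mu> x) \<le> cmod \<mu> * norm x" .
    qed (use C(1) d in auto)
    then obtain x f where xf: "x \<in> M0" "f \<in> F" "A \<mu> (x, f) = y" "norm (x, f) \<le> C / (1 - C * cmod \<mu>) * norm y"
      by auto
    have "C / (1 - C * cmod \<mu>) \<le> C / (1 / 2)" using d C(1) by (intro divide_left_mono) auto
    then have "C / (1 - C * cmod \<mu>) \<le> 2 * C" by simp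
    then have "norm (x, f) \<le> (2 * C) * norm y"
      by (rule order_trans[OF xf(4) mult_right_mono]) simp
    moreover have "norm x \<le> norm (x, f)" "norm f \<le> norm (x, f)" by (auto simp: norm_Pair)
    ultimately show ?thesis using xf by (intro bexI[of _ x] bexI[of _ f]) (auto simp: A_def)
  qed
  then show ?thesis using C(1) by (intro exI[of _ "2 * C"] conjI exI[of _ "1 / (2 * C)"]) auto
qed

text \<open>A finite-dimensional subspace that meets the range only in \<open>0\<close> continues to do so: its coordinate functionals can be
chosen to vanish on \<open>T ` M0\<close>, and are then of size \<open>O(\<mu>)\<close> on the perturbed range.\<close>

lemma codim_shift_ge:
  assumes T: "bounded_op UNIV T" and M: "complex_vector.subspace M"
    and M0: "complex_vector.subspace M0" "closed M0" "M0 \<subseteq> M" "T ` M0 \<subseteq> M"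
    and c: "c > 0" "\<And>x. x \<in> M0 \<Longrightarrow> c * norm x \<le> norm (T x)"
    and m: "enat m \<le> codim M (T ` M0)"
  shows "\<exists>\<delta>>0. \<forall>\<mu>. cmod \<mu> < \<delta> \<longrightarrow> enat m \<le> codim M (shift T \<mu> ` M0)"
proof -
  note cl = bounded_op_imp_clinear[OF T]
  have R: "complex_vector.subspace (T ` M0)" using csubspace_image[OF cl M0(1)] .
  have clR: "closed (T ` M0)"
    using bounded_op_imp_bounded_linear[OF T] subspace_if_csubspace[OF M0(1)] M0(2)
    by (rule bounded_below_closed) (use c in \<open>auto simp: bounded_below_def\<close>)
  obtain G where G: "complement_in M (T ` M0) G" using complement_in_exists[OF R M M0(4)] by blast
  have G': "complex_vector.subspace G" "G \<subseteq> M" "T ` M0 \<inter> G = {0}" using G by (auto simp: complement_in_def)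
  have "enat m \<le> edim G" using m codim_eq[OF R M0(4) G] by simp
  then obtain B where B: "B \<subseteq> G" "finite B" "card B = m" "complex_vector.independent B"
    by (rule nat_le_edimE)
  let ?S = "complex_vector.span B"
  have SG: "?S \<subseteq> G" using B(1) G'(1) by (rule complex_vector.span_minimal)
  then have "T ` M0 \<inter> ?S = {0}"
    using G'(3) complex_vector.subspace_0[OF R] complex_vector.span_zero[of B] by blast
  then obtain \<phi> where \<phi>: "\<And>b. b \<in> B \<Longrightarrow> cfunctional (\<phi> b)" "\<And>b w. b \<in> B \<Longrightarrow> w \<in> T ` M0 \<Longrightarrow> \<phi> b w = 0"
    "\<And>b b'. b \<in> B \<Longrightarrow> b' \<in> B \<Longrightarrow> \<phi> b b' = (if b' = b then 1 else 0)"
    "\<And>v. v \<in> ?S \<Longrightarrow> v = (\<Sum>b\<in>B. \<phi> b v *\<^sub>C b)"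
    by (rule dual_basis[OF R clR B(2,4)]) (rule that)
  have "\<exists>k\<ge>0. \<forall>x. cmod (\<phi> b x) \<le> norm x * k" if "b \<in> B" for b
    using bounded_linear.nonneg_bounded[OF cfunctionalD(1)[OF \<phi>(1)[OF that]]] by blast
  then obtain k where k: "\<And>b. b \<in> B \<Longrightarrow> k b \<ge> 0" "\<And>b x. b \<in> B \<Longrightarrow> cmod (\<phi> b x) \<le> norm x * k b" by metis
  define K where "K = (\<Sum>b\<in>B. k b * norm b)"
  have K: "K \<ge> 0" unfolding K_def using k by (intro sum_nonneg) auto
  \<comment> \<open>For \<open>cmod \<mu> < \<delta>\<close> one has \<open>cmod \<mu> * K < c - cmod \<mu>\<close>: the coordinate estimate beats the lower bound of the shifted operator.\<close>
  define \<delta> where "\<delta> = c / (K + 1)"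
  have "\<delta> > 0" using c K by (simp add: \<delta>_def)
  moreover have "enat m \<le> codim M (shift T \<mu> ` M0)" if \<mu>: "cmod \<mu> < \<delta>" for \<mu>
  proof -
    note clm = bounded_op_imp_clinear[OF bounded_op_shift[OF T, of \<mu>]]
    let ?R = "shift T \<mu> ` M0"
    have R': "complex_vector.subspace ?R" using csubspace_image[OF clm M0(1)] .
    have R'M: "?R \<subseteq> M"
      using M0(3,4) complex_vector.subspace_diff[OF M] complex_vector.subspace_scale[OF M]
      unfolding shift_def by blast
    have "g = 0" if g: "g \<in> ?R" "g \<in> ?S" for g
    proof -
      obtain x where x: "x \<in> M0" "g = shift T \<mu> x" using g(1) by blast
      have \<phi>g: "\<phi> b g = - \<mu> * \<phi> b x" if b: "b \<in> B" for b
        using \<phi>(2)[OF b imageI[OF x(1)]] by (simp add: x(2) shift_def cfunctionalD[OF \<phi>(1)[OF b]])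
      have "norm g \<le> (\<Sum>b\<in>B. norm (\<phi> b g *\<^sub>C b))"
        using \<phi>(4)[OF g(2)] norm_sum[of "\<lambda>b. \<phi> b g *\<^sub>C b" B] by simp
      also have "\<dots> \<le> (\<Sum>b\<in>B. cmod \<mu> * norm x * (k b * norm b))"
      proof (rule sum_mono)
        fix b assume b: "b \<in> B"
        have "norm (\<phi> b g *\<^sub>C b) = cmod \<mu> * cmod (\<phi> b x) * norm b"
          by (simp add: norm_scaleC \<phi>g[OF b] norm_mult)
        also have "\<dots> \<le> cmod \<mu> * (norm x * k b) * norm b"
          using k(2)[OF b] by (intro mult_right_mono mult_left_mono) auto
        finally show "norm (\<phi> b g *\<^sub>C b) \<le> cmod \<mu> * norm x * (k b * norm b)" by (simp add: mult_ac)
      qed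
      also have "\<dots> = cmod \<mu> * norm x * K" by (simp add: K_def sum_distrib_left)
      finally have 1: "norm g \<le> cmod \<mu> * norm x * K" .
      have 2: "(c - cmod \<mu>) * norm x \<le> norm g"
        using bounded_below_shift[of M0 c T x \<mu>] c(2) x by simp
      have 3: "cmod \<mu> * (K + 1) < c" using \<mu> K by (simp add: \<delta>_def field_simps)
      have "(c - cmod \<mu> * (K + 1)) * norm x \<le> 0" using 1 2 by (simp add: algebra_simps)
      then have "norm x \<le> 0" using 3 by (simp add: mult_le_0_iff)
      then show "g = 0" using x by (simp add: clinear_simps[OF clm])
    qed
    then have "?R \<inter> ?S = {0}" using complex_vector.subspace_0[OF R'] complex_vector.span_zero[of B] by blast
    then have "edim ?S \<le> codim M ?R"
      using R' R'M SG G'(2) M by (intro edim_le_codim) auto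
    then show ?thesis using edim_span[OF B(2,4)] B(3) by simp
  qed
  ultimately show ?thesis by blast
qed

text \<open>A complement \<open>F\<close> of the range is finite-dimensional, and \<open>(x, f) \<mapsto> T x + f\<close> remains onto after a small shift.\<close>

lemma codim_shift_le:
  assumes T: "bounded_op UNIV T" and M: "complex_vector.subspace M" "closed M"
    and M0: "complex_vector.subspace M0" "closed M0" "M0 \<subseteq> M" "T ` M0 \<subseteq> M"
    and m: "codim M (T ` M0) \<le> enat m"
  shows "\<exists>\<delta>>0. \<forall>\<mu>. cmod \<mu> < \<delta> \<longrightarrow> codim M (shift T \<mu> ` M0) \<le> enat m"
proof -
  note cl = bounded_op_imp_clinear[OF T]
  have R: "complex_vector.subspace (T ` M0)" using csubspace_image[OF cl M0(1)] .
  obtain F where F: "complement_in M (T ` M0) F" using complement_in_exists[OF R M(1) M0(4)] by blast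
  have F': "complex_vector.subspace F" "F \<subseteq> M" "M \<subseteq> sum_space (T ` M0) F"
    using F by (simp_all add: complement_in_def) (rule complement_in_spans[OF F])
  have eF: "edim F \<le> enat m" using m codim_eq[OF R M0(4) F] by simp
  then have "edim F < \<infinity>" by (rule le_less_trans) simp
  then have clF: "closed F" by (rule finite_dim_closed[OF F'(1)])
  obtain C' \<delta> where C': "\<delta> > 0" "\<forall>\<mu>. cmod \<mu> < \<delta> \<longrightarrow>
      (\<forall>y\<in>M. \<exists>x\<in>M0. \<exists>f\<in>F. y = shift T \<mu> x + f \<and> norm x \<le> C' * norm y \<and> norm f \<le> C' * norm y)"
    using surjective_shift_near[OF T M M0 F'(1) clF F'(2,3)] by (elim exE conjE)
  have C: "\<exists>x\<in>M0. \<exists>f\<in>F. y = shift T \<mu> x + f" if "cmod \<mu> < \<delta>" "y \<in> M" for \<mu> y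
    using C'(2) that by fast
  have "codim M (shift T \<mu> ` M0) \<le> enat m" if \<mu>: "cmod \<mu> < \<delta>" for \<mu>
  proof (rule order_trans[OF codim_le_edim eF])
    show "complex_vector.subspace (shift T \<mu> ` M0)"
      using csubspace_image[OF bounded_op_imp_clinear[OF bounded_op_shift[OF T]] M0(1)] .
    show "shift T \<mu> ` M0 \<subseteq> M"
      using M0(3,4) complex_vector.subspace_diff[OF M(1)] complex_vector.subspace_scale[OF M(1)]
      unfolding shift_def by blast
    show "M \<subseteq> sum_space (shift T \<mu> ` M0) F" using C[OF \<mu>] by (simp add: subset_iff mem_sum_space)
  qed (fact F'(1) M(1))+
  with C'(1) show ?thesis by blast
qed

text \<open>By the previous two lemmas each condition \<open>m \<le> codim\<close> is locally constant on the disc in which the shifted operator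
is bounded below, hence constant since the disc is connected. Comparing with natural numbers \<open>m\<close> is what
covers infinite codimension, where the size of the admissible shift depends on \<open>m\<close>.\<close>

lemma codim_shift_eq:
  assumes T: "bounded_op UNIV T" and M: "complex_vector.subspace M" "closed M"
    and M0: "complex_vector.subspace M0" "closed M0" "M0 \<subseteq> M" "T ` M0 \<subseteq> M"
    and c: "\<And>x. x \<in> M0 \<Longrightarrow> c * norm x \<le> norm (T x)" and \<mu>: "cmod \<mu> < c"
  shows "codim M (shift T \<mu> ` M0) = codim M (T ` M0)"
proof -
  define f where "f a = codim M (shift T a ` M0)" for a
  have iff: "(enat m \<le> f \<mu>) = (enat m \<le> f 0)" for m
  proof (rule connected_local_const[of "ball 0 c" \<mu> 0 "\<lambda>a. enat m \<le> f a"])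
    show "\<mu> \<in> ball 0 c" using \<mu> by simp
    show "0 \<in> ball (0::complex) c" using \<mu> norm_ge_zero[of \<mu>] by (simp del: norm_ge_zero)
    show "\<forall>a\<in>ball 0 c. \<forall>\<^sub>F b in at a within ball 0 c. (enat m \<le> f a) = (enat m \<le> f b)"
    proof
      fix a :: complex assume a: "a \<in> ball 0 c"
      let ?T = "shift T a"
      have T': "bounded_op UNIV ?T" using T by (rule bounded_op_shift)
      have im: "?T ` M0 \<subseteq> M"
        using M0(3,4) complex_vector.subspace_diff[OF M(1)] complex_vector.subspace_scale[OF M(1)]
        unfolding shift_def by blast
      have ca: "c - cmod a > 0" using a by simp
      \<comment> \<open>\<open>\<not> m \<le> f a\<close> means \<open>f a \<le> m - 1\<close>, which is the other semicontinuity.\<close>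
      have "\<exists>\<delta>>0. \<forall>e. cmod e < \<delta> \<longrightarrow> (enat m \<le> f a) = (enat m \<le> f (a + e))"
      proof (cases "enat m \<le> f a")
        case True
        then show ?thesis
          using codim_shift_ge[OF T' M(1) M0(1-3) im ca bounded_below_shift[of M0 c T _ a, OF c], of m]
          by (simp add: f_def shift_shift)
      next
        case False
        then obtain k where k: "m = Suc k" by (cases m) (auto simp: zero_enat_def[symmetric])
        have le: "\<not> enat m \<le> x \<longleftrightarrow> x \<le> enat k" for x :: enat unfolding k by (cases x) auto
        have "f a \<le> enat k" using False le by blast
        then obtain \<delta> where "\<delta> > 0" "\<And>e. cmod e < \<delta> \<Longrightarrow> f (a + e) \<le> enat k"
          using codim_shift_le[OF T' M M0(1-3) im, of k] by (auto simp: f_def shift_shift)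
        then show ?thesis using False le by blast
      qed
      then obtain \<delta> where "\<delta> > 0" "\<And>e. cmod e < \<delta> \<Longrightarrow> (enat m \<le> f a) = (enat m \<le> f (a + e))" by blast
      then show "\<forall>\<^sub>F b in at a within ball 0 c. (enat m \<le> f a) = (enat m \<le> f b)"
        unfolding eventually_at by (intro exI[of _ \<delta>]) (metis add.commute diff_add_cancel dist_norm)
    qed
  qed simp
  have "f \<mu> = f 0"
    by (rule antisym; rule enat_le_if_all_nat_le) (simp_all only: iff)
  then show ?thesis by (simp add: f_def)
qed

lemma index_eqI:
  assumes "edim K + codim M R = edim Z + codim M R0" "edim K < \<infinity>" "edim Z < \<infinity>"
  shows "ereal_of_enat (edim Z) - ereal_of_enat (codim M R) = ereal_of_enat (edim K) - ereal_of_enat (codim M R0)"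
  using assms by (cases "edim K"; cases "edim Z"; cases "codim M R"; cases "codim M R0")
    (auto simp: algebra_simps simp flip: of_nat_add)

text \<open>Off its finite-dimensional kernel an upper semi-Fredholm operator is bounded below.\<close>

lemma upper_semi_fredholm_complement:
  assumes T: "bounded_op UNIV T" and M: "closed_invariant T M" and usf: "upper_semi_fredholm M T"
  obtains M0 where "complex_vector.subspace M0" "closed M0" "M0 \<subseteq> M" "kernel_op M T \<inter> M0 = {0}"
    "M \<subseteq> sum_space (kernel_op M T) M0" "T ` M0 = T ` M" "bounded_below M0 T"
proof -
  note cl = bounded_op_imp_clinear[OF T] and M' = closed_invariantD[OF M]
  let ?K = "kernel_op M T"
  have K: "complex_vector.subspace ?K" "?K \<subseteq> M" "edim ?K < \<infinity>"
    using csubspace_kernel[OF cl M'(1)] usf by (auto simp: kernel_op_def upper_semi_fredholm_def)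
  obtain M0 where M0: "complex_vector.subspace M0" "closed M0" "M0 \<subseteq> M" "?K \<inter> M0 = {0}" "M \<subseteq> sum_space ?K M0"
    using closed_complement_of_finite_dim[OF M'(1,2) K] by blast
  have ker0: "kernel_op M0 T = {0}" using M0(3,4) by (auto simp: kernel_op_def)
  have "T ` M \<subseteq> T ` M0"
  proof
    fix y assume "y \<in> T ` M"
    then obtain z where "z \<in> M" "y = T z" by blast
    moreover obtain k x where "k \<in> ?K" "x \<in> M0" "z = k + x" by (rule sum_spaceE[OF subsetD[OF M0(5) \<open>z \<in> M\<close>]])
    ultimately have "k \<in> ?K" "x \<in> M0" "y = T (k + x)" by simp_all
    then have "y = T x" by (simp add: kernel_op_def clinear_simps[OF cl])
    then show "y \<in> T ` M0" using \<open>x \<in> M0\<close> by blast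
  qed
  then have im: "T ` M0 = T ` M" using M0(3) by blast
  have "bounded_below M0 T"
    using bounded_below_if_kernel[OF T M0(1,2) ker0] usf im by (simp add: upper_semi_fredholm_def)
  then show thesis using that M0 im by blast
qed

text \<open>With a fixed closed complement \<open>M0\<close> of the kernel, the index of the shifted operator is \<open>dim ker T\<close> minus the codimension
of the image of \<open>M0\<close>, which is constant as long as the shifted operator is bounded below on \<open>M0\<close>.\<close>

lemma upper_semi_fredholm_shift_near:
  assumes T: "bounded_op UNIV T" and M: "closed_invariant T M" and usf: "upper_semi_fredholm M T"
  shows "\<exists>\<epsilon>>0. \<forall>\<mu>. cmod \<mu> < \<epsilon> \<longrightarrow>
           upper_semi_fredholm M (shift T \<mu>) \<and> index_op M (shift T \<mu>) = index_op M T"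
proof -
  note cl = bounded_op_imp_clinear[OF T] and M' = closed_invariantD[OF M]
  let ?K = "kernel_op M T"
  have K: "complex_vector.subspace ?K" "?K \<subseteq> M" "edim ?K < \<infinity>"
    using csubspace_kernel[OF cl M'(1)] usf by (auto simp: kernel_op_def upper_semi_fredholm_def)
  obtain M0 where M0: "complex_vector.subspace M0" "closed M0" "M0 \<subseteq> M" "?K \<inter> M0 = {0}" "M \<subseteq> sum_space ?K M0"
    and im: "T ` M0 = T ` M" and "bounded_below M0 T"
    using upper_semi_fredholm_complement[OF T M usf] .
  then obtain c where c: "c > 0" "\<And>x. x \<in> M0 \<Longrightarrow> c * norm x \<le> norm (T x)" by (auto simp: bounded_below_def)
  have TM0: "T ` M0 \<subseteq> M" using im M'(3) by simp
  have "upper_semi_fredholm M (shift T \<mu>) \<and> index_op M (shift T \<mu>) = index_op M T" if \<mu>: "cmod \<mu> < c" for \<mu>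
  proof -
    let ?A = "shift T \<mu>"
    have A: "bounded_op UNIV ?A" using T by (rule bounded_op_shift)
    note clA = bounded_op_imp_clinear[OF A]
    have AM: "?A ` M \<subseteq> M" using closed_invariantD(3)[OF closed_invariant_shift[OF M]] .
    have bb: "bounded_below M0 ?A"
      unfolding bounded_below_def using \<mu> bounded_below_shift[of M0 c T _ \<mu>, OF c(2)]
      by (intro exI[of _ "c - cmod \<mu>"]) auto
    have ker: "kernel_op M0 ?A = {0}"
      using bb complex_vector.subspace_0[OF M0(1)] clinear_simps(3)[OF clA] by (rule bounded_below_kernel)
    have clA0: "closed (?A ` M0)"
      using bounded_op_imp_bounded_linear[OF A] subspace_if_csubspace[OF M0(1)] M0(2) bb by (rule bounded_below_closed)
    have "closed (?A ` M)"
    proof -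
      obtain B where B: "finite B" "complex_vector.span B = ?K" using edim_finite_basis[OF K(3,1)] by metis
      interpret A: Vector_Spaces.linear scaleC scaleC ?A using clA by (simp add: clinear_iff_linear)
      have "?A ` M = sum_space (?A ` M0) (?A ` ?K)"
      proof (intro equalityI subsetI)
        fix y assume "y \<in> ?A ` M"
        then obtain z where "z \<in> M" "y = ?A z" by blast
        moreover obtain k x where "k \<in> ?K" "x \<in> M0" "z = k + x" by (rule sum_spaceE[OF subsetD[OF M0(5) \<open>z \<in> M\<close>]])
        ultimately have "k \<in> ?K" "x \<in> M0" "y = ?A (k + x)" by simp_all
        then have "y = ?A x + ?A k" by (simp add: A.add)
        then show "y \<in> sum_space (?A ` M0) (?A ` ?K)" using \<open>k \<in> ?K\<close> \<open>x \<in> M0\<close> by (simp add: sum_spaceI)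
      next
        fix y assume "y \<in> sum_space (?A ` M0) (?A ` ?K)"
        then obtain k x where kx: "k \<in> ?K" "x \<in> M0" "y = ?A x + ?A k" unfolding mem_sum_space by blast
        then have "y = ?A (x + k)" "x + k \<in> M"
          using M0(3) K(2) complex_vector.subspace_add[OF M'(1)] by (auto simp: A.add)
        then show "y \<in> ?A ` M" by blast
      qed
      also have "?A ` ?K = complex_vector.span (?A ` B)" using B(2) A.span_image by metis
      finally show ?thesis
        using closed_sum_finite_dim[OF csubspace_image[OF clA M0(1)] clA0, of "?A ` B"] B(1) by simp
    qed
    moreover have fin: "edim (kernel_op M ?A) < \<infinity>"
    proof -
      have "edim (kernel_op M ?A) \<le> codim M M0"
      proof (rule edim_le_codim[OF M0(1,3) csubspace_kernel[OF clA M'(1)] _ _ M'(1)])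
        show "M0 \<inter> kernel_op M ?A = {0}" using ker M0(3) by (auto simp: kernel_op_def)
      qed (auto simp: kernel_op_def)
      also have "\<dots> \<le> edim ?K"
        using M0(5) sum_space_commute[of ?K M0] by (intro codim_le_edim M0 K M') simp
      finally show ?thesis using K(3) by (rule le_less_trans)
    qed
    moreover have "index_op M ?A = index_op M T"
    proof -
      have "edim ?K + codim M (?A ` M) = edim (kernel_op M ?A) + codim M (?A ` M0)"
        using edim_kernel_plus_codim[OF clA M'(1) AM K(1,2) M0(1,3,4,5) ker] .
      also have "codim M (?A ` M0) = codim M (T ` M)"
        using codim_shift_eq[OF T M'(1,2) M0(1-3) TM0 c(2) \<mu>] im by simp
      finally show ?thesis unfolding index_op_def using K(3) fin by (rule index_eqI)
    qed
    ultimately show ?thesis by (simp add: upper_semi_fredholm_def)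
  qed
  with c(1) show ?thesis by blast
qed


section \<open>Stability of lower semi-Fredholm operators\<close>

lemma lower_semi_fredholm_complement:
  assumes T: "clinear T" and M: "closed_invariant T M" and lsf: "lower_semi_fredholm M T"
  obtains F where "complex_vector.subspace F" "closed F" "F \<subseteq> M" "edim F < \<infinity>" "T ` M \<inter> F = {0}"
    "M \<subseteq> sum_space (T ` M) F" "edim F = codim M (T ` M)"
proof -
  note M' = closed_invariantD[OF M]
  have R: "complex_vector.subspace (T ` M)" using csubspace_image[OF T M'(1)] .
  obtain F where F: "complement_in M (T ` M) F" using complement_in_exists[OF R M'(1,3)] by blast
  have F': "complex_vector.subspace F" "F \<subseteq> M" "T ` M \<inter> F = {0}" using F by (simp_all add: complement_in_def)
  have e: "edim F = codim M (T ` M)" using codim_eq[OF R M'(3) F] by simp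
  then have "edim F < \<infinity>" using lsf by (simp add: lower_semi_fredholm_def)
  then show thesis using that[OF F'(1) finite_dim_closed[OF F'(1)] F'(2) _ F'(3) complement_in_spans[OF F] e] by blast
qed

text \<open>In a decomposition \<open>y = T x + f\<close> the component \<open>f\<close> depends boundedly on \<open>y\<close> and vanishes on the range, hence on its closure.\<close>

lemma lower_semi_fredholm_closed_range:
  assumes T: "bounded_op UNIV T" and M: "closed_invariant T M" and lsf: "lower_semi_fredholm M T"
  shows "closed (T ` M)"
proof -
  note cl = bounded_op_imp_clinear[OF T] and M' = closed_invariantD[OF M]
  have R: "complex_vector.subspace (T ` M)" using csubspace_image[OF cl M'(1)] .
  obtain F where F: "complex_vector.subspace F" "closed F" "F \<subseteq> M" "T ` M \<inter> F = {0}" "M \<subseteq> sum_space (T ` M) F"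
    using lower_semi_fredholm_complement[OF cl M lsf] by metis
  obtain C \<delta> where C: "C > 0" "\<delta> > 0" "\<forall>\<mu>. cmod \<mu> < \<delta> \<longrightarrow>
      (\<forall>y\<in>M. \<exists>x\<in>M. \<exists>f\<in>F. y = shift T \<mu> x + f \<and> norm x \<le> C * norm y \<and> norm f \<le> C * norm y)"
    using surjective_shift_near[OF T M'(1,2) M'(1,2) subset_refl M'(3) F(1-3,5)] by (elim exE conjE)
  have ex: "\<exists>x\<in>M. \<exists>f\<in>F. y = T x + f \<and> norm f \<le> C * norm y" if "y \<in> M" for y
    using C(3)[rule_format, of 0 y] C(2) that by auto
  show ?thesis
    unfolding closed_sequential_limits
  proof (intro allI impI, elim conjE)
    fix y :: "nat \<Rightarrow> 'a" and l assume y: "\<forall>n. y n \<in> T ` M" and lim: "y \<longlonglongrightarrow> l"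
    have yM: "y n \<in> M" for n using y M'(3) by blast
    have lM: "l \<in> M" by (rule closed_sequentially[OF M'(2) _ lim]) (simp add: yM)
    obtain x f where xf: "x \<in> M" "f \<in> F" "l = T x + f" using ex[OF lM] by blast
    have "norm f \<le> C * norm (y n - l)" for n
    proof -
      have "y n - l \<in> M" using complex_vector.subspace_diff[OF M'(1) yM lM] .
      then obtain x' f' where x': "x' \<in> M" "f' \<in> F" "y n - l = T x' + f'" "norm f' \<le> C * norm (y n - l)"
        using ex by blast
      obtain z where z: "z \<in> M" "y n = T z" using y by blast
      have "f + f' = T (z - x - x')" using x'(3) xf(3) z(2) by (simp add: clinear_simps[OF cl] algebra_simps)
      moreover have "z - x - x' \<in> M" using z x' xf by (intro complex_vector.subspace_diff[OF M'(1)])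
      ultimately have "f + f' \<in> T ` M \<inter> F" using complex_vector.subspace_add[OF F(1) xf(2) x'(2)] by blast
      then have "f = - f'" using F(4) by (simp add: eq_neg_iff_add_eq_0)
      then show ?thesis using x'(4) by simp
    qed
    moreover have "(\<lambda>n. C * norm (y n - l)) \<longlonglongrightarrow> C * 0"
      using lim by (intro tendsto_intros) (simp add: LIM_zero tendsto_norm_zero)
    ultimately have "norm f \<le> C * 0" by (intro LIMSEQ_le_const) auto
    then show "l \<in> T ` M" using xf by simp
  qed
qed

text \<open>Compactness of the unit sphere of a finite-dimensional space is derived from boundedness of coordinates, as a finite sum of
compact discs.\<close>

lemma compact_bounded_coefficients:
  assumes "finite B"
  shows "compact {\<Sum>b\<in>B. c b *\<^sub>C (b :: 'a::complex_banach) |c. \<forall>b\<in>B. cmod (c b) \<le> k}"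
  using assms
proof (induction B)
  case (insert b B)
  have "{\<Sum>b\<in>insert b B. c b *\<^sub>C b |c. \<forall>b\<in>insert b B. cmod (c b) \<le> k}
      = {x + y |x y. x \<in> (\<lambda>a. a *\<^sub>C b) ` cball 0 k \<and> y \<in> {\<Sum>b\<in>B. c b *\<^sub>C b |c. \<forall>b\<in>B. cmod (c b) \<le> k}}"
    (is "?L = ?R")
  proof (intro equalityI subsetI)
    fix z assume "z \<in> ?L"
    then obtain c where c: "z = (\<Sum>b\<in>insert b B. c b *\<^sub>C b)" "\<forall>b\<in>insert b B. cmod (c b) \<le> k" by blast
    have "z = c b *\<^sub>C b + (\<Sum>b\<in>B. c b *\<^sub>C b)" using c(1) insert.hyps by simp
    moreover have "c b \<in> cball 0 k" using c(2) by simp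
    then have "c b *\<^sub>C b \<in> (\<lambda>a. a *\<^sub>C b) ` cball 0 k" by (rule imageI)
    moreover have "(\<Sum>b\<in>B. c b *\<^sub>C b) \<in> {\<Sum>b\<in>B. c b *\<^sub>C b |c. \<forall>b\<in>B. cmod (c b) \<le> k}" using c(2) by blast
    ultimately show "z \<in> ?R" by blast
  next
    fix z assume "z \<in> ?R"
    then obtain a c where c: "z = a *\<^sub>C b + (\<Sum>b\<in>B. c b *\<^sub>C b)" "cmod a \<le> k" "\<forall>b\<in>B. cmod (c b) \<le> k" by auto
    have "(\<Sum>b'\<in>insert b B. (c(b := a)) b' *\<^sub>C b') = a *\<^sub>C b + (\<Sum>b'\<in>B. (c(b := a)) b' *\<^sub>C b')"
      using insert.hyps by simp
    also have "(\<Sum>b'\<in>B. (c(b := a)) b' *\<^sub>C b') = (\<Sum>b'\<in>B. c b' *\<^sub>C b')"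
      using insert.hyps by (intro sum.cong) auto
    finally have "z = (\<Sum>b'\<in>insert b B. (c(b := a)) b' *\<^sub>C b')" using c(1) by simp
    moreover have "\<forall>b'\<in>insert b B. cmod ((c(b := a)) b') \<le> k" using c by simp
    ultimately show "z \<in> ?L" by blast
  qed
  moreover have "compact ((\<lambda>a. a *\<^sub>C b) ` cball 0 k)"
    by (intro compact_continuous_image linear_continuous_on bounded_linear_scaleC_left compact_cball)
  ultimately show ?case using compact_sums[OF _ insert.IH] by simp
qed simp

lemma compact_finite_dim_sphere:
  assumes V: "complex_vector.subspace V" "edim V < \<infinity>"
  shows "compact (V \<inter> sphere 0 1)"
proof -
  obtain B where B: "finite B" "complex_vector.independent B" "complex_vector.span B = V" "edim V = enat (card B)"
    using edim_finite_basis[OF V(2,1)] .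
  obtain \<phi> where \<phi>: "\<And>b. b \<in> B \<Longrightarrow> cfunctional (\<phi> b)"
    "\<And>b w. b \<in> B \<Longrightarrow> w \<in> {0} \<Longrightarrow> \<phi> b w = 0"
    "\<And>b b'. b \<in> B \<Longrightarrow> b' \<in> B \<Longrightarrow> \<phi> b b' = (if b' = b then 1 else 0)"
    "\<And>v. v \<in> V \<Longrightarrow> v = (\<Sum>b\<in>B. \<phi> b v *\<^sub>C b)"
    using dual_basis[of "{0}" B, unfolded B(3)] B(1,2) complex_vector.subspace_0[OF V(1)] by auto
  have "\<exists>k\<ge>0. \<forall>x. cmod (\<phi> b x) \<le> norm x * k" if "b \<in> B" for b
    using bounded_linear.nonneg_bounded[OF cfunctionalD(1)[OF \<phi>(1)[OF that]]] by blast
  then obtain k where k: "\<And>b. b \<in> B \<Longrightarrow> k b \<ge> 0" "\<And>b x. b \<in> B \<Longrightarrow> cmod (\<phi> b x) \<le> norm x * k b" by metis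
  define K where "K = (\<Sum>b\<in>B. k b)"
  have kK: "k b \<le> K" if "b \<in> B" for b
    unfolding K_def using B(1) k(1) that by (intro member_le_sum) auto
  have KS: "{\<Sum>b\<in>B. c b *\<^sub>C b |c. \<forall>b\<in>B. cmod (c b) \<le> K} \<inter> (V \<inter> sphere 0 1) = V \<inter> sphere 0 1"
  proof -
    have "v \<in> {\<Sum>b\<in>B. c b *\<^sub>C b |c. \<forall>b\<in>B. cmod (c b) \<le> K}" if v: "v \<in> V" "norm v = 1" for v
    proof -
      have "cmod (\<phi> b v) \<le> K" if "b \<in> B" for b using k(2)[OF that, of v] kK[OF that] v(2) by simp
      then show ?thesis using \<phi>(4)[OF v(1)] by (intro CollectI exI[of _ "\<lambda>b. \<phi> b v"]) simp
    qed
    then show ?thesis by auto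
  qed
  have "closed {x :: 'a. norm x = 1}" by (intro closed_Collect_eq continuous_intros)
  moreover have "{x :: 'a. norm x = 1} = sphere 0 1" by auto
  ultimately have "closed (V \<inter> sphere 0 1)"
    using finite_dim_closed[OF V] by (simp only: closed_Int)
  from compact_Int_closed[OF compact_bounded_coefficients[OF B(1)] this, of K]
  show ?thesis unfolding KS .
qed

lemma infinite_dim_inter_kernels:
  assumes U: "complex_vector.subspace U" "edim U = \<infinity>" and D: "finite D" "\<And>f. f \<in> D \<Longrightarrow> cfunctional f"
  shows "complex_vector.subspace {u\<in>U. \<forall>f\<in>D. f u = 0} \<and> edim {u\<in>U. \<forall>f\<in>D. f u = 0} = \<infinity>"
  using D
proof (induction D)
  case empty
  then show ?case using U by simp
next
  case (insert f D)
  let ?W = "{u\<in>U. \<forall>f\<in>D. f u = 0}" and ?W' = "{u\<in>U. \<forall>f\<in>insert f D. f u = 0}"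
  have W: "complex_vector.subspace ?W" "edim ?W = \<infinity>" using insert by auto
  have f: "cfunctional f" using insert.prems by simp
  have eq: "?W' = ?W \<inter> {u. f u = 0}" by auto
  have sub: "complex_vector.subspace ?W'"
    unfolding eq using W(1) subspace_kernel_functional[OF f] by (rule complex_vector.subspace_inter)
  have "edim ?W' = \<infinity>"
  proof (rule ccontr)
    assume "edim ?W' \<noteq> \<infinity>"
    then have "edim ?W' < \<infinity>" by simp
    then obtain B where B: "finite B" "complex_vector.independent B" "complex_vector.span B = ?W'" "edim ?W' = enat (card B)"
      using edim_finite_basis[OF _ sub] by blast
    obtain x where x: "\<And>u. u \<in> ?W \<Longrightarrow> \<exists>c. f (u - c *\<^sub>C x) = 0" "x \<in> ?W"
    proof (cases "\<exists>x\<in>?W. f x \<noteq> 0")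
      case True
      then obtain x where x: "x \<in> ?W" "f x \<noteq> 0" by blast
      have "\<exists>c. f (u - c *\<^sub>C x) = 0" for u
        using x(2) by (intro exI[of _ "f u / f x"]) (simp add: cfunctionalD[OF f])
      then show thesis using that x(1) by blast
    next
      case False
      then have "f u = 0" if "u \<in> ?W" for u using that by blast
      then have "\<exists>c. f (u - c *\<^sub>C 0) = 0" if "u \<in> ?W" for u using that by simp
      then show thesis using that complex_vector.subspace_0[OF W(1)] by blast
    qed
    have "?W \<subseteq> complex_vector.span (insert x B)"
    proof
      fix u assume u: "u \<in> ?W"
      obtain c where c: "f (u - c *\<^sub>C x) = 0" using x(1)[OF u] by blast
      have "u - c *\<^sub>C x \<in> ?W"
        by (rule complex_vector.subspace_diff[OF W(1) u complex_vector.subspace_scale[OF W(1) x(2)]])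
      then have "u - c *\<^sub>C x \<in> complex_vector.span B" unfolding B(3) eq using c by simp
      then show "u \<in> complex_vector.span (insert x B)" unfolding complex_vector.span_insert by blast
    qed
    then have "edim ?W \<le> edim (complex_vector.span (insert x B))" by (rule edim_mono)
    also have "\<dots> \<le> enat (card (insert x B))" using B(1) by (intro edim_span_le) simp
    finally show False using W(2) by simp
  qed
  with sub show ?case by blast
qed

text \<open>Functionals that norm a finite net of the unit sphere of \<open>V\<close> have a common zero \<open>u \<in> U\<close>; up to the mesh \<open>1 / 4\<close>
of the net, \<open>u\<close> is then orthogonal to \<open>V\<close>. The bound \<open>3 / 8\<close> does not depend on \<open>V\<close>, which is the point: it is
compared below with perturbations whose kernels are not controlled.\<close>

lemma far_unit_vector:
  assumes U: "complex_vector.subspace U" "edim U = \<infinity>" and V: "complex_vector.subspace V" "edim V < \<infinity>"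
  shows "\<exists>u\<in>U. norm u = 1 \<and> (\<forall>v\<in>V. norm (u - v) \<ge> 3 / 8)"
proof -
  have "V \<inter> sphere 0 1 \<subseteq> (\<Union>d\<in>V \<inter> sphere 0 1. ball d (1/4))" by force
  then obtain D where D: "D \<subseteq> V \<inter> sphere 0 1" "finite D" "V \<inter> sphere 0 1 \<subseteq> (\<Union>d\<in>D. ball d (1/4))"
    using compactE_image[OF compact_finite_dim_sphere[OF V], of "V \<inter> sphere 0 1" "\<lambda>d. ball d (1/4)"] by auto
  obtain f where f: "\<And>d :: 'a. cfunctional (f d)" "\<And>d y. cmod (f d y) \<le> norm y" "\<And>d. f d d = of_real (norm d)"
    using norming_functional by metis
  let ?W = "{u\<in>U. \<forall>g\<in>f ` D. g u = 0}"
  have W: "complex_vector.subspace ?W" "edim ?W = \<infinity>"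
    using infinite_dim_inter_kernels[OF U, of "f ` D"] D(2) f(1) by auto
  have "?W \<noteq> {0}" using W(2) edim_zero by (metis infinity_ne_i0)
  then obtain w where w: "w \<in> ?W" "w \<noteq> 0" using complex_vector.subspace_0[OF W(1)] by blast
  define u where "u = complex_of_real (1 / norm w) *\<^sub>C w"
  have u: "u \<in> ?W" unfolding u_def using w(1) by (rule complex_vector.subspace_scale[OF W(1)])
  have nu: "norm u = 1" using w(2) by (simp add: u_def norm_scaleC norm_divide)
  have "norm (u - v) \<ge> 3 / 8" if v: "v \<in> V" for v
  proof (cases "norm v \<le> 1 / 2")
    case True
    then show ?thesis using norm_triangle_ineq2[of u v] nu by simp
  next
    case False
    then have nv: "norm v > 1 / 2" by simp
    define v' where "v' = complex_of_real (1 / norm v) *\<^sub>C v"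
    have nz: "norm v \<noteq> 0" using nv by linarith
    have "v' \<in> V \<inter> sphere 0 1"
      using complex_vector.subspace_scale[OF V(1) v] nz by (auto simp: v'_def norm_scaleC norm_divide)
    then obtain d where d: "d \<in> D" "dist d v' < 1/4" using D(3) by auto
    have nd: "norm d = 1" using d(1) D(1) by auto
    have "1 - cmod (f d v') \<le> cmod (f d d - f d v')"
      using norm_triangle_ineq2[of "f d d" "f d v'"] by (simp add: f(3) nd)
    also have "\<dots> \<le> norm (d - v')" using f(2)[of d "d - v'"] by (simp add: cfunctionalD[OF f(1)])
    finally have "cmod (f d v') \<ge> 3 / 4" using d(2) by (simp add: dist_norm)
    moreover have "cmod (f d v') = cmod (f d v) / norm v"
      by (simp add: v'_def cfunctionalD[OF f(1)] norm_divide norm_mult)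
    ultimately have "3 / 4 \<le> cmod (f d v) / norm v" by simp
    moreover have "norm v > 0" using nv by linarith
    ultimately have "3 / 4 * norm v \<le> cmod (f d v)" by (simp only: pos_le_divide_eq)
    moreover have "f d (u - v) = - f d v" using u d(1) by (simp add: cfunctionalD[OF f(1)])
    ultimately have "3 / 4 * norm v \<le> norm (u - v)" using f(2)[of d "u - v"] by simp
    then show ?thesis using nv by simp
  qed
  then show ?thesis using u nu by blast
qed

lemma edim_preimage_finite:
  assumes A: "clinear A" and M: "complex_vector.subspace M" and F: "complex_vector.subspace F" "edim F < \<infinity>"
    and ker: "edim (kernel_op M A) < \<infinity>"
  shows "complex_vector.subspace {x\<in>M. A x \<in> F}" "edim {x\<in>M. A x \<in> F} < \<infinity>"
proof -
  let ?V = "{x\<in>M. A x \<in> F}" and ?K = "kernel_op M A"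
  show V: "complex_vector.subspace ?V"
    using M F(1) by (auto simp: complex_vector.subspace_def clinear_simps[OF A])
  have K: "complex_vector.subspace ?K" "?K \<subseteq> ?V"
    using csubspace_kernel[OF A M] complex_vector.subspace_0[OF F(1)] by (auto simp: kernel_op_def)
  obtain L where L: "complement_in ?V ?K L" using complement_in_exists[OF K(1) V K(2)] by blast
  have L': "complex_vector.subspace L" "L \<subseteq> ?V" "?K \<inter> L = {0}" using L by (simp_all add: complement_in_def)
  have "kernel_op L A = {0}" using L'(2,3) by (auto simp: kernel_op_def)
  then have "edim L = edim (A ` L)" using edim_image_inj[OF A L'(1)] inj_on_iff_kernel[OF A L'(1)] by simp
  also have "\<dots> \<le> edim F" using L'(2) by (intro edim_mono) blast
  finally have finL: "edim L < \<infinity>" using F(2) by (rule le_less_trans)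
  have "edim ?V \<le> edim (sum_space ?K L)" using complement_in_spans[OF L] by (rule edim_mono)
  also have "\<dots> = edim ?K + edim L" using K(1) L'(1,3) by (rule edim_direct_sum)
  finally have "edim ?V \<le> edim ?K + edim L" .
  moreover have "edim ?K + edim L < \<infinity>" using ker finL by (auto elim!: less_enatE)
  ultimately show "edim ?V < \<infinity>" by (rule le_less_trans)
qed

text \<open>With finite-dimensional kernel the operator is Fredholm and the previous section applies. With infinite-dimensional
kernel, a shift with finite-dimensional kernel is impossible: a unit vector of \<open>ker T\<close> far from the
finite-dimensional space of vectors mapped into \<open>F\<close> would be within \<open>O(\<mu>)\<close> of that space, by solving
\<open>(T - \<mu>) x + f = (T - \<mu>) u = - \<mu> u\<close>.\<close>

lemma lower_semi_fredholm_shift_near: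
  assumes T: "bounded_op UNIV T" and M: "closed_invariant T M" and lsf: "lower_semi_fredholm M T"
  shows "\<exists>\<epsilon>>0. \<forall>\<mu>. cmod \<mu> < \<epsilon> \<longrightarrow>
           lower_semi_fredholm M (shift T \<mu>) \<and> index_op M (shift T \<mu>) = index_op M T"
proof (cases "edim (kernel_op M T) < \<infinity>")
  case True
  then have "upper_semi_fredholm M T"
    using lower_semi_fredholm_closed_range[OF assms] by (simp add: upper_semi_fredholm_def)
  then obtain \<epsilon> where \<epsilon>: "\<epsilon> > 0" "\<And>\<mu>. cmod \<mu> < \<epsilon> \<Longrightarrow>
      upper_semi_fredholm M (shift T \<mu>) \<and> index_op M (shift T \<mu>) = index_op M T"
    using upper_semi_fredholm_shift_near[OF T M] by blast
  have "lower_semi_fredholm M (shift T \<mu>)" if \<mu>: "cmod \<mu> < \<epsilon>" for \<mu>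
  proof -
    obtain k n where "edim (kernel_op M T) = enat k" "codim M (T ` M) = enat n"
      using True lsf by (auto simp: lower_semi_fredholm_def elim!: less_enatE)
    moreover obtain z where "edim (kernel_op M (shift T \<mu>)) = enat z"
      using \<epsilon>(2)[OF \<mu>] by (auto simp: upper_semi_fredholm_def elim!: less_enatE)
    ultimately show ?thesis using \<epsilon>(2)[OF \<mu>] unfolding index_op_def lower_semi_fredholm_def
      by (cases "codim M (shift T \<mu> ` M)") auto
  qed
  then show ?thesis using \<epsilon> by blast
next
  case False
  note cl = bounded_op_imp_clinear[OF T] and M' = closed_invariantD[OF M]
  let ?K = "kernel_op M T"
  have K: "complex_vector.subspace ?K" "edim ?K = \<infinity>" using csubspace_kernel[OF cl M'(1)] False by auto
  obtain F where F: "complex_vector.subspace F" "closed F" "F \<subseteq> M" "edim F < \<infinity>" "T ` M \<inter> F = {0}"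
    "M \<subseteq> sum_space (T ` M) F" "edim F = codim M (T ` M)"
    using lower_semi_fredholm_complement[OF cl M lsf] .
  obtain C \<delta> where C: "C > 0" "\<delta> > 0" "\<forall>\<mu>. cmod \<mu> < \<delta> \<longrightarrow>
      (\<forall>y\<in>M. \<exists>x\<in>M. \<exists>f\<in>F. y = shift T \<mu> x + f \<and> norm x \<le> C * norm y \<and> norm f \<le> C * norm y)"
    using surjective_shift_near[OF T M'(1,2) M'(1,2) subset_refl M'(3) F(1-3,6)] by (elim exE conjE)
  define \<epsilon> where "\<epsilon> = min \<delta> (1 / (4 * C))"
  have "lower_semi_fredholm M (shift T \<mu>) \<and> index_op M (shift T \<mu>) = index_op M T" if \<mu>: "cmod \<mu> < \<epsilon>" for \<mu>
  proof -
    let ?A = "shift T \<mu>"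
    have clA: "clinear ?A" using bounded_op_imp_clinear[OF bounded_op_shift[OF T]] .
    have ex: "\<exists>x\<in>M. \<exists>f\<in>F. y = ?A x + f \<and> norm x \<le> C * norm y" if "y \<in> M" for y
      using C(3) \<mu> that by (fastforce simp: \<epsilon>_def)
    have AM: "complex_vector.subspace (?A ` M)" "?A ` M \<subseteq> M"
      using csubspace_image[OF clA M'(1)] closed_invariantD(3)[OF closed_invariant_shift[OF M]] by auto
    have "M \<subseteq> sum_space (?A ` M) F"
    proof
      fix y assume "y \<in> M"
      then obtain x f where "x \<in> M" "f \<in> F" "y = ?A x + f" using ex by blast
      then show "y \<in> sum_space (?A ` M) F" by (simp add: sum_spaceI)
    qed
    then have "codim M (?A ` M) \<le> edim F" by (rule codim_le_edim[OF AM F(1) M'(1)])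
    then have lower: "codim M (?A ` M) < \<infinity>" using F(4) by (rule le_less_trans)
    have "edim (kernel_op M ?A) = \<infinity>"
    proof (rule ccontr)
      assume "edim (kernel_op M ?A) \<noteq> \<infinity>"
      then have fin: "edim (kernel_op M ?A) < \<infinity>" by simp
      let ?V = "{x\<in>M. ?A x \<in> F}"
      have V: "complex_vector.subspace ?V" "edim ?V < \<infinity>"
        using edim_preimage_finite[OF clA M'(1) F(1,4) fin] by auto
      obtain u where u: "u \<in> ?K" "norm u = 1" "\<forall>v\<in>?V. norm (u - v) \<ge> 3 / 8"
        using far_unit_vector[OF K V] by blast
      have uM: "u \<in> M" using u(1) by (simp add: kernel_op_def)
      have Au: "?A u = - (\<mu> *\<^sub>C u)" using u(1) by (simp add: kernel_op_def shift_def)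
      have "?A u \<in> M" using AM(2) uM by blast
      then obtain x f where xf: "x \<in> M" "f \<in> F" "?A u = ?A x + f" "norm x \<le> C * norm (?A u)"
        using ex by blast
      have "?A (u - x) = f" using xf(3) by (simp add: clinear_simps[OF clA])
      then have "u - x \<in> ?V" using xf(2) complex_vector.subspace_diff[OF M'(1) uM xf(1)] by simp
      then have "3 / 8 \<le> norm x" using u(3) by force
      also have "\<dots> \<le> C * cmod \<mu>" using xf(4) u(2) by (simp add: Au norm_scaleC)
      also have "\<dots> < 1 / 4" using \<mu> C(1) by (simp add: \<epsilon>_def field_simps)
      finally show False by simp
    qed
    moreover obtain n n' where "codim M (?A ` M) = enat n" "codim M (T ` M) = enat n'"
      using lower lsf by (auto simp: lower_semi_fredholm_def elim!: less_enatE)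
    ultimately show ?thesis using K(2) by (simp add: lower_semi_fredholm_def index_op_def)
  qed
  moreover have "\<epsilon> > 0" using C by (simp add: \<epsilon>_def)
  ultimately show ?thesis by blast
qed

lemma semi_fredholm_shift_near:
  assumes T: "bounded_op UNIV T" and M: "closed_invariant T M" and "semi_fredholm M T"
  shows "\<exists>\<epsilon>>0. \<forall>\<mu>. cmod \<mu> < \<epsilon> \<longrightarrow> index_op M (shift T \<mu>) = index_op M T"
  using assms(3) upper_semi_fredholm_shift_near[OF T M] lower_semi_fredholm_shift_near[OF T M]
  unfolding semi_fredholm_def by blast


section \<open>The Kato decomposition\<close>

text \<open>Enlarging \<open>W\<close> by the kernel keeps it closed and does not change its image, and then the part of it in the complement
\<open>M0\<close>, where \<open>T\<close> is bounded below, has the same image.\<close>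

lemma upper_semi_fredholm_closed_image:
  assumes T: "bounded_op UNIV T" and M: "closed_invariant T M" and usf: "upper_semi_fredholm M T"
    and W: "complex_vector.subspace W" "closed W" "W \<subseteq> M"
  shows "closed (T ` W)"
proof -
  note cl = bounded_op_imp_clinear[OF T] and M' = closed_invariantD[OF M]
  let ?K = "kernel_op M T"
  have K: "complex_vector.subspace ?K" "edim ?K < \<infinity>"
    using csubspace_kernel[OF cl M'(1)] usf by (auto simp: upper_semi_fredholm_def)
  obtain B where B: "finite B" "complex_vector.independent B" "complex_vector.span B = ?K" "edim ?K = enat (card B)"
    using edim_finite_basis[OF K(2,1)] .
  obtain M0 where M0: "complex_vector.subspace M0" "closed M0" "M0 \<subseteq> M" "?K \<inter> M0 = {0}" "M \<subseteq> sum_space ?K M0"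
    "T ` M0 = T ` M" "bounded_below M0 T"
    using upper_semi_fredholm_complement[OF T M usf] .
  let ?W = "sum_space W ?K \<inter> M0"
  have sub: "complex_vector.subspace ?W"
    using subspace_sum_space[OF W(1) K(1)] M0(1) by (rule complex_vector.subspace_inter)
  have clW: "closed ?W"
    using closed_sum_finite_dim[OF W(1,2) B(1)] M0(2) unfolding B(3) by (rule closed_Int)
  have "bounded_below ?W T" using M0(7) unfolding bounded_below_def by blast
  then have "closed (T ` ?W)"
    by (rule bounded_below_closed[OF bounded_op_imp_bounded_linear[OF T] subspace_if_csubspace[OF sub] clW])
  moreover have "T ` W \<subseteq> T ` ?W"
  proof
    fix y assume "y \<in> T ` W"
    then obtain w where w: "w \<in> W" "y = T w" by blast
    have "w \<in> M" using w(1) W(3) by blast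
    obtain k x where kx: "k \<in> ?K" "x \<in> M0" "w = k + x" by (rule sum_spaceE[OF subsetD[OF M0(5) \<open>w \<in> M\<close>]])
    have "w + (- k) \<in> sum_space W ?K" using w(1) complex_vector.subspace_neg[OF K(1) kx(1)] by (rule sum_spaceI)
    then have "x \<in> ?W" using kx by simp
    moreover have "y = T x" using w kx by (simp add: clinear_simps[OF cl] kernel_op_def)
    ultimately show "y \<in> T ` ?W" by blast
  qed
  moreover have "T ` ?W \<subseteq> T ` W"
  proof
    fix y assume "y \<in> T ` ?W"
    then obtain x where x: "x \<in> sum_space W ?K" "y = T x" by blast
    obtain w k where "w \<in> W" "k \<in> ?K" "x = w + k" using x(1) by (rule sum_spaceE)
    then have "y = T w" using x(2) by (simp add: clinear_simps[OF cl] kernel_op_def)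
    then show "y \<in> T ` W" using \<open>w \<in> W\<close> by blast
  qed
  ultimately show ?thesis by (metis subset_antisym)
qed

lemma upper_semi_fredholm_restrict:
  assumes T: "bounded_op UNIV T" and M: "closed_invariant T M" and usf: "upper_semi_fredholm M T"
    and W: "closed_invariant T W" "W \<subseteq> M"
  shows "upper_semi_fredholm W T"
proof -
  have "edim (kernel_op W T) \<le> edim (kernel_op M T)"
    using W(2) by (intro edim_mono) (auto simp: kernel_op_def)
  moreover have "edim (kernel_op M T) < \<infinity>" using usf by (simp add: upper_semi_fredholm_def)
  ultimately have "edim (kernel_op W T) < \<infinity>" by (rule le_less_trans)
  then show ?thesis
    using upper_semi_fredholm_closed_image[OF T M usf closed_invariantD(1,2)[OF W(1)] W(2)]
    by (simp add: upper_semi_fredholm_def)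
qed

lemma funpow_image_Suc: "(T ^^ Suc n) ` M = T ` ((T ^^ n) ` M)"
  by (simp add: image_image)

lemma funpow_image_subset: "T ` M \<subseteq> M \<Longrightarrow> (T ^^ n) ` M \<subseteq> M"
  by (induction n) auto

lemma clinear_funpow: "clinear T \<Longrightarrow> clinear (T ^^ n)"
  by (induction n) (auto simp: clinear_def)

lemma closed_invariant_range_power:
  assumes T: "bounded_op UNIV T" and M: "closed_invariant T M" and usf: "upper_semi_fredholm M T"
  shows "complex_vector.subspace ((T ^^ n) ` M)" "closed ((T ^^ n) ` M)" "(T ^^ n) ` M \<subseteq> M"
proof -
  note M' = closed_invariantD[OF M]
  show sub: "complex_vector.subspace ((T ^^ n) ` M)" for n
    using clinear_funpow[OF bounded_op_imp_clinear[OF T]] M'(1) by (rule csubspace_image)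
  show subM: "(T ^^ n) ` M \<subseteq> M" for n using M'(3) by (rule funpow_image_subset)
  show "closed ((T ^^ n) ` M)"
  proof (induction n)
    case (Suc n)
    show ?case unfolding funpow_image_Suc
      using T M usf sub Suc subM by (rule upper_semi_fredholm_closed_image)
  qed (simp add: M'(2))
qed

text \<open>If \<open>x = T^m e\<close> were a combination of \<open>R\<close> and the lower members of the chain \<open>e, T e, \<dots>\<close>, applying \<open>T^(m - i)\<close> with \<open>i\<close>
the least exponent that occurs would leave a nonzero multiple of \<open>x\<close> plus a vector of \<open>R\<close> equal to \<open>0\<close>, and put \<open>x\<close> into \<open>R\<close>.\<close>

lemma kernel_avoids_chain:
  assumes T: "clinear T" and R: "complex_vector.subspace R" "\<And>k y. y \<in> R \<Longrightarrow> (T ^^ k) y \<in> R"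
    and x: "x \<notin> R" "(T ^^ m) e = x" "T x = 0"
  shows "x \<notin> sum_space R (complex_vector.span ((\<lambda>j. (T ^^ j) e) ` {..<m}))"
proof
  define S where "S i = complex_vector.span ((\<lambda>j. (T ^^ j) e) ` {i..<m})" for i
  have Tx: "(T ^^ k) x = 0" if "k > 0" for k
  proof -
    obtain l where "k = Suc l" using \<open>k > 0\<close> by (cases k) auto
    then show ?thesis using x(3) clinear_simps(3)[OF clinear_funpow[OF T]] by (simp add: funpow_swap1)
  qed
  \<comment> \<open>\<open>S i\<close> is spanned by the chain from the exponent \<open>i\<close> on; the lowest exponent is removed at each step.\<close>
  have step: "x \<in> sum_space R (S (Suc i))" if i: "x \<in> sum_space R (S i)" "i < m" for i
  proof -
    have "{i..<m} = insert i {Suc i..<m}" using i(2) by auto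
    then have S: "S i = complex_vector.span (insert ((T ^^ i) e) ((\<lambda>j. (T ^^ j) e) ` {Suc i..<m}))"
      by (simp add: S_def)
    obtain y v where yv: "y \<in> R" "v \<in> S i" "x = y + v" using i(1) by (rule sum_spaceE)
    obtain c where c: "v - c *\<^sub>C (T ^^ i) e \<in> S (Suc i)"
      using yv(2)[unfolded S complex_vector.span_insert] unfolding S_def by blast
    let ?D = "T ^^ (m - i)"
    note D = clinear_simps[OF clinear_funpow[OF T, of "m - i"]]
    have DS: "?D w = 0" if w: "w \<in> S (Suc i)" for w
    proof -
      interpret D: Vector_Spaces.linear scaleC scaleC ?D
        using clinear_funpow[OF T] by (simp add: clinear_iff_linear)
      show ?thesis
      proof (rule D.eq_0_on_span[OF _ w[unfolded S_def]])
        fix z assume "z \<in> (\<lambda>j. (T ^^ j) e) ` {Suc i..<m}"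
        then obtain j where j: "Suc i \<le> j" "j < m" "z = (T ^^ j) e" by auto
        have "?D z = (T ^^ (m - i + j)) e" by (simp add: j(3) funpow_add)
        also have "m - i + j = (j - i) + m" using j by simp
        also have "(T ^^ ((j - i) + m)) e = (T ^^ (j - i)) x" using x(2) by (simp add: funpow_add)
        also have "\<dots> = 0" using j by (intro Tx) simp
        finally show "?D z = 0" .
      qed
    qed
    have "?D ((T ^^ i) e) = (T ^^ (m - i + i)) e" by (simp add: funpow_add)
    then have Di: "?D ((T ^^ i) e) = x" using i(2) x(2) by simp
    have "?D x = 0" using i(2) by (intro Tx) simp
    moreover have "?D x = ?D y + (c *\<^sub>C ?D ((T ^^ i) e) + ?D (v - c *\<^sub>C (T ^^ i) e))"
      unfolding yv(3) by (simp add: D)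
    ultimately have "?D y + c *\<^sub>C x = 0" using DS[OF c] Di by simp
    then have cx: "c *\<^sub>C x = - ?D y" by (simp add: eq_neg_iff_add_eq_0 add.commute)
    have "c = 0"
    proof (rule ccontr)
      assume "c \<noteq> 0"
      then have "x = (1 / c) *\<^sub>C (c *\<^sub>C x)" by (simp add: scaleC_one)
      then have "x \<in> R" unfolding cx
        using complex_vector.subspace_scale[OF R(1) complex_vector.subspace_neg[OF R(1) R(2)[OF yv(1)]]] by metis
      then show False using x(1) by blast
    qed
    then show ?thesis using yv c by (auto intro: sum_spaceI)
  qed
  assume "x \<in> sum_space R (complex_vector.span ((\<lambda>j. (T ^^ j) e) ` {..<m}))"
  then have "x \<in> sum_space R (S 0)" by (simp add: S_def atLeast0LessThan)
  then have "i \<le> m \<Longrightarrow> x \<in> sum_space R (S i)" for i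
    by (induction i) (auto intro: step)
  from this[of m] have "x \<in> sum_space R {0}" by (simp add: S_def)
  then show False using x(1) by (auto elim!: sum_spaceE)
qed

text \<open>Take \<open>n\<close> minimal such that the kernel is not contained in the range of \<open>T^n\<close>, and a chain \<open>e, T e, \<dots>, T^m e = x\<close>
with \<open>n = m + 1\<close>, ending in a kernel vector \<open>x\<close> outside that range. A functional that is \<open>1\<close> at the end of the chain and \<open>0\<close>
on the rest of it and on the range of \<open>T^n\<close> defines, through \<open>f (T^(m - j) y)\<close> as the coefficient of \<open>T^j e\<close>,
a bounded projection onto the chain that commutes with \<open>T\<close>. Splitting off the chain removes \<open>x\<close> from the kernel.\<close>

lemma chain_splitting:
  assumes T: "bounded_op UNIV T" and M: "closed_invariant T M" and usf: "upper_semi_fredholm M T"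
    and n: "\<not> kernel_op M T \<subseteq> (T ^^ n) ` M"
  shows "\<exists>A B n. splits T M A B \<and> (\<forall>x\<in>B. (T ^^ n) x = 0) \<and> edim (kernel_op A T) < edim (kernel_op M T)"
proof -
  note cl = bounded_op_imp_clinear[OF T] and M' = closed_invariantD[OF M]
  define n where "n = (LEAST n. \<not> kernel_op M T \<subseteq> (T ^^ n) ` M)"
  have n1: "\<not> kernel_op M T \<subseteq> (T ^^ n) ` M" unfolding n_def by (rule LeastI, fact n)
  have "n \<noteq> 0" using n1 by (auto simp: kernel_op_def intro!: Nat.gr0I)
  then obtain m where m: "n = Suc m" using not0_implies_Suc by blast
  have n2: "kernel_op M T \<subseteq> (T ^^ m) ` M" using not_less_Least[of m "\<lambda>n. \<not> kernel_op M T \<subseteq> (T ^^ n) ` M"] m unfolding n_def by auto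
  obtain x where x: "x \<in> kernel_op M T" "x \<notin> (T ^^ n) ` M" using n1 by blast
  then obtain e where e: "e \<in> M" "x = (T ^^ m) e" using n2 by blast
  have xM: "x \<in> M" "T x = 0" using x(1) by (auto simp: kernel_op_def)
  let ?R = "(T ^^ n) ` M"
  note R = closed_invariant_range_power[OF T M usf, of n]
  have TR: "(T ^^ k) y \<in> ?R" if y: "y \<in> ?R" for k y
  proof -
    obtain z where z: "z \<in> M" "y = (T ^^ n) z" using y by blast
    have "(T ^^ k) y = (T ^^ n) ((T ^^ k) z)" unfolding z(2) by (metis add.commute comp_apply funpow_add)
    then show ?thesis using z(1) funpow_image_subset[OF M'(3)] by blast
  qed
  let ?S = "complex_vector.span ((\<lambda>j. (T ^^ j) e) ` {..<m})"
  have "x \<notin> sum_space ?R ?S"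
    using kernel_avoids_chain[OF cl R(1) TR x(2) e(2)[symmetric] xM(2)] .
  then obtain f where f: "cfunctional f" "\<forall>w\<in>sum_space ?R ?S. f w = 0" "f x = 1"
    using separating_functional[OF subspace_sum_space[OF R(1) complex_vector.subspace_span]
        closed_sum_finite_dim[OF R(1,2)]] by (meson finite_imageI finite_lessThan)
  have fR: "f ((T ^^ n) y) = 0" if "y \<in> M" for y
    using f(2) sum_space_superset(1)[OF R(1) complex_vector.subspace_span] that by blast
  have Te0: "(T ^^ k) e = 0" if "k \<ge> n" for k
  proof -
    have "(T ^^ Suc m) e = 0" using e(2) xM(2) by simp
    moreover have "k = (k - n) + Suc m" using that m by simp
    ultimately show ?thesis using clinear_simps(3)[OF clinear_funpow[OF cl, of "k - n"]]
      by (metis comp_apply funpow_add)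
  qed
  \<comment> \<open>On the chain, and beyond it where the chain is \<open>0\<close>, the functional sees only the last vector.\<close>
  have fe: "f ((T ^^ k) e) = (if k = m then 1 else 0)" for k
  proof -
    consider "k < m" | "k = m" | "k \<ge> n" using m by linarith
    then show ?thesis
    proof cases
      case 1
      then have "(T ^^ k) e \<in> ?S" by (intro complex_vector.span_base) auto
      then show ?thesis using 1 f(2) sum_space_superset(2)[OF R(1) complex_vector.subspace_span] by auto
    next
      case 2
      then show ?thesis using f(3) e(2) by simp
    next
      case 3
      then show ?thesis using Te0[OF 3] m by (simp add: cfunctionalD[OF f(1)])
    qed
  qed
  define P where "P y = (\<Sum>j<n. f ((T ^^ (m - j)) y) *\<^sub>C (T ^^ j) e)" for y
  have blT: "bounded_linear (T ^^ k)" for k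
  proof (induction k)
    case 0
    then show ?case by (simp add: id_def)
  next
    case (Suc k)
    then show ?case using bounded_linear_compose[OF bounded_op_imp_bounded_linear[OF T], of "T ^^ k"]
      by (simp add: comp_def)
  qed
  have blP: "bounded_linear P"
    unfolding P_def
    by (intro bounded_linear_sum bounded_linear_compose[OF bounded_linear_scaleC_left]
        bounded_linear_compose[OF cfunctionalD(1)[OF f(1)]] blT)
  note Tk = clinear_simps[OF clinear_funpow[OF cl]]
  have linP: "P (y + z) = P y + P z" "P (y - z) = P y - P z" "P (c *\<^sub>C y) = c *\<^sub>C P y" "P 0 = 0" for y z c
    by (simp_all add: P_def Tk cfunctionalD[OF f(1)] scaleC_add_left complex_vector.scale_left_diff_distrib
        sum.distrib sum_subtractf complex_vector.scale_sum_right)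
  have PM: "P y \<in> M" for y
    unfolding P_def using e(1) funpow_image_subset[OF M'(3)]
    by (intro complex_vector.subspace_sum[OF M'(1)] complex_vector.subspace_scale[OF M'(1)]) blast
  \<comment> \<open>Applying \<open>T\<close> shifts the coefficients by one; the two boundary terms vanish as \<open>f\<close> kills the range of \<open>T^n\<close> and \<open>T^n e = 0\<close>.\<close>
  have PT: "P (T y) = T (P y)" if y: "y \<in> M" for y
  proof -
    have "P (T y) = (\<Sum>j<Suc m. f ((T ^^ (m - j)) (T y)) *\<^sub>C (T ^^ j) e)" by (simp add: P_def m)
    also have "\<dots> = f ((T ^^ m) (T y)) *\<^sub>C e + (\<Sum>j<m. f ((T ^^ (m - Suc j)) (T y)) *\<^sub>C (T ^^ Suc j) e)"
      by (subst sum.lessThan_Suc_shift) simp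
    also have "f ((T ^^ m) (T y)) = 0" using fR[OF y] by (simp add: m funpow_swap1)
    also have "(\<Sum>j<m. f ((T ^^ (m - Suc j)) (T y)) *\<^sub>C (T ^^ Suc j) e)
             = (\<Sum>j<m. f ((T ^^ (m - j)) y) *\<^sub>C (T ^^ Suc j) e)"
    proof (intro sum.cong refl)
      fix j assume "j \<in> {..<m}"
      then have "m - j = Suc (m - Suc j)" by auto
      then show "f ((T ^^ (m - Suc j)) (T y)) *\<^sub>C (T ^^ Suc j) e = f ((T ^^ (m - j)) y) *\<^sub>C (T ^^ Suc j) e"
        by (simp add: funpow_swap1)
    qed
    also have "\<dots> = (\<Sum>j<Suc m. f ((T ^^ (m - j)) y) *\<^sub>C (T ^^ Suc j) e)"
      using Te0[of "Suc m"] m by simp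
    also have "\<dots> = T (P y)"
    proof -
      interpret T: Vector_Spaces.linear scaleC scaleC T using cl by (simp add: clinear_iff_linear)
      show ?thesis unfolding P_def m T.sum T.scale by simp
    qed
    finally show ?thesis by simp
  qed
  have Pe: "P ((T ^^ i) e) = (T ^^ i) e" if i: "i < n" for i
  proof -
    have "P ((T ^^ i) e) = (\<Sum>j<n. if j = i then (T ^^ i) e else 0)"
      unfolding P_def
    proof (intro sum.cong refl)
      fix j assume "j \<in> {..<n}"
      then have j: "j \<le> m" using m by simp
      have "(T ^^ (m - j)) ((T ^^ i) e) = (T ^^ (m - j + i)) e" by (simp add: funpow_add)
      moreover have "m - j + i = m \<longleftrightarrow> j = i" using j by auto
      ultimately show "f ((T ^^ (m - j)) ((T ^^ i) e)) *\<^sub>C (T ^^ j) e = (if j = i then (T ^^ i) e else 0)"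
        by (simp add: fe scaleC_one)
    qed
    also have "\<dots> = (T ^^ i) e" using i by simp
    finally show ?thesis .
  qed
  have PP: "P (P y) = P y" for y
  proof -
    interpret P: bounded_linear P by (fact blP)
    have "P (P y) = (\<Sum>j<n. f ((T ^^ (m - j)) y) *\<^sub>C P ((T ^^ j) e))"
      by (subst (2) P_def) (simp add: P.sum linP)
    also have "\<dots> = P y" unfolding P_def using Pe by (intro sum.cong) (auto simp: P_def)
    finally show ?thesis .
  qed
  have nil: "(T ^^ n) (P y) = 0" for y
  proof -
    interpret Tn: Vector_Spaces.linear scaleC scaleC "T ^^ n"
      using clinear_funpow[OF cl] by (simp add: clinear_iff_linear)
    have "(T ^^ n) ((T ^^ j) e) = 0" for j using Te0[of "n + j"] by (simp add: funpow_add)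
    then show ?thesis unfolding P_def by (simp add: Tn.sum Tn.scale)
  qed
  define A where "A = {y\<in>M. P y = 0}"
  define B where "B = {y\<in>M. P y = y}"
  have contP: "continuous_on UNIV P" using blP by (rule linear_continuous_on)
  have "A = M \<inter> {y. P y = 0}" "B = M \<inter> {y. P y = y}" by (auto simp: A_def B_def)
  moreover have "closed {y. P y = 0}" "closed {y. P y = y}"
    using contP by (auto intro!: closed_Collect_eq continuous_intros)
  ultimately have "closed A" "closed B" using M'(2) by auto
  moreover have "complex_vector.subspace A" "complex_vector.subspace B"
    using M'(1) by (auto simp: A_def B_def complex_vector.subspace_def linP)
  moreover have "T ` A \<subseteq> A" "T ` B \<subseteq> B"
    using M'(3) PT by (auto simp: A_def B_def clinear_simps[OF cl])
  ultimately have inv: "closed_invariant T A" "closed_invariant T B" by (auto simp: closed_invariant_def)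
  have AB: "A \<inter> B = {0}"
    using complex_vector.subspace_0[OF M'(1)] by (auto simp: A_def B_def linP)
  have "M \<subseteq> sum_space A B"
  proof
    fix y assume y: "y \<in> M"
    have "y - P y \<in> A" using complex_vector.subspace_diff[OF M'(1) y PM] by (simp add: A_def linP PP)
    moreover have "P y \<in> B" using PM by (simp add: B_def PP)
    ultimately have "(y - P y) + P y \<in> sum_space A B" by (rule sum_spaceI)
    then show "y \<in> sum_space A B" by simp
  qed
  moreover have "sum_space A B \<subseteq> M" by (rule sum_space_subset[OF M'(1)]) (auto simp: A_def B_def)
  ultimately have "splits T M A B" using inv AB by (auto simp: splits_def)
  moreover have "\<forall>x\<in>B. (T ^^ n) x = 0"
  proof
    fix y assume "y \<in> B"
    then show "(T ^^ n) y = 0" using nil[of y] by (simp add: B_def)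
  qed
  moreover have "edim (kernel_op A T) < edim (kernel_op M T)"
  proof -
    have Px: "P x = x" using Pe[of m] e(2) m by simp
    have x0: "x \<noteq> 0" using f(3) by (auto simp: cfunctionalD[OF f(1)])
    have KA: "complex_vector.subspace (kernel_op A T)" "kernel_op A T \<subseteq> kernel_op M T"
      using csubspace_kernel[OF cl closed_invariantD(1)[OF inv(1)]] by (auto simp: kernel_op_def A_def)
    have KM: "complex_vector.subspace (kernel_op M T)" using csubspace_kernel[OF cl M'(1)] .
    have sp: "complex_vector.span {x} \<subseteq> kernel_op M T"
      using x(1) KM by (intro complex_vector.span_minimal) auto
    have "z = 0" if z: "z \<in> kernel_op A T" "z \<in> complex_vector.span {x}" for z
    proof -
      obtain c where "z = c *\<^sub>C x" using z(2) by (auto simp: complex_vector.span_singleton)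
      moreover have "P z = 0" using z(1) by (simp add: kernel_op_def A_def)
      ultimately show ?thesis using Px by (simp add: linP)
    qed
    then have "kernel_op A T \<inter> complex_vector.span {x} = {0}"
      using complex_vector.subspace_0[OF KA(1)] complex_vector.span_zero[of "{x}"] by blast
    then have "edim (kernel_op A T) + edim (complex_vector.span {x}) = edim (sum_space (kernel_op A T) (complex_vector.span {x}))"
      using edim_direct_sum[OF KA(1) complex_vector.subspace_span] by simp
    also have "\<dots> \<le> edim (kernel_op M T)"
      using sum_space_subset[OF KM KA(2) sp] by (rule edim_mono)
    finally have "edim (kernel_op A T) + edim (complex_vector.span {x}) \<le> edim (kernel_op M T)" .
    moreover have "edim (complex_vector.span {x}) = 1"
      using edim_span[of "{x}"] x0 by (simp add: one_enat_def)
    moreover have "edim (kernel_op M T) < \<infinity>" using usf by (simp add: upper_semi_fredholm_def)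
    ultimately show ?thesis by (cases "edim (kernel_op A T)"; cases "edim (kernel_op M T)") (auto simp: one_enat_def)
  qed
  ultimately show ?thesis by blast
qed

text \<open>The sum of the two removed summands is closed because the projections of the outer splitting are bounded.\<close>

lemma splits_assoc:
  assumes s1: "splits T M A1 B1" and s2: "splits T A1 A B2" and T: "clinear T" and M: "closed M"
  shows "splits T M A (sum_space B2 B1)"
proof -
  have 1: "complex_vector.subspace A1" "closed A1" "T ` A1 \<subseteq> A1" "complex_vector.subspace B1" "closed B1" "T ` B1 \<subseteq> B1"
    "A1 \<inter> B1 = {0}" "M = sum_space A1 B1" using s1 by (simp_all add: splits_def closed_invariant_def)
  have 2: "closed_invariant T A" "complex_vector.subspace A" "complex_vector.subspace B2" "closed B2" "T ` B2 \<subseteq> B2"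
    "A \<inter> B2 = {0}" "A1 = sum_space A B2" using s2 by (simp_all add: splits_def closed_invariant_def)
  have sup: "A \<subseteq> A1" "B2 \<subseteq> A1" using splits_superset[OF s2] by auto
  have "closed (sum_space B2 B1)"
    by (rule closed_sum_of_summands[OF 1(1,2,4,5,7) _ 2(3,4) sup(2)]) (use M 1(8) in simp)
  moreover have "complex_vector.subspace (sum_space B2 B1)" using 2(3) 1(4) by (rule subspace_sum_space)
  moreover have "T ` sum_space B2 B1 \<subseteq> sum_space B2 B1"
  proof
    fix y assume "y \<in> T ` sum_space B2 B1"
    then obtain b2 b1 where b: "b2 \<in> B2" "b1 \<in> B1" "y = T b2 + T b1"
      by (auto elim!: sum_spaceE simp: clinear_simps[OF T])
    then show "y \<in> sum_space B2 B1" using 1(6) 2(5) sum_spaceI[of "T b2" B2 "T b1" B1] by blast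
  qed
  moreover have "A \<inter> sum_space B2 B1 = {0}"
  proof -
    have "x = 0" if x: "x \<in> A" "x \<in> sum_space B2 B1" for x
    proof -
      obtain b2 b1 where b: "b2 \<in> B2" "b1 \<in> B1" "x = b2 + b1" using x(2) by (rule sum_spaceE)
      have xA1: "x \<in> A1" and b2A1: "b2 \<in> A1" using x(1) b(1) sup by auto
      have "x = b2" by (rule splits_eqD(1)[OF s1 xA1 complex_vector.subspace_0[OF 1(4)] b2A1 b(2)]) (simp add: b(3))
      then show ?thesis using x(1) b(1) 2(6) by blast
    qed
    then show ?thesis using complex_vector.subspace_0[OF 2(2)]
        complex_vector.subspace_0[OF subspace_sum_space[OF 2(3) 1(4)]] by blast
  qed
  moreover have "M = sum_space A (sum_space B2 B1)"
  proof (intro equalityI subsetI)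
    fix x assume "x \<in> M"
    then obtain a1 b1 where ab: "a1 \<in> A1" "b1 \<in> B1" "x = a1 + b1" unfolding 1(8) by (rule sum_spaceE)
    obtain a b2 where ab2: "a \<in> A" "b2 \<in> B2" "a1 = a + b2" using ab(1) unfolding 2(7) by (rule sum_spaceE)
    have "a + (b2 + b1) \<in> sum_space A (sum_space B2 B1)" using ab ab2 by (intro sum_spaceI)
    then show "x \<in> sum_space A (sum_space B2 B1)" using ab ab2 by (simp add: add.assoc)
  next
    fix x assume "x \<in> sum_space A (sum_space B2 B1)"
    then obtain a z where az: "a \<in> A" "z \<in> sum_space B2 B1" "x = a + z" by (rule sum_spaceE)
    obtain b2 b1 where b: "b2 \<in> B2" "b1 \<in> B1" "z = b2 + b1" using az(2) by (rule sum_spaceE)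
    have "a + b2 \<in> A1" using az(1) b(1) unfolding 2(7) by (rule sum_spaceI)
    then have "(a + b2) + b1 \<in> M" using b(2) unfolding 1(8) by (rule sum_spaceI)
    then show "x \<in> M" using az b by (simp add: add.assoc)
  qed
  ultimately show ?thesis using 2(1) by (simp add: splits_def closed_invariant_def)
qed

text \<open>Chains are split off until the kernel, whose dimension drops each time, lies in the range of every power.\<close>

lemma kato_decomposition:
  assumes T: "bounded_op UNIV T" and M: "closed_invariant T M" and usf: "upper_semi_fredholm M T"
  shows "\<exists>A B n. splits T M A B \<and> (\<forall>x\<in>B. (T ^^ n) x = 0) \<and> (\<forall>k. kernel_op A T \<subseteq> (T ^^ k) ` A)"
proof -
  note cl = bounded_op_imp_clinear[OF T]
  have "\<exists>A B n. splits T M A B \<and> (\<forall>x\<in>B. (T ^^ n) x = 0) \<and> (\<forall>k. kernel_op A T \<subseteq> (T ^^ k) ` A)"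
    if "closed_invariant T M" "upper_semi_fredholm M T" "edim (kernel_op M T) = enat d" for d M
    using that
  proof (induction d arbitrary: M rule: less_induct)
    case (less d)
    note M = less.prems(1) and usf = less.prems(2) and d = less.prems(3)
    show ?case
    proof (cases "\<forall>k. kernel_op M T \<subseteq> (T ^^ k) ` M")
      case True
      then show ?thesis using splits_trivial[OF M cl]
        by (intro exI[of _ M] exI[of _ "{0}"] exI[of _ 0]) simp
    next
      case False
      then obtain k where "\<not> kernel_op M T \<subseteq> (T ^^ k) ` M" by blast
      from chain_splitting[OF T M usf this]
      obtain A1 B1 n1 where s1: "splits T M A1 B1" and nil1: "\<forall>x\<in>B1. (T ^^ n1) x = 0"
        and lt: "edim (kernel_op A1 T) < edim (kernel_op M T)" by blast
      have A1: "closed_invariant T A1" using s1 by (simp add: splits_def)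
      obtain d1 where d1: "edim (kernel_op A1 T) = enat d1" "d1 < d" using lt d by (auto elim!: less_enatE)
      have "upper_semi_fredholm A1 T"
        using T M usf A1 splits_superset(1)[OF s1] by (rule upper_semi_fredholm_restrict)
      from less.IH[OF d1(2) A1 this d1(1)]
      obtain A B2 n2 where s2: "splits T A1 A B2" and nil2: "\<forall>x\<in>B2. (T ^^ n2) x = 0"
        and kato: "\<forall>k. kernel_op A T \<subseteq> (T ^^ k) ` A" by blast
      have "(T ^^ (n1 + n2)) x = 0" if x: "x \<in> sum_space B2 B1" for x
      proof -
        obtain b2 b1 where b: "b2 \<in> B2" "b1 \<in> B1" "x = b2 + b1" using x by (rule sum_spaceE)
        have "(T ^^ (n1 + n2)) b2 = 0" using nil2 b(1) clinear_simps(3)[OF clinear_funpow[OF cl]]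
          by (simp add: funpow_add)
        moreover have "(T ^^ (n2 + n1)) b1 = 0" using nil1 b(2) clinear_simps(3)[OF clinear_funpow[OF cl]]
          by (simp add: funpow_add)
        ultimately show ?thesis using b(3) clinear_simps(1)[OF clinear_funpow[OF cl]] by (simp add: add.commute)
      qed
      then show ?thesis
        using splits_assoc[OF s1 s2 cl closed_invariantD(2)[OF M]] kato
        by (intro exI[of _ A] exI[of _ "sum_space B2 B1"] exI[of _ "n1 + n2"]) blast
    qed
  qed
  moreover obtain d where "edim (kernel_op M T) = enat d"
    using usf by (auto simp: upper_semi_fredholm_def elim!: less_enatE)
  ultimately show ?thesis using M usf by blast
qed


section \<open>Browder operators and nearby invertibility\<close>

text \<open>The common range \<open>R\<close> of all powers satisfies \<open>T R = R\<close> and contains the kernel, so a kernel vector \<open>x0\<close> starts a backward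
orbit \<open>T s(n+1) = s n\<close> in \<open>R\<close> of at most geometric growth, and \<open>\<Sum>n. \<mu>^n s n\<close> is a vector of \<open>ker (T - \<mu>)\<close> near \<open>x0\<close>.\<close>

lemma kernel_persists_in_hyperrange:
  assumes T: "bounded_op UNIV T" and A: "closed_invariant T A" and usf: "upper_semi_fredholm A T"
    and kato: "\<And>k. kernel_op A T \<subseteq> (T ^^ k) ` A" and ker: "kernel_op A T \<noteq> {0}"
  shows "\<exists>\<epsilon>>0. \<forall>\<mu>. cmod \<mu> < \<epsilon> \<longrightarrow> kernel_op A (shift T \<mu>) \<noteq> {0}"
proof -
  note cl = bounded_op_imp_clinear[OF T] and A' = closed_invariantD[OF A]
  interpret T: bounded_linear T using T by (rule bounded_op_imp_bounded_linear)
  define R where "R = (\<Inter>k. (T ^^ k) ` A)"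
  note pow = closed_invariant_range_power[OF T A usf]
  have R: "complex_vector.subspace R" "closed R"
    unfolding R_def using pow by (auto intro!: complex_vector.subspace_Inter)
  have RA: "R \<subseteq> A"
    using pow(3)[of 0] unfolding R_def by blast
  have "T ` R = R"
  proof (intro equalityI subsetI)
    fix y assume "y \<in> T ` R"
    then obtain x where x: "x \<in> R" "y = T x" by blast
    have "y \<in> (T ^^ k) ` A" for k
    proof (cases k)
      case 0
      then show ?thesis using x RA A'(3) by auto
    next
      case (Suc j)
      have "x \<in> (T ^^ j) ` A" using x(1) unfolding R_def by blast
      then show ?thesis unfolding Suc funpow_image_Suc x(2) by (rule imageI)
    qed
    then show "y \<in> R" by (simp add: R_def)
  next
    fix y assume y: "y \<in> R"
    then have "y \<in> (T ^^ Suc 0) ` A" unfolding R_def by blast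
    then obtain x where x: "x \<in> A" "y = T x" by auto
    have "x \<in> (T ^^ k) ` A" for k
    proof -
      have "y \<in> (T ^^ Suc k) ` A" using y unfolding R_def by blast
      then obtain z where z: "z \<in> A" "y = T ((T ^^ k) z)" by auto
      have zk: "(T ^^ k) z \<in> (T ^^ k) ` A" using z(1) by blast
      then have "x - (T ^^ k) z \<in> kernel_op A T"
        using x z(2) pow(3)[of k] complex_vector.subspace_diff[OF A'(1), of x "(T ^^ k) z"]
        by (auto simp: kernel_op_def clinear_simps[OF cl])
      then have "(x - (T ^^ k) z) + (T ^^ k) z \<in> (T ^^ k) ` A"
        using kato[of k] zk by (intro complex_vector.subspace_add[OF pow(1)]) auto
      then show ?thesis by simp
    qed
    then show "y \<in> T ` R" using x(2) by (auto simp: R_def)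
  qed
  then obtain C where C: "C > 0" "\<And>y. y \<in> R \<Longrightarrow> \<exists>x\<in>R. T x = y \<and> norm x \<le> C * norm y"
    using open_mapping[OF T.bounded_linear_axioms subspace_if_csubspace[OF R(1)] R(2)] R(2) by auto
  then obtain g where g: "\<And>y. y \<in> R \<Longrightarrow> g y \<in> R \<and> T (g y) = y \<and> norm (g y) \<le> C * norm y" by metis
  obtain x0 where x0: "x0 \<in> kernel_op A T" "x0 \<noteq> 0"
    using ker complex_vector.subspace_0[OF csubspace_kernel[OF cl A'(1)]] by blast
  have x0R: "x0 \<in> R" using kato x0(1) unfolding R_def by blast
  define s where "s n = (g ^^ n) x0" for n
  have sR: "s n \<in> R" for n by (induction n) (use x0R g in \<open>auto simp: s_def\<close>)
  have Ts: "T (s 0) = 0" "T (s (Suc n)) = s n" for n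
    using x0(1) g[OF sR[of n]] by (auto simp: s_def kernel_op_def)
  have ns: "norm (s n) \<le> C ^ n * norm x0" for n
  proof (induction n)
    case (Suc n)
    have "norm (s (Suc n)) \<le> C * norm (s n)" using g[OF sR[of n]] by (simp add: s_def)
    also have "\<dots> \<le> C * (C ^ n * norm x0)" using Suc C(1) by (intro mult_left_mono) auto
    finally show ?case by simp
  qed (simp add: s_def)
  have "kernel_op A (shift T \<mu>) \<noteq> {0}" if \<mu>: "cmod \<mu> < 1 / (3 * C)" for \<mu>
  proof -
    define t where "t n = \<mu> ^ n *\<^sub>C s n" for n
    have q: "cmod \<mu> * C \<le> 1 / 3" using \<mu> C(1) by (simp add: field_simps)
    have nt: "norm (t n) \<le> (1 / 3) ^ n * norm x0" for n
    proof -
      have "norm (t n) \<le> cmod \<mu> ^ n * (C ^ n * norm x0)"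
        unfolding t_def norm_scaleC norm_power using ns by (intro mult_left_mono) auto
      also have "\<dots> = (cmod \<mu> * C) ^ n * norm x0" by (simp add: power_mult_distrib)
      also have "\<dots> \<le> (1 / 3) ^ n * norm x0" using q C(1) by (intro mult_right_mono power_mono) auto
      finally show ?thesis .
    qed
    have geo: "(\<lambda>n. (1 / 3) ^ n * norm x0) sums (1 / (1 - 1 / 3) * norm x0)"
      by (intro sums_mult2 geometric_sums) simp
    have sumn: "summable (\<lambda>n. norm (t n))"
      using nt by (intro summable_comparison_test[OF _ sums_summable[OF geo]]) auto
    then have sm: "summable t" by (rule summable_norm_cancel)
    define y where "y = suminf t"
    have t0: "t 0 = x0" by (simp add: t_def s_def scaleC_one)
    have "y \<in> A"
    proof (rule closed_sequentially[OF A'(2)])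
      show "(\<lambda>n. \<Sum>i<n. t i) \<longlonglongrightarrow> y" unfolding y_def using sm by (rule summable_LIMSEQ)
      show "(\<Sum>i<n. t i) \<in> A" for n
        unfolding t_def using sR RA by (intro complex_vector.subspace_sum[OF A'(1)] complex_vector.subspace_scale[OF A'(1)]) auto
    qed
    moreover have "shift T \<mu> y = 0"
    proof -
      have "T y = (\<Sum>n. T (t n))" unfolding y_def by (rule T.suminf[OF sm])
      also have "\<dots> = (\<Sum>n. T (t (Suc n))) + T (t 0)"
        using suminf_split_head[OF T.summable[OF sm]] by simp
      also have "T (t 0) = 0" using Ts(1) by (simp add: t_def clinear_simps[OF cl])
      also have "(\<lambda>n. T (t (Suc n))) = (\<lambda>n. \<mu> *\<^sub>C t n)"
        by (simp add: t_def clinear_simps[OF cl] Ts(2))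
      also have "(\<Sum>n. \<mu> *\<^sub>C t n) = \<mu> *\<^sub>C y"
        unfolding y_def using bounded_linear.suminf[OF bounded_linear_scaleC_right sm] by simp
      finally show ?thesis by (simp add: shift_def)
    qed
    moreover have "y \<noteq> 0"
    proof
      assume "y = 0"
      then have "x0 = - (\<Sum>n. t (Suc n))"
        using suminf_split_head[OF sm] t0 by (simp add: y_def)
      then have "norm x0 = norm (\<Sum>n. t (Suc n))" by simp
      also have "\<dots> \<le> (\<Sum>n. norm (t (Suc n)))"
        using iffD2[OF summable_Suc_iff[of "\<lambda>n. norm (t n)"] sumn] by (rule summable_norm)
      also have "\<dots> \<le> (\<Sum>n. (1 / 3) ^ Suc n * norm x0)"
        using sumn sums_summable[OF geo] summable_Suc_iff[of "\<lambda>n. norm (t n)"]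
          summable_Suc_iff[of "\<lambda>n. (1 / 3) ^ n * norm x0"] by (intro suminf_le nt) simp_all
      also have "\<dots> = 1 / 2 * norm x0"
        using suminf_split_head[OF sums_summable[OF geo]] sums_unique[OF geo] by simp
      finally show False using x0(2) by simp
    qed
    ultimately show ?thesis by (auto simp: kernel_op_def)
  qed
  then show ?thesis using C(1) by (intro exI[of _ "1 / (3 * C)"]) auto
qed

text \<open>The kernel of the first Kato summand would otherwise survive all small shifts.\<close>

lemma splitting_if_injective_nearby:
  assumes T: "bounded_op UNIV T" and M: "closed_invariant T M" and usf: "upper_semi_fredholm M T"
    and near: "\<And>\<epsilon>. \<epsilon> > 0 \<Longrightarrow> \<exists>\<mu>. cmod \<mu> < \<epsilon> \<and> kernel_op M (shift T \<mu>) = {0}"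
  shows "\<exists>A B n. splits T M A B \<and> (\<forall>x\<in>B. (T ^^ n) x = 0) \<and> bounded_below A T"
proof -
  note cl = bounded_op_imp_clinear[OF T]
  obtain A B n where s: "splits T M A B" and nil: "\<forall>x\<in>B. (T ^^ n) x = 0"
    and kato: "\<And>k. kernel_op A T \<subseteq> (T ^^ k) ` A" using kato_decomposition[OF T M usf] by blast
  have A: "closed_invariant T A" using s by (simp add: splits_def)
  have usfA: "upper_semi_fredholm A T"
    using T M usf A splits_superset(1)[OF s] by (rule upper_semi_fredholm_restrict)
  have "kernel_op A T = {0}"
  proof (rule ccontr)
    assume "kernel_op A T \<noteq> {0}"
    then obtain \<epsilon> where \<epsilon>: "\<epsilon> > 0" "\<And>\<mu>. cmod \<mu> < \<epsilon> \<Longrightarrow> kernel_op A (shift T \<mu>) \<noteq> {0}"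
      using kernel_persists_in_hyperrange[OF T A usfA kato] by blast
    obtain \<mu> where \<mu>: "cmod \<mu> < \<epsilon>" "kernel_op M (shift T \<mu>) = {0}" using near[OF \<epsilon>(1)] by blast
    have "kernel_op A (shift T \<mu>) = {0}"
      using splits_kernel_eq_zero_iff[OF bounded_op_imp_clinear[OF bounded_op_shift[OF T]] splits_shift[OF s]] \<mu>(2)
      by blast
    then show False using \<epsilon>(2)[OF \<mu>(1)] by blast
  qed
  then have "bounded_below A T"
    using usfA by (intro bounded_below_if_kernel[OF T closed_invariantD(1,2)[OF A]])
      (simp_all add: upper_semi_fredholm_def)
  with s nil show ?thesis by blast
qed

lemma bij_shift_near:
  assumes T: "bounded_op UNIV T" and M: "closed_invariant T M" and bij: "bij_betw T M M"
  shows "\<exists>\<epsilon>>0. \<forall>\<mu>. cmod \<mu> < \<epsilon> \<longrightarrow> bij_betw (shift T \<mu>) M M"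
proof -
  note cl = bounded_op_imp_clinear[OF T] and M' = closed_invariantD[OF M]
  have ker: "kernel_op M T = {0}" and im: "T ` M = M"
    using bij inj_on_iff_kernel[OF cl M'(1)] by (auto simp: bij_betw_def)
  have "bounded_below M T" using bounded_below_if_kernel[OF T M'(1,2) ker] im M'(2) by simp
  then obtain \<epsilon> where \<epsilon>: "\<epsilon> > 0" "\<And>\<mu>. cmod \<mu> < \<epsilon> \<Longrightarrow> bounded_below M (shift T \<mu>)"
    using bounded_below_shift_near by blast
  have z: "complex_vector.subspace {0 :: 'a}" "closed {0 :: 'a}" "{0} \<subseteq> M"
    using complex_vector.subspace_0[OF M'(1)] by auto
  have sur: "M \<subseteq> sum_space (T ` M) {0}" by (auto simp: sum_space_def im)
  obtain C \<delta> where C: "C > 0" "\<delta> > 0" "\<forall>\<mu>. cmod \<mu> < \<delta> \<longrightarrow>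
      (\<forall>y\<in>M. \<exists>x\<in>M. \<exists>f\<in>{0}. y = shift T \<mu> x + f \<and> norm x \<le> C * norm y \<and> norm f \<le> C * norm y)"
    using surjective_shift_near[OF T M'(1,2) M'(1,2) subset_refl M'(3) z sur] by (elim exE conjE)
  have "bij_betw (shift T \<mu>) M M" if \<mu>: "cmod \<mu> < min \<epsilon> \<delta>" for \<mu>
  proof -
    have cls: "clinear (shift T \<mu>)" using bounded_op_imp_clinear[OF bounded_op_shift[OF T]] .
    have "kernel_op M (shift T \<mu>) = {0}"
      using \<epsilon>(2) \<mu> complex_vector.subspace_0[OF M'(1)] clinear_simps(3)[OF cls]
      by (intro bounded_below_kernel) auto
    then have "inj_on (shift T \<mu>) M" using inj_on_iff_kernel[OF cls M'(1)] by simp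
    moreover have "M \<subseteq> shift T \<mu> ` M"
    proof
      fix y assume "y \<in> M"
      then obtain x where "x \<in> M" "y = shift T \<mu> x" using C(3) \<mu> by fastforce
      then show "y \<in> shift T \<mu> ` M" by blast
    qed
    ultimately show ?thesis
      using closed_invariantD(3)[OF closed_invariant_shift[OF M]] by (auto simp: bij_betw_def)
  qed
  then show ?thesis using \<epsilon>(1) C(2) by (intro exI[of _ "min \<epsilon> \<delta>"]) auto
qed

lemma bij_fredholm_index:
  assumes T: "clinear T" and M: "complex_vector.subspace M" "closed M" and bij: "bij_betw T M M"
  shows "fredholm M T" "index_op M T = 0"
proof -
  have "kernel_op M T = {0}" "T ` M = M"
    using bij inj_on_iff_kernel[OF T M(1)] by (auto simp: bij_betw_def)
  then show "fredholm M T" "index_op M T = 0"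
    using M by (simp_all add: fredholm_def upper_semi_fredholm_def lower_semi_fredholm_def index_op_def
        edim_zero codim_self)
qed

lemma bounded_below_usf_index:
  assumes T: "bounded_op UNIV T" and M: "complex_vector.subspace M" "closed M" and bb: "bounded_below M T"
  shows "upper_semi_fredholm M T" "index_op M T \<le> 0" "kernel_op M T = {0}"
proof -
  note cl = bounded_op_imp_clinear[OF T]
  show ker: "kernel_op M T = {0}"
    using bb complex_vector.subspace_0[OF M(1)] clinear_simps(3)[OF cl] by (rule bounded_below_kernel)
  show "upper_semi_fredholm M T"
    using bounded_below_closed[OF bounded_op_imp_bounded_linear[OF T] subspace_if_csubspace[OF M(1)] M(2) bb] ker
    by (simp add: upper_semi_fredholm_def edim_zero)
  show "index_op M T \<le> 0" using ker by (cases "codim M (T ` M)") (auto simp: index_op_def edim_zero)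
qed

text \<open>The index is \<open>0\<close> after the shift, hence before it, and an injective operator of index \<open>0\<close> is surjective.\<close>

lemma bij_if_bounded_below_and_bij_nearby:
  assumes T: "bounded_op UNIV T" and M: "closed_invariant T M" and bb: "bounded_below M T"
    and near: "\<And>\<epsilon>. \<epsilon> > 0 \<Longrightarrow> \<exists>\<mu>. cmod \<mu> < \<epsilon> \<and> bij_betw (shift T \<mu>) M M"
  shows "bij_betw T M M"
proof -
  note cl = bounded_op_imp_clinear[OF T] and M' = closed_invariantD[OF M]
  note bb' = bounded_below_usf_index[OF T M'(1,2) bb]
  obtain \<epsilon> where \<epsilon>: "\<epsilon> > 0" "\<And>\<mu>. cmod \<mu> < \<epsilon> \<Longrightarrow> index_op M (shift T \<mu>) = index_op M T"
    using upper_semi_fredholm_shift_near[OF T M bb'(1)] by blast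
  obtain \<mu> where \<mu>: "cmod \<mu> < \<epsilon>" "bij_betw (shift T \<mu>) M M" using near[OF \<epsilon>(1)] by blast
  have "index_op M T = 0"
    using \<epsilon>(2)[OF \<mu>(1)] bij_fredholm_index(2)[OF bounded_op_imp_clinear[OF bounded_op_shift[OF T]] M'(1,2) \<mu>(2)] by simp
  then have "codim M (T ` M) = 0"
    using bb'(3) by (cases "codim M (T ` M)") (auto simp: index_op_def edim_zero zero_enat_def)
  then have "T ` M = M" using codim_eq_0_iff[OF csubspace_image[OF cl M'(1)] M'(3,1)] by simp
  then show ?thesis using bb'(3) inj_on_iff_kernel[OF cl M'(1)] by (simp add: bij_betw_def)
qed

lemma splitting_if_bij_nearby:
  assumes T: "bounded_op UNIV T" and M: "closed_invariant T M" and usf: "upper_semi_fredholm M T"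
    and near: "\<And>\<epsilon>. \<epsilon> > 0 \<Longrightarrow> \<exists>\<mu>. cmod \<mu> < \<epsilon> \<and> bij_betw (shift T \<mu>) M M"
  shows "\<exists>A B n. splits T M A B \<and> (\<forall>x\<in>B. (T ^^ n) x = 0) \<and> bij_betw T A A"
proof -
  note cls = bounded_op_imp_clinear[OF bounded_op_shift[OF T]]
  have "\<exists>\<mu>. cmod \<mu> < \<epsilon> \<and> kernel_op M (shift T \<mu>) = {0}" if "\<epsilon> > 0" for \<epsilon>
    using near[OF that] inj_on_iff_kernel[OF cls closed_invariantD(1)[OF M]] by (auto simp: bij_betw_def)
  then obtain A B n where s: "splits T M A B" and nil: "\<forall>x\<in>B. (T ^^ n) x = 0" and bb: "bounded_below A T"
    using splitting_if_injective_nearby[OF T M usf] by blast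
  have "\<exists>\<mu>. cmod \<mu> < \<epsilon> \<and> bij_betw (shift T \<mu>) A A" if "\<epsilon> > 0" for \<epsilon>
    using near[OF that] splits_bij_iff[OF cls splits_shift[OF s]] by blast
  then have "bij_betw T A A"
    using s by (intro bij_if_bounded_below_and_bij_nearby[OF T _ bb]) (simp_all add: splits_def)
  with s nil show ?thesis by blast
qed

lemma splits_nilpotent_power:
  assumes T: "clinear T" and s: "splits T M A B" and nil: "\<forall>x\<in>B. (T ^^ n) x = 0" and k: "n \<le> k"
  shows "a \<in> A \<Longrightarrow> b \<in> B \<Longrightarrow> (T ^^ k) (a + b) = (T ^^ k) a"
proof -
  assume "b \<in> B"
  have "(T ^^ k) b = (T ^^ (k - n)) ((T ^^ n) b)" using k by (simp flip: funpow_add comp_apply[of "T ^^ (k - n)"])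
  then show "(T ^^ k) (a + b) = (T ^^ k) a"
    using nil \<open>b \<in> B\<close> by (simp add: clinear_simps[OF clinear_funpow[OF T]])
qed

lemma splits_nilpotent_range:
  assumes T: "clinear T" and s: "splits T M A B" and nil: "\<forall>x\<in>B. (T ^^ n) x = 0" and k: "n \<le> k"
  shows "(T ^^ k) ` M = (T ^^ k) ` A"
proof (intro equalityI subsetI)
  fix y assume "y \<in> (T ^^ k) ` M"
  then obtain x where x: "x \<in> sum_space A B" "y = (T ^^ k) x" using s by (auto simp: splits_def)
  obtain a b where "a \<in> A" "b \<in> B" "x = a + b" using x(1) by (rule sum_spaceE)
  then show "y \<in> (T ^^ k) ` A" using splits_nilpotent_power[OF T s nil k] x(2) by auto
qed (use splits_superset(1)[OF s] in blast)

lemma finite_ascent_if_splits: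
  assumes T: "clinear T" and s: "splits T M A B" and nil: "\<forall>x\<in>B. (T ^^ n) x = 0" and ker: "kernel_op A T = {0}"
  shows "finite_ascent M T"
proof -
  have A: "T ` A \<subseteq> A" using s by (simp add: splits_def closed_invariant_def)
  have "x \<in> kernel_op M (T ^^ n)" if x: "x \<in> kernel_op M (T ^^ Suc n)" for x
  proof -
    have "x \<in> sum_space A B" using x s by (simp add: kernel_op_def splits_def)
    then obtain a b where ab: "a \<in> A" "b \<in> B" "x = a + b" by (rule sum_spaceE)
    have "T ((T ^^ n) a) = 0"
      using x splits_nilpotent_power[OF T s nil, of "Suc n" a b] ab by (simp add: kernel_op_def)
    then have "(T ^^ n) a \<in> kernel_op A T" using ab(1) funpow_image_subset[OF A, of n] by (auto simp: kernel_op_def)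
    then have "(T ^^ n) x = 0" using ker splits_nilpotent_power[OF T s nil order_refl ab(1,2)] ab(3) by auto
    then show ?thesis using x by (simp add: kernel_op_def)
  qed
  moreover have "kernel_op M (T ^^ n) \<subseteq> kernel_op M (T ^^ Suc n)"
    by (auto simp: kernel_op_def clinear_simps[OF T])
  ultimately show ?thesis unfolding finite_ascent_def by (intro exI[of _ n]) blast
qed

lemma finite_descent_if_splits:
  assumes T: "clinear T" and s: "splits T M A B" and nil: "\<forall>x\<in>B. (T ^^ n) x = 0" and im: "T ` A = A"
  shows "finite_descent M T"
proof -
  have "(T ^^ k) ` A = A" for k
  proof (induction k)
    case (Suc k)
    then show ?case unfolding funpow_image_Suc using im by simp
  qed simp
  then show ?thesis
    unfolding finite_descent_def using splits_nilpotent_range[OF T s nil]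
    by (intro exI[of _ n]) (simp del: funpow.simps)
qed

text \<open>A kernel vector \<open>x = T^n z\<close> with \<open>n\<close> beyond the ascent has \<open>z \<in> ker T^(n+1) = ker T^n\<close>, so \<open>x = 0\<close>.\<close>

lemma finite_ascent_imp_kernel_zero:
  assumes T: "clinear T" and s: "splits T M A B" and kato: "\<And>k. kernel_op A T \<subseteq> (T ^^ k) ` A"
    and fa: "finite_ascent M T"
  shows "kernel_op A T = {0}"
proof -
  obtain n where n: "kernel_op M (T ^^ n) = kernel_op M (T ^^ Suc n)" using fa by (auto simp: finite_ascent_def)
  have "x = 0" if x: "x \<in> kernel_op A T" for x
  proof -
    obtain z where z: "z \<in> A" "x = (T ^^ n) z" using kato x by blast
    have "z \<in> kernel_op M (T ^^ Suc n)" using z x splits_superset(1)[OF s] by (auto simp: kernel_op_def)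
    then show ?thesis using n z by (auto simp: kernel_op_def)
  qed
  moreover have "complex_vector.subspace A" using s by (simp add: splits_def closed_invariant_def)
  ultimately show ?thesis using complex_vector.subspace_0[OF csubspace_kernel[OF T]] by blast
qed

text \<open>Finite ascent makes the first Kato summand injective, hence bounded below, and this survives small shifts; on the
nilpotent summand every nonzero shift is invertible.\<close>

lemma upper_semi_browder_injective_nearby:
  assumes T: "bounded_op UNIV T" and M: "closed_invariant T M" and usb: "upper_semi_browder M T"
  shows "\<exists>\<epsilon>>0. \<forall>\<mu>. \<mu> \<noteq> 0 \<and> cmod \<mu> < \<epsilon> \<longrightarrow> kernel_op M (shift T \<mu>) = {0}"
proof -
  note cl = bounded_op_imp_clinear[OF T]
  have usf: "upper_semi_fredholm M T" and fa: "finite_ascent M T" using usb by (auto simp: upper_semi_browder_def)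
  obtain A B n where s: "splits T M A B" and nil: "\<forall>x\<in>B. (T ^^ n) x = 0"
    and kato: "\<And>k. kernel_op A T \<subseteq> (T ^^ k) ` A" using kato_decomposition[OF T M usf] by blast
  have A: "closed_invariant T A" and B: "closed_invariant T B" using s by (simp_all add: splits_def)
  have usfA: "upper_semi_fredholm A T"
    using T M usf A splits_superset(1)[OF s] by (rule upper_semi_fredholm_restrict)
  have "bounded_below A T"
    using usfA finite_ascent_imp_kernel_zero[OF cl s kato fa]
    by (intro bounded_below_if_kernel[OF T closed_invariantD(1,2)[OF A]]) (simp_all add: upper_semi_fredholm_def)
  then obtain \<epsilon> where \<epsilon>: "\<epsilon> > 0" "\<And>\<mu>. cmod \<mu> < \<epsilon> \<Longrightarrow> bounded_below A (shift T \<mu>)"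
    using bounded_below_shift_near by blast
  have "kernel_op M (shift T \<mu>) = {0}" if \<mu>: "\<mu> \<noteq> 0" "cmod \<mu> < \<epsilon>" for \<mu>
  proof -
    note Ts = bounded_op_shift[OF T, of \<mu>]
    have "kernel_op A (shift T \<mu>) = {0}"
      using bounded_below_usf_index(3)[OF Ts closed_invariantD(1,2)[OF A] \<epsilon>(2)[OF \<mu>(2)]] .
    moreover have "bij_betw (shift T \<mu>) B B"
      using bij_shift_nilpotent[OF cl closed_invariantD(1,3)[OF B] _ \<mu>(1)] nil by blast
    then have "kernel_op B (shift T \<mu>) = {0}"
      using inj_on_iff_kernel[OF bounded_op_imp_clinear[OF Ts] closed_invariantD(1)[OF B]] by (simp add: bij_betw_def)
    ultimately show ?thesis
      using splits_kernel_eq_zero_iff[OF bounded_op_imp_clinear[OF Ts] splits_shift[OF s]] by simp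
  qed
  with \<epsilon>(1) show ?thesis by blast
qed

text \<open>Finite ascent makes the first Kato summand bounded below; since the nilpotent summand does not contribute to the ranges
of high powers, finite descent makes it surjective. Small nonzero shifts are then invertible on both summands.\<close>

lemma browder_bij_nearby:
  assumes T: "bounded_op UNIV T" and M: "closed_invariant T M" and br: "browder M T"
  shows "\<exists>\<epsilon>>0. \<forall>\<mu>. \<mu> \<noteq> 0 \<and> cmod \<mu> < \<epsilon> \<longrightarrow> bij_betw (shift T \<mu>) M M"
proof -
  note cl = bounded_op_imp_clinear[OF T]
  have usf: "upper_semi_fredholm M T" and fa: "finite_ascent M T" and fd: "finite_descent M T"
    using br by (auto simp: browder_def fredholm_def)
  obtain A B p where s: "splits T M A B" and nil: "\<forall>x\<in>B. (T ^^ p) x = 0"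
    and kato: "\<And>k. kernel_op A T \<subseteq> (T ^^ k) ` A" using kato_decomposition[OF T M usf] by blast
  have A: "closed_invariant T A" and B: "closed_invariant T B" using s by (simp_all add: splits_def)
  note A' = closed_invariantD[OF A]
  have ker: "kernel_op A T = {0}" using finite_ascent_imp_kernel_zero[OF cl s kato fa] .
  then have inj: "inj_on T A" using inj_on_iff_kernel[OF cl A'(1)] by simp
  obtain d where d: "(T ^^ d) ` M = (T ^^ Suc d) ` M" using fd by (auto simp: finite_descent_def)
  have "(T ^^ (d + i)) ` M = (T ^^ Suc (d + i)) ` M" for i
  proof (induction i)
    case (Suc i)
    have "(T ^^ (d + Suc i)) ` M = T ` ((T ^^ (d + i)) ` M)" using funpow_image_Suc[of "d + i" T M] by simp
    also have "\<dots> = T ` ((T ^^ Suc (d + i)) ` M)" using Suc by simp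
    also have "\<dots> = (T ^^ Suc (d + Suc i)) ` M" using funpow_image_Suc[of "Suc (d + i)" T M] by simp
    finally show ?case .
  qed (use d in simp)
  \<comment> \<open>The exponent \<open>d + p\<close> is at least the descent and at least the order of nilpotency.\<close>
  from this[of p] have eq: "(T ^^ (d + p)) ` A = (T ^^ Suc (d + p)) ` A"
    using splits_nilpotent_range[OF cl s nil, of "d + p"] splits_nilpotent_range[OF cl s nil, of "Suc (d + p)"]
    by (simp del: funpow.simps)
  have injk: "inj_on (T ^^ k) A" for k
  proof (induction k)
    case (Suc k)
    have "inj_on T ((T ^^ k) ` A)" using inj_on_subset[OF inj funpow_image_subset[OF A'(3)]] .
    then show ?case using comp_inj_on[OF Suc] by (simp add: comp_def)
  qed simp
  have "A \<subseteq> T ` A"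
  proof
    fix a assume a: "a \<in> A"
    then have "(T ^^ (d + p)) a \<in> (T ^^ Suc (d + p)) ` A" unfolding eq[symmetric] by (rule imageI)
    then obtain z where z: "z \<in> A" "(T ^^ (d + p)) a = (T ^^ (d + p)) (T z)" by (auto simp: funpow_swap1)
    then have "a = T z" using inj_onD[OF injk z(2) a] A'(3) by blast
    then show "a \<in> T ` A" using z(1) by blast
  qed
  then have "bij_betw T A A" using A'(3) inj by (auto simp: bij_betw_def)
  then obtain \<epsilon> where \<epsilon>: "\<epsilon> > 0" "\<And>\<mu>. cmod \<mu> < \<epsilon> \<Longrightarrow> bij_betw (shift T \<mu>) A A"
    using bij_shift_near[OF T A] by blast
  have "bij_betw (shift T \<mu>) M M" if \<mu>: "\<mu> \<noteq> 0" "cmod \<mu> < \<epsilon>" for \<mu>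
  proof -
    have "bij_betw (shift T \<mu>) B B"
      using bij_shift_nilpotent[OF cl closed_invariantD(1,3)[OF B] _ \<mu>(1)] nil by blast
    then show ?thesis
      using splits_bij_iff[OF bounded_op_imp_clinear[OF bounded_op_shift[OF T]] splits_shift[OF s]] \<epsilon>(2)[OF \<mu>(2)] by simp
  qed
  with \<epsilon>(1) show ?thesis by blast
qed

lemma small_nonzero_complex:
  assumes "\<epsilon> > 0" shows "\<exists>\<mu> :: complex. \<mu> \<noteq> 0 \<and> cmod \<mu> < \<epsilon>"
  using assms by (intro exI[of _ "complex_of_real (\<epsilon> / 2)"]) simp

text \<open>The index is stable and vanishes at invertible operators.\<close>

lemma browder_imp_weyl:
  assumes T: "bounded_op UNIV T" and br: "browder UNIV T"
  shows "weyl UNIV T"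
proof -
  have fr: "fredholm UNIV T" using br by (simp add: browder_def)
  obtain \<epsilon> where \<epsilon>: "\<epsilon> > 0" "\<And>\<mu>. \<mu> \<noteq> 0 \<Longrightarrow> cmod \<mu> < \<epsilon> \<Longrightarrow> bij_betw (shift T \<mu>) UNIV UNIV"
    using browder_bij_nearby[OF T closed_invariant_UNIV br] by blast
  obtain \<delta> where \<delta>: "\<delta> > 0" "\<And>\<mu>. cmod \<mu> < \<delta> \<Longrightarrow> index_op UNIV (shift T \<mu>) = index_op UNIV T"
    using upper_semi_fredholm_shift_near[OF T closed_invariant_UNIV] fr unfolding fredholm_def by blast
  obtain \<mu> :: complex where "\<mu> \<noteq> 0" "cmod \<mu> < min \<epsilon> \<delta>" using small_nonzero_complex[of "min \<epsilon> \<delta>"] \<epsilon>(1) \<delta>(1) by auto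
  then have "index_op UNIV T = 0"
    using \<epsilon>(2) \<delta>(2) bij_fredholm_index(2)[OF bounded_op_imp_clinear[OF bounded_op_shift[OF T]] _ _ \<epsilon>(2)] by force
  then show ?thesis using fr by (simp add: weyl_def)
qed

lemma upper_semi_browder_imp_upper_semi_weyl:
  assumes T: "bounded_op UNIV T" and br: "upper_semi_browder UNIV T"
  shows "upper_semi_weyl UNIV T"
proof -
  have fr: "upper_semi_fredholm UNIV T" using br by (simp add: upper_semi_browder_def)
  obtain \<epsilon> where \<epsilon>: "\<epsilon> > 0" "\<And>\<mu>. \<mu> \<noteq> 0 \<Longrightarrow> cmod \<mu> < \<epsilon> \<Longrightarrow> kernel_op UNIV (shift T \<mu>) = {0}"
    using upper_semi_browder_injective_nearby[OF T closed_invariant_UNIV br] by blast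
  obtain \<delta> where \<delta>: "\<delta> > 0" "\<And>\<mu>. cmod \<mu> < \<delta> \<Longrightarrow> index_op UNIV (shift T \<mu>) = index_op UNIV T"
    using upper_semi_fredholm_shift_near[OF T closed_invariant_UNIV fr] by blast
  obtain \<mu> :: complex where \<mu>: "\<mu> \<noteq> 0" "cmod \<mu> < \<epsilon>" "cmod \<mu> < \<delta>"
    using small_nonzero_complex[of "min \<epsilon> \<delta>"] \<epsilon>(1) \<delta>(1) by auto
  have "index_op UNIV (shift T \<mu>) \<le> 0"
    unfolding index_op_def \<epsilon>(2)[OF \<mu>(1,2)] edim_zero
    by (cases "codim UNIV (range (shift T \<mu>))") auto
  then show ?thesis using fr \<delta>(2)[OF \<mu>(3)] by (simp add: upper_semi_weyl_def)
qed


section \<open>Splittings with a zeroloid summand\<close>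

text \<open>Stated for an arbitrary open set rather than a disc about the origin, so that it can be applied to two zeroloid parts in turn.\<close>

lemma zeroloid_gap:
  assumes T: "bounded_op UNIV T" and N: "closed_invariant T N" and z: "zeroloid N T"
    and U: "open U" "U \<noteq> {}"
  shows "\<exists>V. open V \<and> V \<noteq> {} \<and> V \<subseteq> U \<and> (\<forall>\<mu>\<in>V. bij_betw (shift T \<mu>) N N)"
proof -
  have "U \<noteq> {0}" using U(1) not_open_singleton[of "0 :: complex"] by auto
  then obtain a where a: "a \<in> U" "a \<noteq> 0" using U(2) by blast
  then have "\<not> a islimpt spectrum_op N T" using z by (auto simp: zeroloid_def)
  then obtain W where W: "a \<in> W" "open W" "\<And>y. y \<in> W \<Longrightarrow> y \<in> spectrum_op N T \<Longrightarrow> y = a"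
    unfolding islimpt_def by blast
  let ?V = "U \<inter> W - {a}"
  have "bij_betw (shift T \<mu>) N N" if "\<mu> \<in> ?V" for \<mu>
    using that W(3) invertible_iff_bij[OF bounded_op_shift[OF T] closed_invariant_shift[OF N]]
    by (auto simp: spectrum_op_def)
  moreover have "open (U \<inter> W)" using U(1) W(2) by (rule open_Int)
  then have "open ?V" "U \<inter> W \<noteq> {a}" using not_open_singleton[of a] by (auto intro: open_delete)
  moreover have "a \<in> U \<inter> W" using a W by simp
  ultimately show ?thesis by (intro exI[of _ ?V]) auto
qed

text \<open>Two splittings are compared at one small shift that is invertible on both zeroloid parts: there both indices
equal the index of the shifted operator on the whole space.\<close>

lemma gz_index_eq:
  assumes T: "bounded_op UNIV T" and s: "splits T UNIV M N" and sf: "semi_fredholm M T" and z: "zeroloid N T"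
  shows "gz_index T = index_op M T"
  unfolding gz_index_def
proof (rule the_equality)
  show "\<exists>(M', N')\<in>Red T. semi_fredholm M' T \<and> zeroloid N' T \<and> index_op M T = index_op M' T"
    using s sf z by (intro bexI[of _ "(M, N)"]) (auto simp: Red_iff_splits)
next
  fix k assume "\<exists>(M, N)\<in>Red T. semi_fredholm M T \<and> zeroloid N T \<and> k = index_op M T"
  then obtain M' N' where s': "splits T UNIV M' N'" and sf': "semi_fredholm M' T" and z': "zeroloid N' T"
    and k: "k = index_op M' T" by (auto simp: Red_iff_splits)
  have inv: "closed_invariant T M" "closed_invariant T N" "closed_invariant T M'" "closed_invariant T N'"
    using s s' by (auto simp: splits_def)
  obtain \<epsilon> where \<epsilon>: "\<epsilon> > 0" "\<And>\<mu>. cmod \<mu> < \<epsilon> \<Longrightarrow> index_op M (shift T \<mu>) = index_op M T"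
    using semi_fredholm_shift_near[OF T inv(1) sf] by blast
  obtain \<epsilon>' where \<epsilon>': "\<epsilon>' > 0" "\<And>\<mu>. cmod \<mu> < \<epsilon>' \<Longrightarrow> index_op M' (shift T \<mu>) = index_op M' T"
    using semi_fredholm_shift_near[OF T inv(3) sf'] by blast
  have "ball 0 (min \<epsilon> \<epsilon>') \<noteq> {}" using \<epsilon>(1) \<epsilon>'(1) by simp
  then obtain V where V: "open V" "V \<noteq> {}" "V \<subseteq> ball 0 (min \<epsilon> \<epsilon>')" "\<forall>\<mu>\<in>V. bij_betw (shift T \<mu>) N N"
    using zeroloid_gap[OF T inv(2) z open_ball] by meson
  obtain V' where V': "V' \<noteq> {}" "V' \<subseteq> V" "\<forall>\<mu>\<in>V'. bij_betw (shift T \<mu>) N' N'"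
    using zeroloid_gap[OF T inv(4) z' V(1,2)] by blast
  obtain \<mu> where \<mu>: "\<mu> \<in> V'" using V'(1) by blast
  then have "cmod \<mu> < \<epsilon>" "cmod \<mu> < \<epsilon>'" and bij: "bij_betw (shift T \<mu>) N N" "bij_betw (shift T \<mu>) N' N'"
    using V V' by auto
  note cls = bounded_op_imp_clinear[OF bounded_op_shift[OF T]]
  have "index_op M T = index_op UNIV (shift T \<mu>)"
    using \<epsilon>(2)[OF \<open>cmod \<mu> < \<epsilon>\<close>] semi_fredholm_invertible_part(3)[OF cls splits_shift[OF s] closed_UNIV bij(1)] by simp
  moreover have "index_op M' T = index_op UNIV (shift T \<mu>)"
    using \<epsilon>'(2)[OF \<open>cmod \<mu> < \<epsilon>'\<close>] semi_fredholm_invertible_part(3)[OF cls splits_shift[OF s'] closed_UNIV bij(2)] by simp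
  ultimately show "k = index_op M T" using k by simp
qed

text \<open>The nilpotent summand adds at most the point \<open>0\<close> to the spectrum, and hence no accumulation point.\<close>

lemma zeroloid_add_nilpotent:
  assumes T: "bounded_op UNIV T" and N: "closed_invariant T N" "zeroloid N T"
    and s: "splits T L B N" and nil: "\<forall>x\<in>B. (T ^^ n) x = 0" and L: "closed L"
  shows "zeroloid L T"
proof -
  note cl = bounded_op_imp_clinear[OF T]
  have B: "closed_invariant T B" using s by (simp add: splits_def)
  have Linv: "closed_invariant T L"
  proof -
    have "T ` L = sum_space (T ` B) (T ` N)" using splits_image[OF cl s] .
    also have "\<dots> \<subseteq> L"
      using closed_invariantD(3)[OF B] closed_invariantD(3)[OF N(1)] splits_superset[OF s]
      by (intro sum_space_subset) auto
    finally show ?thesis using L splits_superset(3)[OF s] by (simp add: closed_invariant_def)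
  qed
  have sub: "spectrum_op L T \<subseteq> insert 0 (spectrum_op N T)"
  proof
    fix \<mu> assume "\<mu> \<in> spectrum_op L T"
    then have nb: "\<not> bij_betw (shift T \<mu>) L L"
      using invertible_iff_bij[OF bounded_op_shift[OF T] closed_invariant_shift[OF Linv]] by (simp add: spectrum_op_def)
    show "\<mu> \<in> insert 0 (spectrum_op N T)"
    proof (cases "\<mu> = 0")
      case False
      have "bij_betw (shift T \<mu>) B B"
        using bij_shift_nilpotent[OF cl closed_invariantD(1,3)[OF B] _ False] nil by blast
      then have "\<not> bij_betw (shift T \<mu>) N N"
        using nb splits_bij_iff[OF bounded_op_imp_clinear[OF bounded_op_shift[OF T]] splits_shift[OF s]] by simp
      then show ?thesis
        using invertible_iff_bij[OF bounded_op_shift[OF T] closed_invariant_shift[OF N(1)]] by (simp add: spectrum_op_def)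
    qed simp
  qed
  show ?thesis
    unfolding zeroloid_def
  proof
    fix \<mu> assume "\<mu> \<in> {\<mu>. \<mu> islimpt spectrum_op L T}"
    then have "\<mu> islimpt insert 0 (spectrum_op N T)" using islimpt_subset[OF _ sub] by simp
    then have "\<mu> islimpt spectrum_op N T" by (simp add: islimpt_insert)
    then show "\<mu> \<in> {0}" using N(2) by (auto simp: zeroloid_def)
  qed
qed

text \<open>A nilpotent summand of \<open>M\<close> can be counted with the zeroloid part.\<close>

lemma splits_absorb_nilpotent:
  assumes T: "bounded_op UNIV T" and s: "splits T UNIV M N" and z: "zeroloid N T"
    and sM: "splits T M A B" and nil: "\<forall>x\<in>B. (T ^^ n) x = 0"
  shows "splits T UNIV A (sum_space B N) \<and> zeroloid (sum_space B N) T"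
proof -
  note cl = bounded_op_imp_clinear[OF T]
  have 1: "splits T UNIV A (sum_space B N)" using splits_assoc[OF s sM cl closed_UNIV] .
  have N: "closed_invariant T N" "closed_invariant T B" "M \<inter> N = {0}" using s sM by (simp_all add: splits_def)
  have "B \<inter> N = {0}"
    using N(3) splits_superset(2)[OF sM] complex_vector.subspace_0[OF closed_invariantD(1)[OF N(2)]] by blast
  then have "splits T (sum_space B N) B N" using N by (simp add: splits_def)
  moreover have "closed (sum_space B N)" using 1 by (simp add: splits_def closed_invariant_def)
  ultimately have "zeroloid (sum_space B N) T" using zeroloid_add_nilpotent[OF T N(1) z _ nil] by blast
  with 1 show ?thesis by simp
qed

lemma gz_invertibleI:
  assumes "splits T UNIV M N" "bij_betw T M M" "zeroloid N T" and T: "bounded_op UNIV T"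
  shows "gz_invertible T"
proof -
  have M: "closed_invariant T M" using assms(1) by (simp add: splits_def)
  note M' = closed_invariantD[OF M]
  have "kernel_op M T = {0}" "T ` M = M"
    using assms(2) inj_on_iff_kernel[OF bounded_op_imp_clinear[OF T] M'(1)] by (auto simp: bij_betw_def)
  then have "bounded_below M T" "surjective_op M T"
    using bounded_below_if_kernel[OF T M'(1,2)] M'(2) by (simp_all add: surjective_op_def)
  then show ?thesis using assms(1,3) Red_iff_splits
    unfolding gz_invertible_def left_gz_invertible_def right_gz_invertible_def by blast
qed

text \<open>Left and right invertibility a priori come with different splittings. At small shifts that are invertible on both zeroloid
parts the operator is injective by the first splitting and surjective by the second, hence invertible on the bounded below
summand; letting the shift tend to \<open>0\<close> gives invertibility there.\<close>

lemma gz_invertibleE: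
  assumes T: "bounded_op UNIV T" and gz: "gz_invertible T"
  obtains M N where "splits T UNIV M N" "bij_betw T M M" "zeroloid N T"
proof -
  note cls = bounded_op_imp_clinear[OF bounded_op_shift[OF T]]
  obtain M N where s: "splits T UNIV M N" and bb: "bounded_below M T" and z: "zeroloid N T"
    using gz by (auto simp: gz_invertible_def left_gz_invertible_def Red_iff_splits)
  obtain M' N' where s': "splits T UNIV M' N'" and sur: "T ` M' = M'" and z': "zeroloid N' T"
    using gz by (auto simp: gz_invertible_def right_gz_invertible_def Red_iff_splits surjective_op_def)
  have inv: "closed_invariant T M" "closed_invariant T N" "closed_invariant T M'" "closed_invariant T N'"
    using s s' by (auto simp: splits_def)
  note M = closed_invariantD[OF inv(1)] and M' = closed_invariantD[OF inv(3)]
  obtain \<epsilon>1 where \<epsilon>1: "\<epsilon>1 > 0" "\<And>\<mu>. cmod \<mu> < \<epsilon>1 \<Longrightarrow> bounded_below M (shift T \<mu>)"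
    using bounded_below_shift_near[OF bb] by blast
  have z0: "complex_vector.subspace {0 :: 'a}" "closed {0 :: 'a}" "{0} \<subseteq> M'"
    using complex_vector.subspace_0[OF M'(1)] by auto
  have surM': "M' \<subseteq> sum_space (T ` M') {0}" by (auto simp: sum_space_def sur)
  obtain C \<epsilon>2 where \<epsilon>2: "C > 0" "\<epsilon>2 > 0" "\<forall>\<mu>. cmod \<mu> < \<epsilon>2 \<longrightarrow>
      (\<forall>y\<in>M'. \<exists>x\<in>M'. \<exists>f\<in>{0}. y = shift T \<mu> x + f \<and> norm x \<le> C * norm y \<and> norm f \<le> C * norm y)"
    using surjective_shift_near[OF T M'(1,2) M'(1,2) subset_refl M'(3) z0 surM'] by (elim exE conjE)
  have "\<exists>\<mu>. cmod \<mu> < \<epsilon> \<and> bij_betw (shift T \<mu>) M M" if \<epsilon>: "\<epsilon> > 0" for \<epsilon>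
  proof -
    have "ball 0 (min \<epsilon> (min \<epsilon>1 \<epsilon>2)) \<noteq> {}" using \<epsilon> \<epsilon>1(1) \<epsilon>2(2) by simp
    then obtain V where V: "open V" "V \<noteq> {}" "V \<subseteq> ball 0 (min \<epsilon> (min \<epsilon>1 \<epsilon>2))" "\<forall>\<mu>\<in>V. bij_betw (shift T \<mu>) N N"
      using zeroloid_gap[OF T inv(2) z open_ball] by meson
    obtain V' where V': "V' \<noteq> {}" "V' \<subseteq> V" "\<forall>\<mu>\<in>V'. bij_betw (shift T \<mu>) N' N'"
      using zeroloid_gap[OF T inv(4) z' V(1,2)] by blast
    obtain \<mu> where "\<mu> \<in> V'" using V'(1) by blast
    then have \<mu>: "cmod \<mu> < \<epsilon>" "cmod \<mu> < \<epsilon>1" "cmod \<mu> < \<epsilon>2" and bij: "bij_betw (shift T \<mu>) N N" "bij_betw (shift T \<mu>) N' N'"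
      using V V' by auto
    have "kernel_op M (shift T \<mu>) = {0}"
      using \<epsilon>1(2)[OF \<mu>(2)] complex_vector.subspace_0[OF M(1)] clinear_simps(3)[OF cls] by (rule bounded_below_kernel)
    moreover have "kernel_op N (shift T \<mu>) = {0}"
      using bij(1) inj_on_iff_kernel[OF cls closed_invariantD(1)[OF inv(2)]] by (simp add: bij_betw_def)
    ultimately have "kernel_op UNIV (shift T \<mu>) = {0}"
      using splits_kernel_eq_zero_iff[OF cls splits_shift[OF s]] by simp
    moreover have "shift T \<mu> ` M' = M'"
    proof
      show "M' \<subseteq> shift T \<mu> ` M'"
      proof
        fix y assume "y \<in> M'"
        then obtain x where "x \<in> M'" "y = shift T \<mu> x" using \<epsilon>2(3) \<mu>(3) by fastforce
        then show "y \<in> shift T \<mu> ` M'" by blast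
      qed
    qed (rule closed_invariantD(3)[OF closed_invariant_shift[OF inv(3)]])
    then have "range (shift T \<mu>) = UNIV"
      using splits_image_eq_iff[OF cls splits_shift[OF s']] bij(2) by (simp add: bij_betw_def)
    ultimately have "bij_betw (shift T \<mu>) UNIV UNIV"
      using inj_on_iff_kernel[OF cls complex_vector.subspace_UNIV] by (simp add: bij_betw_def)
    then have "bij_betw (shift T \<mu>) M M" using splits_bij_iff[OF cls splits_shift[OF s]] by simp
    with \<mu>(1) show ?thesis by blast
  qed
  then have "bij_betw T M M" by (rule bij_if_bounded_below_and_bij_nearby[OF T inv(1) bb])
  then show thesis using that s z by blast
qed

lemma small_shift_off_zeroloid_part:
  assumes T: "bounded_op UNIV T" and s: "splits T UNIV M N" and z: "zeroloid N T" and \<epsilon>: "\<epsilon> > 0"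
  shows "\<exists>\<mu>. cmod \<mu> < \<epsilon> \<and> bij_betw (shift T \<mu>) N N"
proof -
  have "closed_invariant T N" using s by (simp add: splits_def)
  moreover have "ball (0 :: complex) \<epsilon> \<noteq> {}" using \<epsilon> by simp
  ultimately obtain V where "V \<noteq> {}" "V \<subseteq> ball 0 \<epsilon>" "\<forall>\<mu>\<in>V. bij_betw (shift T \<mu>) N N"
    using zeroloid_gap[OF T _ z open_ball] by meson
  then show ?thesis by (metis mem_ball_0 subset_iff ex_in_conv)
qed

text \<open>The hypothesis \<open>near\<close> is only required for shifts that keep the index, so that it follows from the condition on Weyl
operators and from the one on Fredholm operators alike.\<close>

lemma gz_invertible_if_nearby_browder:
  assumes T: "bounded_op UNIV T" and s: "splits T UNIV M N" and fr: "fredholm M T" and z: "zeroloid N T"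
    and near: "\<And>\<mu>. fredholm UNIV (shift T \<mu>) \<Longrightarrow> index_op UNIV (shift T \<mu>) = index_op M T \<Longrightarrow> browder UNIV (shift T \<mu>)"
  shows "gz_invertible T"
proof -
  have M: "closed_invariant T M" using s by (simp add: splits_def)
  have usf: "upper_semi_fredholm M T" and lsf: "lower_semi_fredholm M T" using fr by (auto simp: fredholm_def)
  note cls = bounded_op_imp_clinear[OF bounded_op_shift[OF T]]
  obtain \<epsilon>1 where \<epsilon>1: "\<epsilon>1 > 0" "\<And>\<mu>. cmod \<mu> < \<epsilon>1 \<Longrightarrow> upper_semi_fredholm M (shift T \<mu>) \<and> index_op M (shift T \<mu>) = index_op M T"
    using upper_semi_fredholm_shift_near[OF T M usf] by blast
  obtain \<epsilon>2 where \<epsilon>2: "\<epsilon>2 > 0" "\<And>\<mu>. cmod \<mu> < \<epsilon>2 \<Longrightarrow> lower_semi_fredholm M (shift T \<mu>)"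
    using lower_semi_fredholm_shift_near[OF T M lsf] by blast
  have "\<exists>\<mu>. cmod \<mu> < \<epsilon> \<and> bij_betw (shift T \<mu>) M M" if \<epsilon>: "\<epsilon> > 0" for \<epsilon>
  proof -
    have "min \<epsilon> (min \<epsilon>1 \<epsilon>2) > 0" using \<epsilon> \<epsilon>1(1) \<epsilon>2(1) by simp
    then obtain \<mu> where "cmod \<mu> < min \<epsilon> (min \<epsilon>1 \<epsilon>2)" and bij: "bij_betw (shift T \<mu>) N N"
      using small_shift_off_zeroloid_part[OF T s z] by blast
    then have \<mu>: "cmod \<mu> < \<epsilon>" "cmod \<mu> < \<epsilon>1" "cmod \<mu> < \<epsilon>2" by auto
    have br: "browder UNIV (shift T \<mu>)"
      using semi_fredholm_invertible_part[OF cls splits_shift[OF s] closed_UNIV bij] \<epsilon>1(2)[OF \<mu>(2)] \<epsilon>2(2)[OF \<mu>(3)]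
      by (intro near) (simp_all add: fredholm_def)
    obtain \<delta> where \<delta>: "\<delta> > 0" "\<And>\<nu>. \<nu> \<noteq> 0 \<Longrightarrow> cmod \<nu> < \<delta> \<Longrightarrow> bij_betw (shift T (\<mu> + \<nu>)) UNIV UNIV"
      using browder_bij_nearby[OF bounded_op_shift[OF T] closed_invariant_UNIV br] unfolding shift_shift by blast
    \<comment> \<open>A second, still smaller shift passes from the Browder operator to an invertible one.\<close>
    obtain \<nu> :: complex where \<nu>: "\<nu> \<noteq> 0" "cmod \<nu> < \<delta>" "cmod \<nu> < \<epsilon> - cmod \<mu>"
      using small_nonzero_complex[of "min \<delta> (\<epsilon> - cmod \<mu>)"] \<delta>(1) \<mu>(1) by auto
    have "bij_betw (shift T (\<mu> + \<nu>)) M M"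
      using splits_bij_iff[OF cls splits_shift[OF s]] \<delta>(2)[OF \<nu>(1,2)] by simp
    moreover have "cmod (\<mu> + \<nu>) < \<epsilon>" using norm_triangle_ineq[of \<mu> \<nu>] \<nu>(3) by simp
    ultimately show ?thesis by blast
  qed
  then obtain A B n where sM: "splits T M A B" and nil: "\<forall>x\<in>B. (T ^^ n) x = 0" and bij: "bij_betw T A A"
    using splitting_if_bij_nearby[OF T M usf] by blast
  then show ?thesis using splits_absorb_nilpotent[OF T s z sM nil] gz_invertibleI[OF _ bij _ T] by blast
qed

lemma left_gz_invertible_if_nearby_browder:
  assumes T: "bounded_op UNIV T" and s: "splits T UNIV M N" and usf: "upper_semi_fredholm M T" and z: "zeroloid N T"
    and near: "\<And>\<mu>. upper_semi_fredholm UNIV (shift T \<mu>) \<Longrightarrow> index_op UNIV (shift T \<mu>) = index_op M T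
                 \<Longrightarrow> upper_semi_browder UNIV (shift T \<mu>)"
  shows "left_gz_invertible T"
proof -
  have M: "closed_invariant T M" using s by (simp add: splits_def)
  note cls = bounded_op_imp_clinear[OF bounded_op_shift[OF T]]
  obtain \<epsilon>1 where \<epsilon>1: "\<epsilon>1 > 0" "\<And>\<mu>. cmod \<mu> < \<epsilon>1 \<Longrightarrow> upper_semi_fredholm M (shift T \<mu>) \<and> index_op M (shift T \<mu>) = index_op M T"
    using upper_semi_fredholm_shift_near[OF T M usf] by blast
  have "\<exists>\<mu>. cmod \<mu> < \<epsilon> \<and> kernel_op M (shift T \<mu>) = {0}" if \<epsilon>: "\<epsilon> > 0" for \<epsilon>
  proof -
    have "min \<epsilon> \<epsilon>1 > 0" using \<epsilon> \<epsilon>1(1) by simp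
    then obtain \<mu> where "cmod \<mu> < min \<epsilon> \<epsilon>1" and bij: "bij_betw (shift T \<mu>) N N"
      using small_shift_off_zeroloid_part[OF T s z] by blast
    then have \<mu>: "cmod \<mu> < \<epsilon>" "cmod \<mu> < \<epsilon>1" by auto
    have br: "upper_semi_browder UNIV (shift T \<mu>)"
      using semi_fredholm_invertible_part[OF cls splits_shift[OF s] closed_UNIV bij] \<epsilon>1(2)[OF \<mu>(2)]
      by (intro near) simp_all
    obtain \<delta> where \<delta>: "\<delta> > 0" "\<And>\<nu>. \<nu> \<noteq> 0 \<Longrightarrow> cmod \<nu> < \<delta> \<Longrightarrow> kernel_op UNIV (shift T (\<mu> + \<nu>)) = {0}"
      using upper_semi_browder_injective_nearby[OF bounded_op_shift[OF T] closed_invariant_UNIV br]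
      unfolding shift_shift by blast
    obtain \<nu> :: complex where \<nu>: "\<nu> \<noteq> 0" "cmod \<nu> < \<delta>" "cmod \<nu> < \<epsilon> - cmod \<mu>"
      using small_nonzero_complex[of "min \<delta> (\<epsilon> - cmod \<mu>)"] \<delta>(1) \<mu>(1) by auto
    have "kernel_op M (shift T (\<mu> + \<nu>)) = {0}"
      using splits_kernel_eq_zero_iff[OF cls splits_shift[OF s]] \<delta>(2)[OF \<nu>(1,2)] by simp
    moreover have "cmod (\<mu> + \<nu>) < \<epsilon>" using norm_triangle_ineq[of \<mu> \<nu>] \<nu>(3) by simp
    ultimately show ?thesis by blast
  qed
  then obtain A B n where sM: "splits T M A B" and nil: "\<forall>x\<in>B. (T ^^ n) x = 0" and bb: "bounded_below A T"
    using splitting_if_injective_nearby[OF T M usf] by blast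
  then show ?thesis using splits_absorb_nilpotent[OF T s z sM nil] Red_iff_splits
    unfolding left_gz_invertible_def by blast
qed

lemma fredholm_gz_invertible_imp_browder:
  assumes T: "bounded_op UNIV T" and fr: "fredholm UNIV T" and gz: "gz_invertible T"
  shows "browder UNIV T"
proof -
  note cl = bounded_op_imp_clinear[OF T] and cls = bounded_op_imp_clinear[OF bounded_op_shift[OF T]]
  obtain M N where s: "splits T UNIV M N" and bij: "bij_betw T M M" and z: "zeroloid N T"
    using gz_invertibleE[OF T gz] .
  have M: "closed_invariant T M" using s by (simp add: splits_def)
  obtain \<epsilon>1 where \<epsilon>1: "\<epsilon>1 > 0" "\<And>\<mu>. cmod \<mu> < \<epsilon>1 \<Longrightarrow> bij_betw (shift T \<mu>) M M"
    using bij_shift_near[OF T M bij] by blast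
  have "\<exists>\<mu>. cmod \<mu> < \<epsilon> \<and> bij_betw (shift T \<mu>) UNIV UNIV" if \<epsilon>: "\<epsilon> > 0" for \<epsilon>
  proof -
    have "min \<epsilon> \<epsilon>1 > 0" using \<epsilon> \<epsilon>1(1) by simp
    then obtain \<mu> where "cmod \<mu> < min \<epsilon> \<epsilon>1" "bij_betw (shift T \<mu>) N N"
      using small_shift_off_zeroloid_part[OF T s z] by blast
    then show ?thesis using splits_bij_iff[OF cls splits_shift[OF s]] \<epsilon>1(2) by (intro exI[of _ \<mu>]) simp
  qed
  then obtain A B n where sA: "splits T UNIV A B" and nil: "\<forall>x\<in>B. (T ^^ n) x = 0" and bijA: "bij_betw T A A"
    using splitting_if_bij_nearby[OF T closed_invariant_UNIV] fr unfolding fredholm_def by blast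
  have "closed_invariant T A" using sA by (simp add: splits_def)
  then have "kernel_op A T = {0}" "T ` A = A"
    using bijA inj_on_iff_kernel[OF cl closed_invariantD(1)] by (auto simp: bij_betw_def)
  then show ?thesis
    using fr finite_ascent_if_splits[OF cl sA nil] finite_descent_if_splits[OF cl sA nil] by (simp add: browder_def)
qed

lemma left_gz_invertible_imp_upper_semi_browder:
  assumes T: "bounded_op UNIV T" and usf: "upper_semi_fredholm UNIV T" and gz: "left_gz_invertible T"
  shows "upper_semi_browder UNIV T"
proof -
  note cl = bounded_op_imp_clinear[OF T] and cls = bounded_op_imp_clinear[OF bounded_op_shift[OF T]]
  obtain M N where s: "splits T UNIV M N" and bb: "bounded_below M T" and z: "zeroloid N T"
    using gz by (auto simp: left_gz_invertible_def Red_iff_splits)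
  have M: "closed_invariant T M" and N: "closed_invariant T N" using s by (simp_all add: splits_def)
  obtain \<epsilon>1 where \<epsilon>1: "\<epsilon>1 > 0" "\<And>\<mu>. cmod \<mu> < \<epsilon>1 \<Longrightarrow> bounded_below M (shift T \<mu>)"
    using bounded_below_shift_near[OF bb] by blast
  have "\<exists>\<mu>. cmod \<mu> < \<epsilon> \<and> kernel_op UNIV (shift T \<mu>) = {0}" if \<epsilon>: "\<epsilon> > 0" for \<epsilon>
  proof -
    have "min \<epsilon> \<epsilon>1 > 0" using \<epsilon> \<epsilon>1(1) by simp
    then obtain \<mu> where \<mu>: "cmod \<mu> < min \<epsilon> \<epsilon>1" "bij_betw (shift T \<mu>) N N"
      using small_shift_off_zeroloid_part[OF T s z] by blast
    have "kernel_op N (shift T \<mu>) = {0}"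
      using \<mu>(2) inj_on_iff_kernel[OF cls closed_invariantD(1)[OF N]] by (simp add: bij_betw_def)
    moreover have "kernel_op M (shift T \<mu>) = {0}"
      using bounded_below_usf_index(3)[OF bounded_op_shift[OF T] closed_invariantD(1,2)[OF M]] \<epsilon>1(2) \<mu>(1) by simp
    ultimately show ?thesis
      using splits_kernel_eq_zero_iff[OF cls splits_shift[OF s]] \<mu>(1) by (intro exI[of _ \<mu>]) simp
  qed
  then obtain A B n where sA: "splits T UNIV A B" and nil: "\<forall>x\<in>B. (T ^^ n) x = 0" and bbA: "bounded_below A T"
    using splitting_if_injective_nearby[OF T closed_invariant_UNIV usf] by blast
  have "closed_invariant T A" using sA by (simp add: splits_def)
  then have "kernel_op A T = {0}" using bounded_below_usf_index(3)[OF T closed_invariantD(1,2) bbA] by blast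
  then show ?thesis using usf finite_ascent_if_splits[OF cl sA nil] by (simp add: upper_semi_browder_def)
qed

lemma gz_invertible_imp_gz_weyl:
  assumes T: "bounded_op UNIV T" and gz: "gz_invertible T"
  shows "gz_weyl T"
proof -
  obtain M N where s: "splits T UNIV M N" and bij: "bij_betw T M M" and z: "zeroloid N T"
    using gz_invertibleE[OF T gz] .
  have M: "closed_invariant T M" using s by (simp add: splits_def)
  have fr: "fredholm M T" and ind: "index_op M T = 0"
    using bij_fredholm_index[OF bounded_op_imp_clinear[OF T] closed_invariantD(1,2)[OF M] bij] by auto
  have "gz_index T = 0" using gz_index_eq[OF T s _ z] fr ind by (simp add: fredholm_def semi_fredholm_def)
  moreover have "gz_fredholm T" using s fr z Red_iff_splits unfolding gz_fredholm_def by blast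
  ultimately show ?thesis by (simp add: gz_weyl_def)
qed

lemma left_gz_invertible_imp_upper_semi_gz_weyl:
  assumes T: "bounded_op UNIV T" and gz: "left_gz_invertible T"
  shows "upper_semi_gz_weyl T"
proof -
  obtain M N where s: "splits T UNIV M N" and bb: "bounded_below M T" and z: "zeroloid N T"
    using gz by (auto simp: left_gz_invertible_def Red_iff_splits)
  have M: "closed_invariant T M" using s by (simp add: splits_def)
  note bb' = bounded_below_usf_index[OF T closed_invariantD(1,2)[OF M] bb]
  have "gz_index T \<le> 0" using gz_index_eq[OF T s _ z] bb' by (simp add: semi_fredholm_def)
  moreover have "upper_semi_gz_fredholm T" using s bb'(1) z Red_iff_splits unfolding upper_semi_gz_fredholm_def by blast
  ultimately show ?thesis by (simp add: upper_semi_gz_weyl_def)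
qed

lemma zeroloid_zero:
  assumes T: "bounded_op UNIV T" shows "zeroloid {0} T"
proof -
  note cl = bounded_op_imp_clinear[OF T]
  have inv: "closed_invariant T {0}" by (simp add: closed_invariant_def clinear_simps[OF cl])
  have "bij_betw (shift T \<mu>) {0} {0}" for \<mu> by (simp add: bij_betw_def shift_def clinear_simps[OF cl])
  then have "spectrum_op {0} T = {}"
    using invertible_iff_bij[OF bounded_op_shift[OF T] closed_invariant_shift[OF inv]] by (simp add: spectrum_op_def)
  then show ?thesis by (simp add: zeroloid_def)
qed

lemma fredholm_imp_gz_fredholm:
  assumes T: "bounded_op UNIV T"
  shows "fredholm UNIV T \<Longrightarrow> gz_fredholm T" "upper_semi_fredholm UNIV T \<Longrightarrow> upper_semi_gz_fredholm T"
    "semi_fredholm UNIV T \<Longrightarrow> gz_index T = index_op UNIV T"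
proof -
  have s: "splits T UNIV UNIV {0}" using splits_trivial[OF closed_invariant_UNIV bounded_op_imp_clinear[OF T]] .
  note z = zeroloid_zero[OF T]
  show "fredholm UNIV T \<Longrightarrow> gz_fredholm T" "upper_semi_fredholm UNIV T \<Longrightarrow> upper_semi_gz_fredholm T"
    using s z Red_iff_splits unfolding gz_fredholm_def upper_semi_gz_fredholm_def by blast+
  show "semi_fredholm UNIV T \<Longrightarrow> gz_index T = index_op UNIV T" using gz_index_eq[OF T s _ z] .
qed


section \<open>The spectral characterization of the three classes\<close>

theorem theorem5p1:
  fixes T :: "'a::complex_banach \<Rightarrow> 'a"
  assumes "edim (UNIV :: 'a set) = \<infinity>"
    and "bounded_op UNIV T"
  shows "(class_B T \<longleftrightarrow> gz_weyl_spectrum T = gz_invertible_spectrum T) \<and>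
         (class_Be T \<longleftrightarrow> gz_fredholm_spectrum T = gz_invertible_spectrum T) \<and>
         (class_aB T \<longleftrightarrow> upper_semi_gz_weyl_spectrum T = left_gz_invertible_spectrum T)"
proof (intro conjI)
  have S: "bounded_op UNIV (shift T a)" for a using assms(2) by (rule bounded_op_shift)
  have gzw: "\<exists>M N. splits (shift T a) UNIV M N \<and> fredholm M (shift T a) \<and> zeroloid N (shift T a)
      \<and> (gz_weyl (shift T a) \<longleftrightarrow> index_op M (shift T a) = 0)" if f: "gz_fredholm (shift T a)" for a
  proof -
    obtain M N where "splits (shift T a) UNIV M N" "fredholm M (shift T a)" "zeroloid N (shift T a)"
      using f by (auto simp: gz_fredholm_def Red_iff_splits)
    moreover from this have "gz_index (shift T a) = index_op M (shift T a)"
      using gz_index_eq[OF S] by (simp add: fredholm_def semi_fredholm_def)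
    ultimately show ?thesis using f by (intro exI[of _ M] exI[of _ N]) (simp add: gz_weyl_def)
  qed
  have B: "class_B T \<longleftrightarrow> (\<forall>a. weyl UNIV (shift T a) \<longrightarrow> browder UNIV (shift T a))"
    using browder_imp_weyl[OF S] unfolding class_B_def weyl_spectrum_def browder_spectrum_def by blast
  have gzB: "gz_weyl_spectrum T = gz_invertible_spectrum T \<longleftrightarrow>
      (\<forall>a. gz_weyl (shift T a) \<longrightarrow> gz_invertible (shift T a))"
    using gz_invertible_imp_gz_weyl[OF S] unfolding gz_weyl_spectrum_def gz_invertible_spectrum_def by blast
  show "class_B T \<longleftrightarrow> gz_weyl_spectrum T = gz_invertible_spectrum T"
    unfolding B gzB
  proof (intro iffI allI impI)
    fix a assume B: "\<forall>a. weyl UNIV (shift T a) \<longrightarrow> browder UNIV (shift T a)" and w: "gz_weyl (shift T a)"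
    obtain M N where MN: "splits (shift T a) UNIV M N" "fredholm M (shift T a)" "zeroloid N (shift T a)"
      "index_op M (shift T a) = 0" using gzw[of a] w by (auto simp: gz_weyl_def)
    show "gz_invertible (shift T a)"
      by (rule gz_invertible_if_nearby_browder[OF S MN(1-3)]) (use B MN(4) in \<open>simp add: shift_shift weyl_def\<close>)
  next
    fix a assume gz: "\<forall>a. gz_weyl (shift T a) \<longrightarrow> gz_invertible (shift T a)" and w: "weyl UNIV (shift T a)"
    have "gz_weyl (shift T a)"
      using w fredholm_imp_gz_fredholm[OF S[of a]] by (simp add: weyl_def gz_weyl_def fredholm_def semi_fredholm_def)
    then show "browder UNIV (shift T a)"
      using gz w by (intro fredholm_gz_invertible_imp_browder[OF S]) (simp_all add: weyl_def)
  qed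
  have Be: "class_Be T \<longleftrightarrow> (\<forall>a. fredholm UNIV (shift T a) \<longrightarrow> browder UNIV (shift T a))"
    unfolding class_Be_def fredholm_spectrum_def browder_spectrum_def browder_def by blast
  have gzBe: "gz_fredholm_spectrum T = gz_invertible_spectrum T \<longleftrightarrow>
      (\<forall>a. gz_fredholm (shift T a) \<longrightarrow> gz_invertible (shift T a))"
    using gz_invertible_imp_gz_weyl[OF S] unfolding gz_fredholm_spectrum_def gz_invertible_spectrum_def gz_weyl_def by blast
  show "class_Be T \<longleftrightarrow> gz_fredholm_spectrum T = gz_invertible_spectrum T"
    unfolding Be gzBe
  proof (intro iffI allI impI)
    fix a assume Be: "\<forall>a. fredholm UNIV (shift T a) \<longrightarrow> browder UNIV (shift T a)" and f: "gz_fredholm (shift T a)"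
    obtain M N where MN: "splits (shift T a) UNIV M N" "fredholm M (shift T a)" "zeroloid N (shift T a)"
      using gzw[OF f] by blast
    show "gz_invertible (shift T a)"
      by (rule gz_invertible_if_nearby_browder[OF S MN]) (use Be in \<open>simp add: shift_shift\<close>)
  next
    fix a assume gz: "\<forall>a. gz_fredholm (shift T a) \<longrightarrow> gz_invertible (shift T a)" and f: "fredholm UNIV (shift T a)"
    then show "browder UNIV (shift T a)"
      using fredholm_imp_gz_fredholm(1)[OF S] by (intro fredholm_gz_invertible_imp_browder[OF S]) auto
  qed
  have aB: "class_aB T \<longleftrightarrow> (\<forall>a. upper_semi_weyl UNIV (shift T a) \<longrightarrow> upper_semi_browder UNIV (shift T a))"
    using upper_semi_browder_imp_upper_semi_weyl[OF S]
    unfolding class_aB_def upper_semi_weyl_spectrum_def upper_semi_browder_spectrum_def by blast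
  have gzaB: "upper_semi_gz_weyl_spectrum T = left_gz_invertible_spectrum T \<longleftrightarrow>
      (\<forall>a. upper_semi_gz_weyl (shift T a) \<longrightarrow> left_gz_invertible (shift T a))"
    using left_gz_invertible_imp_upper_semi_gz_weyl[OF S]
    unfolding upper_semi_gz_weyl_spectrum_def left_gz_invertible_spectrum_def by blast
  show "class_aB T \<longleftrightarrow> upper_semi_gz_weyl_spectrum T = left_gz_invertible_spectrum T"
    unfolding aB gzaB
  proof (intro iffI allI impI)
    fix a assume aB: "\<forall>a. upper_semi_weyl UNIV (shift T a) \<longrightarrow> upper_semi_browder UNIV (shift T a)"
      and w: "upper_semi_gz_weyl (shift T a)"
    obtain M N where MN: "splits (shift T a) UNIV M N" "upper_semi_fredholm M (shift T a)" "zeroloid N (shift T a)"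
      using w by (auto simp: upper_semi_gz_weyl_def upper_semi_gz_fredholm_def Red_iff_splits)
    have "index_op M (shift T a) \<le> 0"
      using gz_index_eq[OF S MN(1) _ MN(3)] MN(2) w by (simp add: semi_fredholm_def upper_semi_gz_weyl_def)
    then show "left_gz_invertible (shift T a)"
      by (intro left_gz_invertible_if_nearby_browder[OF S MN]) (use aB in \<open>simp add: shift_shift upper_semi_weyl_def\<close>)
  next
    fix a assume gz: "\<forall>a. upper_semi_gz_weyl (shift T a) \<longrightarrow> left_gz_invertible (shift T a)"
      and w: "upper_semi_weyl UNIV (shift T a)"
    have "upper_semi_gz_weyl (shift T a)"
      using w fredholm_imp_gz_fredholm[OF S[of a]] by (simp add: upper_semi_weyl_def upper_semi_gz_weyl_def semi_fredholm_def)
    then show "upper_semi_browder UNIV (shift T a)"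
      using gz w by (intro left_gz_invertible_imp_upper_semi_browder[OF S]) (simp_all add: upper_semi_weyl_def)
  qed
qed

end
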